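(* Let $k\ge 1$, let $\theta_1,\dots,\theta_k\in[0,2\pi)$ be distinct, let $m_1,\dots,m_k$ be strictly positive integers, and let $\eta$ be the probability measure on $\partial\mathbb{D}$ $$d\eta(\theta)=Z_\eta^{-1}\prod_{j=1}^k[1-\cos(\theta-\theta_j)]^{m_j}\,\frac{d\theta}{2\pi},$$ where $Z_\eta$ is the normalization constant. Let $V$ be the associated potential $$V(e^{i\theta})=2\int\log|e^{i\theta}-e^{i\psi}|\,d\eta(\psi),$$ which is a Laurent polynomial, of degree $d$, without constant term, and let $G$ be the polynomial in $d+1$ successive variables $\alpha_j$ and their conjugates from the decomposition of $\operatorname{Tr}(V(U_N))$ described in the context. Let $\alpha=(\alpha_j)_{j\ge0}\in\mathbb{D}^\infty$ and let $\mu$ be the probability measure on $\partial\mathbb{D}$ whose Verblunsky coefficients are $\alpha$. Then $$\lim_{N\to\infty}\sum_{j=0}^N\left[G(\alpha_j,\dots,\alpha_{j+d})-\log(1-|\alpha_j|^2)\right]$$ exists (in $(-\infty,+\infty]$), and the limit is finite if and only if $H(\eta\,|\,\mu)$ is finite.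
   Context: $\mathbb{D}$ is the open unit disk in $\mathbb{C}$ and $\mathbb{D}^\infty=\prod_{j=0}^\infty\mathbb{D}$. Verblunsky coefficients: for a probability measure $\mu$ on $\partial\mathbb{D}$, let $\Phi_n$ be its monic orthogonal polynomials (if $\mu$ has exactly $N$ points in its support, $\Phi_n$ is defined for $n\le N$, with $\Phi_N$ the monic polynomial of degree $N$ vanishing at these points). The coefficients $\alpha_n$ are defined by $\Phi_{n+1}(z)=z\Phi_n(z)-\overline{\alpha}_n\Phi_n^*(z)$, $\Phi_0\equiv1$, $\Phi_n^*(z)=z^n\overline{\Phi_n(1/\bar z)}$. By Verblunsky's theorem this gives a bijection between measures of infinite support and $\mathbb{D}^\infty$, and between $N$-point measures and $\{(\alpha_0,\dots,\alpha_{N-1}):\alpha_0,\dots,\alpha_{N-2}\in\mathbb{D},\ \alpha_{N-1}\in\partial\mathbb{D}\}$. For probability measures $\nu,\mu$, $H(\nu|\mu)=\int\log\left(\frac{d\nu}{d\mu}\right)d\nu$ if $\nu$ is absolutely continuous with respect to $\mu$, and $H(\nu|\mu)=\infty$ otherwise. The degree of a Laurent polynomial $V(z)=\sum_{\ell=-d}^d c_\ell z^\ell$ is $d$ if $c_d\ne0$ and/or $c_{-d}\neq0$. CMV matrix: for $(\alpha_0,\dots,\alpha_{N-1})\in\mathbb{D}^{N-1}\times\partial\mathbb{D}$, with associated $N$-point measure $\mu_N$, $U_N$ is the $N\times N$ unitary matrix of multiplication by $z$ on $L^2(\partial\mathbb{D},d\mu_N)$ in the orthonormal basis obtained by applying Gram–Schmidt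 to $1,z,z^{-1},z^2,z^{-2},\dots$ (first $N$ elements). Decomposition: for a Laurent polynomial $V$ of degree $d$ without constant term, there exist polynomials $F_-,F_+$ (in $d$ successive $\alpha_j$'s and $\bar\alpha_j$'s) and $G$ (in $d+1$ successive $\alpha_j$'s and $\bar\alpha_j$'s), not depending on $N$, with $G(0,\dots,0)=0$ and, for all $N>d$, $$\operatorname{Tr}(V(U_N))=F_-(\alpha_0,\dots,\alpha_{d-1})+F_+(\alpha_{N-d},\dots,\alpha_{N-1})+\sum_{j=0}^{N-1-d}G(\alpha_j,\dots,\alpha_{j+d}).$$ Dependence on the $\bar\alpha_j$ is suppressed in the notation. Fix one such choice of $F_\pm,G$. *)

theory Defs
  imports
    "HOL-Probability.Probability"
    "HOL-Library.Poly_Mapping"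
    "HOL-Computational_Algebra.Polynomial"
    "Jordan_Normal_Form.Gauss_Jordan_Elimination"
begin

section \<open>Probability measures on the unit circle\<close>

text \<open>Measures on the circle are Borel measures on the complex plane that are carried by the
  unit circle.\<close>

definition circle_prob :: "complex measure \<Rightarrow> bool" where
  "circle_prob \<mu> \<longleftrightarrow> prob_space \<mu> \<and> sets \<mu> = sets borel \<and> (AE z in \<mu>. cmod z = 1)"

definition msupport :: "complex measure \<Rightarrow> complex set" where
  "msupport \<mu> = {z. \<forall>U. open U \<and> z \<in> U \<longrightarrow> emeasure \<mu> U > 0}"

text \<open>The Kullback-Leibler divergence of the library is a Bochner integral, which is \<open>0\<close> for a
  non-integrable integrand, so the extended-real version is defined here. The integral is split
  into positive and negative part; the latter is always finite since \<open>x ln x \<ge> - 1 / e\<close>.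
  Note that \<^term>\<open>RN_deriv \<mu> \<nu>\<close> is the density of \<open>\<nu>\<close> with respect to \<open>\<mu>\<close>.\<close>

definition rel_entropy :: "'a measure \<Rightarrow> 'a measure \<Rightarrow> ereal" where
  "rel_entropy \<nu> \<mu> =
     (if absolutely_continuous \<mu> \<nu> then
        enn2ereal (\<integral>\<^sup>+ x. ennreal (ln (enn2real (RN_deriv \<mu> \<nu> x))) \<partial>\<nu>)
          - enn2ereal (\<integral>\<^sup>+ x. ennreal (- ln (enn2real (RN_deriv \<mu> \<nu> x))) \<partial>\<nu>)
      else \<infinity>)"

section \<open>Verblunsky coefficients\<close>

text \<open>The monic orthogonal polynomials. For an \<open>N\<close>-point measure only the indices \<open>n \<le> N\<close> are
  meaningful.\<close>

definition opuc :: "complex measure \<Rightarrow> nat \<Rightarrow> complex poly" where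
  "opuc \<mu> n =
     (if finite (msupport \<mu>) \<and> n = card (msupport \<mu>) then (\<Prod>w\<in>msupport \<mu>. [:- w, 1:])
      else (THE p. lead_coeff p = 1 \<and> degree p = n \<and>
              (\<forall>q. degree q < n \<longrightarrow> (\<integral>z. cnj (poly q z) * poly p z \<partial>\<mu>) = 0)))"

definition rev_poly :: "complex poly \<Rightarrow> complex poly" where
  "rev_poly p = reflect_poly (map_poly cnj p)"

text \<open>For \<open>p\<close> of degree \<open>n\<close> this is the usual \<open>p\<^sup>*\<close>.\<close>

lemma poly_rev_poly:
  assumes "z \<noteq> 0"
  shows "poly (rev_poly p) z = z ^ degree p * cnj (poly p (1 / cnj z))"
proof -
  have deg: "degree (map_poly cnj p) = degree p"
    by (rule degree_map_poly) auto
  have "poly (map_poly cnj p) (inverse z) = cnj (poly p (cnj (inverse z)))"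
    by (simp add: poly_altdef deg coeff_map_poly)
  then show ?thesis
    using assms by (simp add: rev_poly_def poly_reflect_poly_nz deg divide_inverse)
qed

definition verblunsky_rec :: "complex measure \<Rightarrow> nat \<Rightarrow> complex \<Rightarrow> bool" where
  "verblunsky_rec \<mu> n a \<longleftrightarrow>
     opuc \<mu> (Suc n) = [:0, 1:] * opuc \<mu> n - Polynomial.smult (cnj a) (rev_poly (opuc \<mu> n))"

text \<open>\<open>\<mu>\<close> has infinite support and Verblunsky coefficients \<open>\<alpha>\<close>.\<close>

definition has_verblunsky :: "complex measure \<Rightarrow> (nat \<Rightarrow> complex) \<Rightarrow> bool" where
  "has_verblunsky \<mu> \<alpha> \<longleftrightarrow>
     circle_prob \<mu> \<and> infinite (msupport \<mu>) \<and> (\<forall>n. verblunsky_rec \<mu> n (\<alpha> n))"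

text \<open>\<open>\<mu>\<close> is an \<open>N\<close>-point measure with Verblunsky coefficients \<open>\<alpha> 0, \<dots>, \<alpha> (N - 1)\<close>.\<close>

definition has_verblunsky_fin :: "complex measure \<Rightarrow> nat \<Rightarrow> (nat \<Rightarrow> complex) \<Rightarrow> bool" where
  "has_verblunsky_fin \<mu> N \<alpha> \<longleftrightarrow>
     circle_prob \<mu> \<and> finite (msupport \<mu>) \<and> card (msupport \<mu>) = N \<and>
     (\<forall>n<N. verblunsky_rec \<mu> n (\<alpha> n))"

section \<open>CMV matrices\<close>

definition l2_inner :: "complex measure \<Rightarrow> (complex \<Rightarrow> complex) \<Rightarrow> (complex \<Rightarrow> complex) \<Rightarrow> complex"
  where "l2_inner \<mu> f g = (\<integral>z. cnj (f z) * g z \<partial>\<mu>)"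

definition l2_norm :: "complex measure \<Rightarrow> (complex \<Rightarrow> complex) \<Rightarrow> real" where
  "l2_norm \<mu> f = sqrt (\<integral>z. (cmod (f z))\<^sup>2 \<partial>\<mu>)"

text \<open>The sequence \<open>1, z, z\<^sup>-\<^sup>1, z\<^sup>2, z\<^sup>-\<^sup>2, \<dots>\<close>\<close>

definition cmv_monom :: "nat \<Rightarrow> complex \<Rightarrow> complex" where
  "cmv_monom n z = (if even n then z powi (- int (n div 2)) else z powi int (Suc n div 2))"

text \<open>Gram-Schmidt in \<open>L\<^sup>2(\<mu>)\<close>; for an \<open>N\<close>-point measure the indices \<open>n < N\<close> are meaningful.\<close>

fun cmv_basis :: "complex measure \<Rightarrow> nat \<Rightarrow> complex \<Rightarrow> complex" where
  "cmv_basis \<mu> n =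
     (let r = (\<lambda>z. cmv_monom n z
                    - (\<Sum>k<n. l2_inner \<mu> (cmv_basis \<mu> k) (cmv_monom n) * cmv_basis \<mu> k z))
      in (\<lambda>z. r z / complex_of_real (l2_norm \<mu> r)))"

declare cmv_basis.simps [simp del]

definition cmv_matrix :: "complex measure \<Rightarrow> nat \<Rightarrow> complex mat" where
  "cmv_matrix \<mu> N =
     mat N N (\<lambda>(i, j). l2_inner \<mu> (cmv_basis \<mu> i) (\<lambda>z. z * cmv_basis \<mu> j z))"

definition mat_trace :: "complex mat \<Rightarrow> complex" where
  "mat_trace A = (\<Sum>i<dim_row A. A $$ (i, i))"

definition mat_powi :: "complex mat \<Rightarrow> int \<Rightarrow> complex mat" where
  "mat_powi A l = (if l \<ge> 0 then A ^\<^sub>m nat l else the (mat_inverse A) ^\<^sub>m nat (- l))"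

section \<open>Laurent polynomials\<close>

text \<open>Laurent polynomials as finitely supported coefficient families \<open>(c\<^sub>l)\<close>, \<open>l \<in> \<int>\<close>.\<close>

type_synonym laurent = "int \<Rightarrow>\<^sub>0 complex"

definition laurent_eval :: "laurent \<Rightarrow> complex \<Rightarrow> complex" where
  "laurent_eval V z = (\<Sum>l\<in>Poly_Mapping.keys V. Poly_Mapping.lookup V l * z powi l)"

definition laurent_mat :: "laurent \<Rightarrow> complex mat \<Rightarrow> complex mat" where
  "laurent_mat V A =
     mat (dim_row A) (dim_col A) (\<lambda>(i, j).
       \<Sum>l\<in>Poly_Mapping.keys V. Poly_Mapping.lookup V l * mat_powi A l $$ (i, j))"

text \<open>The largest \<open>\<bar>l\<bar>\<close> with \<open>c\<^sub>l \<noteq> 0\<close>.\<close>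

definition laurent_degree :: "laurent \<Rightarrow> nat" where
  "laurent_degree V = Max (insert 0 ((\<lambda>l. nat \<bar>l\<bar>) ` Poly_Mapping.keys V))"

section \<open>Polynomials in successive variables and their conjugates\<close>

text \<open>Formal polynomials with finitely many monomials; the indeterminate \<open>Inl i\<close> stands for the
  \<open>i\<close>-th variable and \<open>Inr i\<close> for its complex conjugate.\<close>

type_synonym cpolynomial = "((nat + nat) \<Rightarrow>\<^sub>0 nat) \<Rightarrow>\<^sub>0 complex"

definition in_vars :: "nat \<Rightarrow> cpolynomial \<Rightarrow> bool" where
  "in_vars n P \<longleftrightarrow> (\<forall>e\<in>Poly_Mapping.keys P. Poly_Mapping.keys e \<subseteq> Inl ` {..<n} \<union> Inr ` {..<n})"

definition cp_eval :: "cpolynomial \<Rightarrow> (nat \<Rightarrow> complex) \<Rightarrow> complex" where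
  "cp_eval P x =
     (\<Sum>e\<in>Poly_Mapping.keys P. Poly_Mapping.lookup P e *
        (\<Prod>v\<in>Poly_Mapping.keys e.
          (case v of Inl i \<Rightarrow> x i | Inr i \<Rightarrow> cnj (x i)) ^ Poly_Mapping.lookup e v))"

text \<open>\<open>cp_shift P x j\<close> is \<open>P (x\<^sub>j, x\<^sub>j\<^sub>+\<^sub>1, \<dots>)\<close>.\<close>

definition cp_shift :: "cpolynomial \<Rightarrow> (nat \<Rightarrow> complex) \<Rightarrow> nat \<Rightarrow> complex" where
  "cp_shift P x j = cp_eval P (\<lambda>i. x (j + i))"

text \<open>The polynomials \<open>Fm\<close>, \<open>Fp\<close> (for \<open>F\<^sub>-\<close>, \<open>F\<^sub>+\<close>) and \<open>G\<close> decompose the traces of \<open>V\<close> of all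
  CMV matrices. By Verblunsky's theorem, for each coefficient tuple there is exactly one
  \<open>N\<close>-point measure \<open>\<mu>\<close>.\<close>

definition trace_decomposition ::
  "laurent \<Rightarrow> cpolynomial \<Rightarrow> cpolynomial \<Rightarrow> cpolynomial \<Rightarrow> bool" where
  "trace_decomposition V Fm Fp G \<longleftrightarrow>
     (let d = laurent_degree V in
        in_vars d Fm \<and> in_vars d Fp \<and> in_vars (Suc d) G \<and> cp_eval G (\<lambda>_. 0) = 0 \<and>
        (\<forall>N>d. \<forall>\<alpha> \<mu>.
           (\<forall>j<N - 1. cmod (\<alpha> j) < 1) \<longrightarrow> cmod (\<alpha> (N - 1)) = 1 \<longrightarrow> has_verblunsky_fin \<mu> N \<alpha> \<longrightarrow>
           mat_trace (laurent_mat V (cmv_matrix \<mu> N)) =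
             cp_shift Fm \<alpha> 0 + cp_shift Fp \<alpha> (N - d) + (\<Sum>j = 0..N - 1 - d. cp_shift G \<alpha> j)))"

section \<open>The reference measure and its potential\<close>

definition eta_weight :: "nat \<Rightarrow> (nat \<Rightarrow> real) \<Rightarrow> (nat \<Rightarrow> nat) \<Rightarrow> real \<Rightarrow> real" where
  "eta_weight k \<theta> m t = (\<Prod>j = 1..k. (1 - cos (t - \<theta> j)) ^ m j)"

text \<open>\<^term>\<open>uniform_measure lborel {0..<2 * pi}\<close> is \<open>dt / (2 \<pi>)\<close>.\<close>

definition eta :: "nat \<Rightarrow> (nat \<Rightarrow> real) \<Rightarrow> (nat \<Rightarrow> nat) \<Rightarrow> complex measure" where
  "eta k \<theta> m =
     (let M = uniform_measure lborel {0..<2 * pi};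
          Z = (\<integral>t. eta_weight k \<theta> m t \<partial>M)
      in distr (density M (\<lambda>t. ennreal (eta_weight k \<theta> m t / Z))) borel cis)"

text \<open>The convention \<open>ln 0 = 0\<close> at \<open>w = z\<close> only matters on a null set when \<open>\<nu>\<close> has no atoms.\<close>

definition is_potential :: "complex measure \<Rightarrow> laurent \<Rightarrow> bool" where
  "is_potential \<nu> V \<longleftrightarrow>
     (\<forall>z. cmod z = 1 \<longrightarrow> laurent_eval V z = complex_of_real (2 * (\<integral>w. ln (cmod (z - w)) \<partial>\<nu>)))"

end

theory Submission
  imports
    Defs
    "HOL-Complex_Analysis.Complex_Analysis"
    "Jordan_Normal_Form.Determinant"
    "HOL-Computational_Algebra.Fundamental_Theorem_Algebra"
    "HOL-Real_Asymp.Real_Asymp"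
begin

text \<open>Let \<open>\<phi>\<^sub>n\<close> and \<open>\<Phi>\<^sub>n\<close> be the orthonormal and the monic orthogonal polynomials of \<open>\<mu>\<close>. The
  Bernstein-Szego measure \<open>\<mu>\<^sub>n = \<bar>\<phi>\<^sub>n\<bar>\<^sup>-\<^sup>2 d\<theta> / 2\<pi>\<close> has Verblunsky coefficients \<open>\<alpha>\<^sub>0, \<dots>, \<alpha>\<^sub>n\<^sub>-\<^sub>1, 0, 0, \<dots>\<close>, and
  \<open>H(\<eta> | \<mu>\<^sub>n)\<close> is, up to a constant,
  \<open>S\<^sub>n = \<integral> ln \<bar>\<phi>\<^sub>n\<bar>\<^sup>2 d\<eta> = \<integral> ln \<bar>\<Phi>\<^sub>n\<bar>\<^sup>2 d\<eta> - \<Sum>\<^sub>j\<^sub><\<^sub>n ln (1 - \<bar>\<alpha>\<^sub>j\<bar>\<^sup>2)\<close>. As \<open>V\<close> is the logarithmic potential of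
  \<open>\<eta>\<close>, the sum of \<open>V\<close> over the zeros of a polynomial with zeros on the circle is the \<open>\<eta>\<close>-integral of its
  \<open>ln \<bar>\<cdot>\<bar>\<^sup>2\<close>; for a para-orthogonal polynomial it is the trace of \<open>V\<close> of a CMV matrix. Averaging over the
  unimodular last coefficient turns this into \<open>\<integral> ln \<bar>\<Phi>\<^sub>n\<bar>\<^sup>2 d\<eta>\<close>, so that \<open>S\<^sub>n\<close> differs from the partial sum
  of the theorem by a bounded quantity, which converges if \<open>\<alpha>\<^sub>j \<rightarrow> 0\<close>.

  The measures \<open>\<mu>\<^sub>n\<close> and \<open>\<mu>\<close> have the same moments up to \<open>n\<close>, and the relative entropy is lower semicontinuous.
  Hence \<open>S\<^sub>n \<rightarrow> \<infinity>\<close> if \<open>H(\<eta> | \<mu>) = \<infinity>\<close>. If \<open>H(\<eta> | \<mu>)\<close> is finite, then the density \<open>w\<close> of \<open>\<mu>\<close> is positive almost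
  everywhere, and semicontinuity for functions other than the density of \<open>\<eta>\<close> gives
  \<open>\<bar>\<phi>\<^sub>n\<bar> w\<^sup>1\<^sup>/\<^sup>2 \<rightarrow> 1\<close> in mean. This implies \<open>\<alpha>\<^sub>j \<rightarrow> 0\<close> (Rakhmanov's theorem) and the missing upper bound for
  \<open>lim S\<^sub>n\<close>.\<close>

section \<open>Measures on the unit circle\<close>

text \<open>The potential is represented by \<open>V\<close> on the circle only, while the zeros of
  \<open>\<Phi>\<^sub>n\<close> lie inside the disc; hence the detour over polynomials with zeros on
  the circle. The average over the last coefficient loses nothing because the logarithmic potential
  of normalized arc length vanishes on the circle. The trace decomposition speaks of finitely
  supported measures only, so the zeros have to carry a quadrature measure that has exactly the
  prescribed coefficients. The error of replacing \<alpha> by its truncation consists of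
  \<open>d\<close> values of \<open>G\<close> near the index \<open>n\<close>. Its boundedness
  suffices for divergence, but convergence needs \<open>\<alpha>\<^sub>j \<rightarrow> 0\<close>;
  this is what makes Rakhmanov's theorem necessary. Semicontinuity is tested on the indicator of a
  set where \<open>w\<close> is bounded above and below. Together with
  \<open>ln x \<le> x - 1\<close> and the normalization of \<open>\<phi>\<^sub>n\<close> this forces
  convergence in mean. The same inequality, applied to
  \<open>\<bar>\<phi>\<^sub>n\<bar> w\<^sup>1\<^sup>/\<^sup>2\<close> and multiplied by the bounded
  density of \<eta>, then yields the upper bound.\<close>

lemma continuous_on_circle_bounded:
  fixes f :: "complex \<Rightarrow> 'b::real_normed_vector"
  assumes "continuous_on (sphere 0 1) f"
  shows "\<exists>B. \<forall>z. cmod z = 1 \<longrightarrow> norm (f z) \<le> B"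
proof -
  have "compact (f ` sphere 0 1)" by (intro compact_continuous_image assms) auto
  then obtain B where "\<forall>x\<in>f ` sphere 0 1. norm x \<le> B"
    using compact_imp_bounded bounded_iff by metis
  then show ?thesis by (intro exI[of _ B]) auto
qed

locale circle_measure = finite_measure M for M :: "complex measure" +
  assumes sets_borel: "sets M = sets borel"
    and AE_circle: "AE z in M. cmod z = 1"
begin

lemma measurable_circle [simp]: "f \<in> borel_measurable M \<longleftrightarrow> f \<in> borel_measurable borel"
  by (simp add: measurable_cong_sets[OF sets_borel refl])

lemma space_circle [simp]: "space M = UNIV"
  using sets_eq_imp_space_eq[OF sets_borel] by simp

lemma integrable_bounded:
  fixes f :: "complex \<Rightarrow> 'b::{banach, second_countable_topology}"
  assumes "f \<in> borel_measurable borel" "\<And>z. cmod z = 1 \<Longrightarrow> norm (f z) \<le> B"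
  shows "integrable M f"
  by (rule integrable_const_bound[where B = B]) (use AE_circle assms in auto)

lemma integrable_continuous:
  fixes f :: "complex \<Rightarrow> 'b::{banach, second_countable_topology}"
  assumes "continuous_on UNIV f"
  shows "integrable M f"
proof -
  obtain B where "\<forall>z. cmod z = 1 \<longrightarrow> norm (f z) \<le> B"
    using continuous_on_circle_bounded[OF continuous_on_subset[OF assms]] by auto
  then show ?thesis
    using borel_measurable_continuous_onI[OF assms] by (intro integrable_bounded[where B = B]) auto
qed

lemma integral_cong_circle:
  fixes f g :: "complex \<Rightarrow> 'b::{banach, second_countable_topology}"
  assumes "f \<in> borel_measurable borel" "g \<in> borel_measurable borel"
    and "\<And>z. cmod z = 1 \<Longrightarrow> f z = g z"
  shows "(\<integral>z. f z \<partial>M) = (\<integral>z. g z \<partial>M)"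
  by (rule integral_cong_AE) (use AE_circle assms in auto)

lemma integral_mono_circle:
  fixes f g :: "complex \<Rightarrow> real"
  assumes "integrable M f" "integrable M g" "\<And>z. cmod z = 1 \<Longrightarrow> f z \<le> g z"
  shows "(\<integral>z. f z \<partial>M) \<le> (\<integral>z. g z \<partial>M)"
  by (rule integral_mono_AE) (use AE_circle assms in auto)

end

lemma circle_prob_circle_measure:
  assumes "circle_prob \<mu>"
  shows "circle_measure \<mu>"
proof -
  interpret prob_space \<mu> using assms by (simp add: circle_prob_def)
  show ?thesis by unfold_locales (use assms in \<open>auto simp: circle_prob_def\<close>)
qed

lemma circle_measure_density:
  assumes "circle_measure M" "f \<in> borel_measurable borel" "\<And>z. cmod z = 1 \<Longrightarrow> 0 \<le> f z"
    "\<And>z. cmod z = 1 \<Longrightarrow> f z \<le> B"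
  shows "circle_measure (density M (\<lambda>z. ennreal (f z)))"
proof -
  interpret circle_measure M by fact
  have m: "f \<in> borel_measurable M" using assms(2) by simp
  have "emeasure (density M (\<lambda>z. ennreal (f z))) UNIV = (\<integral>\<^sup>+z. ennreal (f z) \<partial>M)"
    using m space_circle by (subst emeasure_density) (auto simp: sets_borel)
  also have "\<dots> \<le> (\<integral>\<^sup>+z. ennreal B \<partial>M)"
    by (rule nn_integral_mono_AE) (use AE_circle assms in \<open>auto intro!: ennreal_leI\<close>)
  also have "\<dots> < \<infinity>"
    by (simp add: ennreal_mult_less_top emeasure_eq_measure)
  finally have "emeasure (density M (\<lambda>z. ennreal (f z))) UNIV < \<infinity>" .
  then have "finite_measure (density M (\<lambda>z. ennreal (f z)))"
    by (intro finite_measureI) (auto)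
  moreover have "AE z in density M (\<lambda>z. ennreal (f z)). cmod z = 1"
    using AE_circle m by (subst AE_density) auto
  ultimately show ?thesis
    by (auto simp: circle_measure_def circle_measure_axioms_def sets_borel)
qed

lemma (in circle_measure) integral_density_circle:
  fixes g :: "complex \<Rightarrow> 'b::{banach, second_countable_topology}"
  assumes "g \<in> borel_measurable borel" "f \<in> borel_measurable borel" "\<And>z. cmod z = 1 \<Longrightarrow> 0 \<le> f z"
  shows "(\<integral>z. g z \<partial>density M (\<lambda>z. ennreal (f z))) = (\<integral>z. f z *\<^sub>R g z \<partial>M)"
    and "integrable (density M (\<lambda>z. ennreal (f z))) g \<longleftrightarrow> integrable M (\<lambda>z. f z *\<^sub>R g z)"
proof -
  have ae: "AE z in M. 0 \<le> f z" using AE_circle assms(3) by auto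
  show "(\<integral>z. g z \<partial>density M (\<lambda>z. ennreal (f z))) = (\<integral>z. f z *\<^sub>R g z \<partial>M)"
    by (rule integral_density) (use assms ae in auto)
  show "integrable (density M (\<lambda>z. ennreal (f z))) g \<longleftrightarrow> integrable M (\<lambda>z. f z *\<^sub>R g z)"
    by (rule integrable_density) (use assms ae in auto)
qed

section \<open>Normalized arc length and the mean value property\<close>

definition circ :: "complex measure" where
  "circ = distr (uniform_measure lborel {0..<2 * pi}) borel cis"

lemma measurable_cis [measurable]: "cis \<in> borel_measurable borel"
  by (intro borel_measurable_continuous_onI continuous_intros)

lemma prob_space_circ: "prob_space circ"
  unfolding circ_def by (intro prob_space.prob_space_distr prob_space_uniform_measure) auto

lemma circle_prob_circ: "circle_prob circ"
proof -
  have "AE z in circ. cmod z = 1"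
    unfolding circ_def by (subst AE_distr_iff) auto
  then show ?thesis by (simp add: circle_prob_def prob_space_circ) (simp add: circ_def)
qed

interpretation circ: prob_space circ by (rule prob_space_circ)
interpretation circ: circle_measure circ by (rule circle_prob_circle_measure[OF circle_prob_circ])

lemma uniform_measure_circle: "uniform_measure lborel {0..<2 * pi} =
   density lborel (\<lambda>t. ennreal (indicator {0..<2 * pi} t / (2 * pi)))"
  unfolding uniform_measure_def
  by (rule density_cong) (auto simp: indicator_def divide_ennreal[symmetric] ennreal_1[symmetric] simp del: ennreal_1)

lemma integral_circ:
  fixes f :: "complex \<Rightarrow> complex"
  assumes [measurable]: "f \<in> borel_measurable borel"
  shows "(\<integral>z. f z \<partial>circ) = (\<integral>t. (indicator {0..<2 * pi} t / (2 * pi)) *\<^sub>R f (cis t) \<partial>lborel)"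
  unfolding circ_def uniform_measure_circle
  by (subst integral_distr, simp, simp, subst integral_density) (auto intro!: AE_I2)

theorem mean_value_circ:
  fixes f :: "complex \<Rightarrow> complex"
  assumes [measurable]: "f \<in> borel_measurable borel"
    and cont: "continuous_on (cball 0 1) f" and hol: "f holomorphic_on ball 0 1"
  shows "(\<integral>z. f z \<partial>circ) = f 0"
proof -
  have "((\<lambda>u. f u / (u - 0)) has_contour_integral 2 * complex_of_real pi * \<i> * f 0) (circlepath 0 1)"
    by (rule Cauchy_integral_circlepath[OF cont hol]) auto
  then have "((\<lambda>t. f (cis t) / cis t * \<i> * cis t) has_integral 2 * complex_of_real pi * \<i> * f 0) {0..2 * pi}"
    unfolding circlepath_def
    by (subst (asm) has_contour_integral_part_circlepath_iff) (auto simp: mult_ac)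
  then have "((\<lambda>t. (1 / (2 * pi * \<i>)) * (f (cis t) / cis t * \<i> * cis t)) has_integral (1 / (2 * pi * \<i>)) * (2 * complex_of_real pi * \<i> * f 0)) {0..2 * pi}"
    by (rule has_integral_mult_right)
  then have hk: "((\<lambda>t. (1 / (2 * pi)) *\<^sub>R f (cis t)) has_integral f 0) {0..2 * pi}"
    by (rule has_integral_eq_rhs[OF has_integral_eq, rotated]) (auto simp: scaleR_conv_of_real field_simps)
  have contf: "continuous_on {0..2 * pi} (\<lambda>t. (1 / (2 * pi)) *\<^sub>R f (cis t))"
    by (intro continuous_intros continuous_on_compose2[OF cont]) (auto)
  have si: "set_integrable lborel {0..2 * pi} (\<lambda>t. (1 / (2 * pi)) *\<^sub>R f (cis t))"
    by (rule borel_integrable_atLeastAtMost') (rule contf)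
  have "(LINT t:{0..2 * pi}|lborel. (1 / (2 * pi)) *\<^sub>R f (cis t)) = f 0"
    using set_borel_integral_eq_integral(2)[OF si] integral_unique[OF hk] by (rule trans)
  moreover have "(LINT t:{0..2 * pi}|lborel. (1 / (2 * pi)) *\<^sub>R f (cis t)) =
    (\<integral>t. (indicator {0..<2 * pi} t / (2 * pi)) *\<^sub>R f (cis t) \<partial>lborel)"
    unfolding set_lebesgue_integral_def
  proof (rule integral_cong_AE)
    \<comment> \<open>The contour integral runs over the closed interval, whereas
      \<open>circ\<close> comes from the half-open one; they differ in a single point.\<close>
    have "AE t in lborel. t \<noteq> 2 * pi" by (rule AE_lborel_singleton)
    then show "AE t in lborel. indicat_real {0..2 * pi} t *\<^sub>R (1 / (2 * pi)) *\<^sub>R f (cis t) =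
         (indicat_real {0..<2 * pi} t / (2 * pi)) *\<^sub>R f (cis t)"
      by eventually_elim (auto simp: indicator_def)
  qed measurable
  ultimately show ?thesis by (simp add: integral_circ)
qed

corollary integral_circ_power: "(\<integral>z. z ^ k \<partial>circ) = (if k = 0 then 1 else 0)"
  by (subst mean_value_circ) (auto intro!: continuous_intros holomorphic_intros)

section \<open>Orthogonal polynomials\<close>

definition pip :: "complex measure \<Rightarrow> complex poly \<Rightarrow> complex poly \<Rightarrow> complex" where
  "pip M p q = (\<integral>z. cnj (poly p z) * poly q z \<partial>M)"

text \<open>The recursion for an arbitrary sequence, without a measure: the same polynomials serve
  \<open>\<mu>\<close>, its Bernstein-Szego approximations and, with a unimodular last coefficient,
  the para-orthogonal case.\<close>

primrec szego :: "(nat \<Rightarrow> complex) \<Rightarrow> nat \<Rightarrow> complex poly" where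
  "szego a 0 = 1"
| "szego a (Suc n) = [:0, 1:] * szego a n - Polynomial.smult (cnj (a n)) (rev_poly (szego a n))"

text \<open>The squared norm of the monic polynomial for a probability measure with these
  coefficients, see \<open>pip_szego_self\<close>.\<close>

definition kappa :: "(nat \<Rightarrow> complex) \<Rightarrow> nat \<Rightarrow> real" where
  "kappa a n = (\<Prod>j<n. 1 - (cmod (a j))\<^sup>2)"

text \<open>Expresses that the first \<open>n\<close> coefficients of \<open>M\<close> are those of
  \<open>a\<close>, without the definite description in \<open>opuc\<close> and for any total
  mass.\<close>

definition orth :: "complex measure \<Rightarrow> (nat \<Rightarrow> complex) \<Rightarrow> nat \<Rightarrow> bool" where
  "orth M a n \<longleftrightarrow> (\<forall>k\<le>n. \<forall>j<k. pip M (monom 1 j) (szego a k) = 0)"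

lemma poly_rev_poly_circle:
  assumes "cmod z = 1"
  shows "poly (rev_poly p) z = z ^ degree p * cnj (poly p z)"
proof -
  have "z \<noteq> 0" "1 / cnj z = z"
    using assms complex_norm_square[of z] by (auto simp: divide_eq_eq)
  then show ?thesis using poly_rev_poly[of z p] by simp
qed

lemma degree_rev_poly_le: "degree (rev_poly p) \<le> degree p"
  using degree_reflect_poly_le[of "map_poly cnj p"] by (simp add: rev_poly_def degree_map_poly)

lemma poly_rev_poly_0: "poly (rev_poly p) 0 = cnj (lead_coeff p)"
  by (simp add: rev_poly_def poly_0_coeff_0 coeff_0_reflect_poly degree_map_poly coeff_map_poly)

lemma degree_szego [simp]: "degree (szego a n) = n"
  and lead_coeff_szego: "lead_coeff (szego a n) = 1"
proof (induction n)
  case (Suc n)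
  { case 1
    have "degree (Polynomial.smult (cnj (a n)) (rev_poly (szego a n))) < Suc n"
      using degree_smult_le degree_rev_poly_le Suc by (metis le_imp_less_Suc order_trans)
    moreover have "szego a n \<noteq> 0" using Suc by auto
    then have "degree ([:0, 1:] * szego a n) = Suc n"
      using Suc by (subst degree_mult_eq) auto
    ultimately show ?case
      by (simp only: szego.simps diff_conv_add_uminus) (subst degree_add_eq_left; simp) }
  note deg = this
  { case 2
    have "coeff (rev_poly (szego a n)) (Suc n) = 0"
      using degree_rev_poly_le[of "szego a n"] Suc by (intro coeff_eq_0) auto
    then show ?case using Suc deg by simp }
qed auto

lemma szego_neq_0 [simp]: "szego a n \<noteq> 0"
  using lead_coeff_szego[of a n] by auto

lemma coeff_szego_n [simp]: "coeff (szego a n) n = 1"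
  using lead_coeff_szego[of a n] by simp

lemma szego_cong: "(\<And>j. j < n \<Longrightarrow> a j = b j) \<Longrightarrow> szego a n = szego b n"
  by (induction n) auto

lemma kappa_pos: "(\<And>j. j < n \<Longrightarrow> cmod (a j) < 1) \<Longrightarrow> kappa a n > 0"
  unfolding kappa_def by (intro prod_pos) (simp add: abs_square_less_1)

lemma orth_mono: "orth M a n \<Longrightarrow> k \<le> n \<Longrightarrow> orth M a k"
  by (auto simp: orth_def)

lemma circle_cnj_power:
  assumes "cmod z = 1"
  shows "z ^ k * cnj z ^ k = 1" "cnj z ^ k * z ^ k = 1"
  using complex_norm_square[of z] assms by (simp_all add: power_mult_distrib[symmetric] mult.commute)

lemma circle_cnj_power_diff:
  assumes "cmod z = 1" "j \<le> n"
  shows "cnj z ^ j * z ^ n = z ^ (n - j)"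
  using circle_cnj_power[OF assms(1), of j] assms(2)
  by (metis (no_types, lifting) le_add_diff_inverse mult.assoc mult.left_neutral power_add)

lemma measurable_pip: "(\<lambda>z. cnj (poly p z) * poly q z) \<in> borel_measurable borel"
  by (intro borel_measurable_continuous_onI continuous_intros)

context circle_measure
begin

lemma integrable_pip [simp]: "integrable M (\<lambda>z. cnj (poly p z) * poly q z)"
  by (intro integrable_continuous continuous_intros)

lemma pip_add_right: "pip M p (q + r) = pip M p q + pip M p r"
  by (simp add: pip_def distrib_left)

lemma pip_diff_right: "pip M p (q - r) = pip M p q - pip M p r"
  by (simp add: pip_def right_diff_distrib)

lemma pip_smult_right: "pip M p (Polynomial.smult c q) = c * pip M p q"
  by (simp add: pip_def mult.left_commute)

lemma pip_zero_right [simp]: "pip M p 0 = 0"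
  by (simp add: pip_def)

lemma pip_sum_right: "pip M p (\<Sum>i\<in>A. f i) = (\<Sum>i\<in>A. pip M p (f i))"
  by (induction A rule: infinite_finite_induct) (auto simp: pip_add_right)

lemma pip_cnj: "cnj (pip M p q) = pip M q p"
  unfolding pip_def by (subst Bochner_Integration.integral_cnj[symmetric]) (simp add: mult.commute)

lemma pip_add_left: "pip M (q + r) p = pip M q p + pip M r p"
  by (metis pip_add_right pip_cnj complex_cnj_add)

lemma pip_smult_left: "pip M (Polynomial.smult c q) p = cnj c * pip M q p"
  by (metis pip_smult_right pip_cnj complex_cnj_mult)

lemma pip_zero_left [simp]: "pip M 0 p = 0"
  by (simp add: pip_def)

lemma pip_sum_left: "pip M (\<Sum>i\<in>A. f i) p = (\<Sum>i\<in>A. pip M (f i) p)"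
  by (induction A rule: infinite_finite_induct) (auto simp: pip_add_left)

lemma pip_X: "pip M ([:0, 1:] * p) ([:0, 1:] * q) = pip M p q"
  unfolding pip_def
proof (rule integral_cong_circle)
  fix z :: complex assume "cmod z = 1"
  then have "cnj z * z = 1" using circle_cnj_power(2)[of z 1] by simp
  then show "cnj (poly ([:0, 1:] * p) z) * poly ([:0, 1:] * q) z = cnj (poly p z) * poly q z"
    by (simp add: mult_ac)
qed (rule measurable_pip)+

lemma pip_self: "pip M p p = complex_of_real (\<integral>z. (cmod (poly p z))\<^sup>2 \<partial>M)"
proof -
  have "cnj w * w = complex_of_real ((cmod w)\<^sup>2)" for w
    by (subst complex_norm_square) (rule mult.commute)
  then show ?thesis
    unfolding pip_def by (simp only: integral_complex_of_real)
qed

lemma pip_self_nonneg: "Re (pip M p p) \<ge> 0" "Im (pip M p p) = 0"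
  by (simp_all add: pip_self)

text \<open>The bound on \<open>q\<close> is put on its coefficients and not on its degree so that
  \<open>k = 0\<close>, where it forces \<open>q = 0\<close>, is covered.\<close>

lemma pip_orthogonal:
  assumes "\<And>j. j < k \<Longrightarrow> pip M (monom 1 j) p = 0" "\<And>i. i \<ge> k \<Longrightarrow> coeff q i = 0"
  shows "pip M q p = 0" "pip M p q = 0"
proof -
  have "pip M q p = (\<Sum>i\<le>degree q. cnj (coeff q i) * pip M (monom 1 i) p)"
    by (subst poly_as_sum_of_monoms[symmetric, of q])
      (simp add: pip_sum_left pip_smult_left[symmetric] smult_monom del: poly_as_sum_of_monoms)
  also have "\<dots> = 0"
    by (intro sum.neutral) (metis assms complex_cnj_zero mult_eq_0_iff not_le)
  finally show "pip M q p = 0" .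
  then show "pip M p q = 0" by (metis pip_cnj complex_cnj_zero)
qed

lemma pip_rev_poly_monom:
  assumes "j \<le> degree p"
  shows "pip M (monom 1 j) (rev_poly p) = pip M p (monom 1 (degree p - j))"
  unfolding pip_def
proof (rule integral_cong_circle)
  fix z :: complex assume "cmod z = 1"
  then show "cnj (poly (monom 1 j) z) * poly (rev_poly p) z =
      cnj (poly p z) * poly (monom 1 (degree p - j)) z"
    using assms by (simp add: poly_rev_poly_circle poly_monom circle_cnj_power_diff[symmetric])
qed (rule measurable_pip)+

lemma pip_rev_poly_self: "pip M (rev_poly p) (rev_poly p) = pip M p p"
  unfolding pip_def
proof (rule integral_cong_circle)
  fix z :: complex assume "cmod z = 1"
  then show "cnj (poly (rev_poly p) z) * poly (rev_poly p) z = cnj (poly p z) * poly p z"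
    using circle_cnj_power[of z "degree p"] by (simp add: poly_rev_poly_circle mult_ac)
qed (rule measurable_pip)+

lemma orth_pip:
  assumes "orth M a n" "k \<le> n" "\<And>i. i \<ge> k \<Longrightarrow> coeff q i = 0"
  shows "pip M q (szego a k) = 0" "pip M (szego a k) q = 0"
  using pip_orthogonal[of k "szego a k" q] assms by (auto simp: orth_def)

lemma orth_rev_poly:
  assumes "orth M a n" "k \<le> n" "0 < j" "j \<le> k"
  shows "pip M (monom 1 j) (rev_poly (szego a k)) = 0"
  using orth_pip(2)[OF assms(1,2), of "monom 1 (k - j)"] assms
  by (subst pip_rev_poly_monom) (auto simp: coeff_monom)

text \<open>In \<open>[:0, 1:] * szego a k = szego a (Suc k) + cnj (a k) rev_poly (szego a
  k)\<close> the two summands on the right are orthogonal, and both multiplication by z and reversal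
  preserve the norm. Pythagoras then gives the factor
  \<open>1 - \<bar>a k\<bar>\<^sup>2\<close>.\<close>

theorem pip_szego_self:
  assumes "orth M a n" "k \<le> n"
  shows "pip M (szego a k) (szego a k) = complex_of_real (kappa a k * measure M UNIV)"
  using assms(2)
proof (induction k)
  case 0
  have "pip M 1 1 = complex_of_real (measure M (space M))" by (simp add: pip_def scaleR_conv_of_real del: space_circle)
  then show ?case by (simp add: kappa_def)
next
  case (Suc k)
  let ?P = "szego a k" and ?Q = "szego a (Suc k)" and ?R = "rev_poly (szego a k)"
  have R: "pip M ?R ?Q = 0" "pip M ?Q ?R = 0"
    using orth_pip[OF assms(1) Suc.prems, of ?R] degree_rev_poly_le[of ?P] by (auto simp: coeff_eq_0)
  have eq: "[:0, 1:] * ?P = ?Q + Polynomial.smult (cnj (a k)) ?R" by simp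
  have "pip M ?P ?P = pip M ([:0, 1:] * ?P) ([:0, 1:] * ?P)" by (simp only: pip_X)
  also have "\<dots> = pip M ?Q ?Q + a k * cnj (a k) * pip M ?P ?P"
    unfolding eq by (simp only: pip_add_left pip_add_right pip_smult_left pip_smult_right R pip_rev_poly_self) simp
  finally have "pip M ?Q ?Q = (1 - a k * cnj (a k)) * pip M ?P ?P"
    by (simp add: algebra_simps)
  also have "\<dots> = complex_of_real ((1 - (cmod (a k))\<^sup>2) * (kappa a k * measure M UNIV))"
    using Suc by (simp add: complex_norm_square[symmetric])
  finally show ?case by (simp add: kappa_def mult_ac)
qed

text \<open>Expansion in the orthogonal polynomials, whose norms are positive by
  \<open>kappa_pos\<close>. Nondegeneracy up to degree \<open>n\<close> is thus read off from the
  coefficients and not from the support of \<open>M\<close>.\<close>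

lemma orth_posdef:
  assumes "orth M a n" "\<And>j. j < n \<Longrightarrow> cmod (a j) < 1" "measure M UNIV > 0"
    and "degree q \<le> n" "pip M q q = 0"
  shows "q = 0"
proof -
  \<comment> \<open>Here \<open>m\<close> bounds the number of coefficients of \<open>q\<close>;
    splitting off the leading term is an orthogonal decomposition and lowers
    \<open>m\<close>.\<close>
  have "q = 0" if "m \<le> Suc n" "\<And>i. i \<ge> m \<Longrightarrow> coeff q i = 0" "pip M q q = 0" for m q
    using that
  proof (induction m arbitrary: q)
    case 0
    then show ?case by (auto simp: poly_eq_iff)
  next
    case (Suc m)
    define c where "c = coeff q m"
    define q' where "q' = q - Polynomial.smult c (szego a m)"
    have m: "m \<le> n" using Suc by simp
    have q': "coeff q' i = 0" if "i \<ge> m" for i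
    proof (cases "i = m")
      case False
      then show ?thesis using that Suc.prems(2)[of i] by (simp add: q'_def coeff_eq_0)
    qed (simp add: q'_def c_def)
    have 0: "pip M q' (szego a m) = 0" "pip M (szego a m) q' = 0"
      using orth_pip[OF assms(1) m, of q'] q' by auto
    have q: "q = q' + Polynomial.smult c (szego a m)" by (simp add: q'_def)
    have "pip M q q = pip M q' q' + c * cnj c * pip M (szego a m) (szego a m)"
      unfolding pip_def[of M q q] by (subst (1 2) q, fold pip_def)
        (simp add: pip_add_left pip_add_right pip_smult_left pip_smult_right 0 mult_ac)
    also have "\<dots> = pip M q' q' + complex_of_real ((cmod c)\<^sup>2 * (kappa a m * measure M UNIV))"
      by (simp add: pip_szego_self[OF assms(1) m] complex_norm_square del: of_real_power)
    finally have "Re (pip M q' q') + (cmod c)\<^sup>2 * (kappa a m * measure M UNIV) = 0"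
      using Suc.prems(3) by (metis Re_complex_of_real plus_complex.sel(1) zero_complex.sel(1))
    moreover have pos: "kappa a m * measure M UNIV > 0"
      using assms(2,3) m by (intro mult_pos_pos kappa_pos) auto
    moreover have "Re (pip M q' q') \<ge> 0" by (rule pip_self_nonneg)
    ultimately have "Re (pip M q' q') = 0" "(cmod c)\<^sup>2 * (kappa a m * measure M UNIV) = 0"
      by (smt (verit) mult_nonneg_nonneg zero_le_power2)+
    then have "pip M q' q' = 0" "c = 0"
      using pos pip_self_nonneg(2)[of q'] by (auto simp: complex_eq_iff)
    then show ?case using Suc.IH[of q'] q' Suc.prems(1) q by auto
  qed
  from this[of "Suc n" q] show ?thesis using assms by (auto simp: coeff_eq_0)
qed

text \<open>If \<open>\<Phi>\<^sub>n = (z - w) p\<close>, then \<open>\<parallel>p\<parallel>\<^sup>2 = \<parallel>z p\<parallel>\<^sup>2 = \<parallel>\<Phi>\<^sub>n + w p\<parallel>\<^sup>2 = \<parallel>\<Phi>\<^sub>n\<parallel>\<^sup>2 + \<bar>w\<bar>\<^sup>2 \<parallel>p\<parallel>\<^sup>2\<close>.\<close>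

theorem szego_root_in_disc:
  assumes "orth M a n" "\<And>j. j < n \<Longrightarrow> cmod (a j) < 1" "measure M UNIV > 0"
    and "poly (szego a n) w = 0"
  shows "cmod w < 1"
proof -
  let ?P = "szego a n"
  obtain p where p: "?P = [:- w, 1:] * p"
    using assms(4) by (auto simp: poly_eq_0_iff_dvd dvd_def)
  then have "p \<noteq> 0" by auto
  then have deg: "n = Suc (degree p)"
    using degree_szego[of a n] unfolding p by (subst (asm) degree_mult_eq) auto
  have 0: "pip M p ?P = 0" "pip M ?P p = 0"
    using orth_pip[OF assms(1) order_refl, of p] deg by (auto simp: coeff_eq_0)
  have Xp: "[:0, 1:] * p = ?P + Polynomial.smult w p" by (simp add: p algebra_simps)
  have "pip M p p = pip M ([:0, 1:] * p) ([:0, 1:] * p)" by (simp only: pip_X)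
  also have "\<dots> = pip M ?P ?P + w * cnj w * pip M p p"
    unfolding Xp by (simp only: pip_add_left pip_add_right pip_smult_left pip_smult_right 0) simp
  finally have "pip M p p = complex_of_real (kappa a n * measure M UNIV) + complex_of_real ((cmod w)\<^sup>2) * pip M p p"
    by (simp only: pip_szego_self[OF assms(1) order_refl] complex_norm_square)
  from arg_cong[OF this, of Re]
  have "Re (pip M p p) = kappa a n * measure M UNIV + (cmod w)\<^sup>2 * Re (pip M p p)" by simp
  moreover have "kappa a n * measure M UNIV > 0"
    using assms(2,3) by (intro mult_pos_pos kappa_pos) auto
  moreover have "Re (pip M p p) \<ge> 0" by (rule pip_self_nonneg)
  ultimately have "(cmod w)\<^sup>2 < 1"
    by (smt (verit) mult_le_cancel_right1 mult_nonneg_nonneg)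
  then show ?thesis by (simp add: abs_square_less_1)
qed

end

section \<open>Bernstein-Szego measures\<close>

definition vtrunc :: "(nat \<Rightarrow> complex) \<Rightarrow> nat \<Rightarrow> nat \<Rightarrow> complex" where
  "vtrunc a n j = (if j < n then a j else 0)"

definition bs_density :: "(nat \<Rightarrow> complex) \<Rightarrow> nat \<Rightarrow> complex \<Rightarrow> real" where
  "bs_density a n z = kappa a n / (cmod (poly (szego a n) z))\<^sup>2"

definition bernstein_szego :: "(nat \<Rightarrow> complex) \<Rightarrow> nat \<Rightarrow> complex measure" where
  "bernstein_szego a n = density circ (\<lambda>z. ennreal (bs_density a n z))"

lemma szego_vtrunc: "szego (vtrunc a n) (n + i) = monom 1 i * szego a n"
proof (induction i)
  case 0
  have "szego (vtrunc a n) n = szego a n" by (rule szego_cong) (simp add: vtrunc_def)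
  then show ?case by simp
qed (simp add: vtrunc_def monom_Suc)

text \<open>Away from 0 the zeros of the reversed polynomial are the reflections
  \<open>1 / cnj w\<close> of those of \<open>p\<close>, and at 0 its value is the conjugate of the
  leading coefficient. Quotients by it are therefore holomorphic in the disc, as
  \<open>mean_value_circ\<close> requires.\<close>

lemma rev_poly_nonzero:
  assumes "\<And>w. poly p w = 0 \<Longrightarrow> cmod w < 1" "cmod z \<le> 1"
  shows "poly (rev_poly p) z \<noteq> 0"
proof (cases "z = 0")
  case True
  have "p \<noteq> 0" using assms(1)[of 1] by auto
  then show ?thesis using True by (simp add: poly_rev_poly_0)
next
  case False
  have "poly p (1 / cnj z) \<noteq> 0"
    using assms(1)[of "1 / cnj z"] assms(2) False by (auto simp: norm_divide)
  then show ?thesis using False by (simp add: poly_rev_poly)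
qed

context circle_measure
begin

text \<open>On the circle \<open>(1 - \<bar>a\<^sub>k\<bar>\<^sup>2) z \<Phi>\<^sub>k = \<Phi>\<^sub>k\<^sub>+\<^sub>1 + cnj a\<^sub>k \<Phi>\<^sub>k\<^sub>+\<^sub>1\<^sup>*\<close>, so orthogonality passes down.\<close>

lemma orth_descend:
  assumes orth: "\<And>j. j < Suc k \<Longrightarrow> pip M (monom 1 j) (szego a (Suc k)) = 0"
    and a: "cmod (a k) < 1" and j: "j < k"
  shows "pip M (monom 1 j) (szego a k) = 0"
proof -
  let ?P = "szego a k" and ?Q = "szego a (Suc k)"
  have "pip M (szego a (Suc k)) (monom 1 (Suc k - Suc j)) = 0"
    by (rule pip_orthogonal(2)[where k = "Suc k"]) (use orth in \<open>auto simp: coeff_monom\<close>)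
  then have "pip M (monom 1 (Suc j)) (rev_poly ?Q) = 0"
    using j by (subst pip_rev_poly_monom) (auto simp del: szego.simps)
  with orth[of "Suc j"] j
  have "0 = pip M (monom 1 (Suc j)) (?Q + Polynomial.smult (cnj (a k)) (rev_poly ?Q))"
    by (simp add: pip_add_right pip_smult_right del: szego.simps)
  also have "\<dots> = pip M (monom 1 j) (Polynomial.smult (1 - a k * cnj (a k)) ?P)"
    unfolding pip_def
  proof (rule integral_cong_circle)
    fix z :: complex assume z: "cmod z = 1"
    have z1: "cnj z * z = 1" "z ^ k * cnj z ^ k = 1" using circle_cnj_power[OF z] circle_cnj_power(2)[OF z, of 1] by auto
    have Q: "poly ?Q z = z * poly ?P z - cnj (a k) * (z ^ k * cnj (poly ?P z))"
      using z by (simp add: poly_rev_poly_circle)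
    have "poly (rev_poly ?Q) z = z ^ Suc k * (cnj z * cnj (poly ?P z) - a k * (cnj z ^ k * poly ?P z))"
      using z by (subst poly_rev_poly_circle) (simp_all add: Q del: szego.simps)
    also have "\<dots> = (cnj z * z) * z ^ k * cnj (poly ?P z) - a k * z * (z ^ k * cnj z ^ k) * poly ?P z"
      by (simp add: algebra_simps)
    also have "\<dots> = z ^ k * cnj (poly ?P z) - a k * z * poly ?P z" by (simp only: z1) simp
    finally have R: "poly (rev_poly ?Q) z = z ^ k * cnj (poly ?P z) - a k * z * poly ?P z" .
    have "cnj (poly (monom 1 (Suc j)) z) * poly (?Q + Polynomial.smult (cnj (a k)) (rev_poly ?Q)) z
       = (cnj z * z) * cnj z ^ j * ((1 - a k * cnj (a k)) * poly ?P z)"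
      by (simp only: poly_add poly_smult Q R poly_monom) (simp add: algebra_simps)
    then show "cnj (poly (monom 1 (Suc j)) z) * poly (?Q + Polynomial.smult (cnj (a k)) (rev_poly ?Q)) z
       = cnj (poly (monom 1 j) z) * poly (Polynomial.smult (1 - a k * cnj (a k)) ?P) z"
      by (simp only: z1) (simp add: poly_monom)
  qed (rule measurable_pip)+
  also have "\<dots> = (1 - a k * cnj (a k)) * pip M (monom 1 j) ?P"
    by (rule pip_smult_right)
  finally have "(1 - a k * cnj (a k)) * pip M (monom 1 j) ?P = 0" by simp
  moreover have "1 - a k * cnj (a k) \<noteq> 0"
  proof
    assume "1 - a k * cnj (a k) = 0"
    then have "complex_of_real ((cmod (a k))\<^sup>2) = 1" by (simp add: complex_norm_square del: of_real_power)
    then have "(cmod (a k))\<^sup>2 = 1" using of_real_eq_1_iff by blast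
    then show False using a norm_ge_zero[of "a k"] by (auto simp: power2_eq_1_iff)
  qed
  ultimately show ?thesis by simp
qed

text \<open>The recursion can be inverted when the coefficients lie in the disc, so only the last
  polynomial has to be tested against the measure.\<close>

lemma orth_of_top:
  assumes "\<And>j. j < n \<Longrightarrow> pip M (monom 1 j) (szego a n) = 0" "\<And>j. j < n \<Longrightarrow> cmod (a j) < 1"
  shows "orth M a n"
proof -
  have "\<forall>j<k. pip M (monom 1 j) (szego a k) = 0" if "k \<le> n" for k
    using that
  proof (induction rule: inc_induct)
    case (step k)
    then show ?case using orth_descend[of k a] assms(2) by auto
  qed (use assms(1) in auto)
  then show ?thesis by (auto simp: orth_def)
qed

lemma pip_one_poly: "pip M 1 q = (\<Sum>i\<le>degree q. coeff q i * pip M 1 (monom 1 i))"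
  by (subst poly_as_sum_of_monoms[symmetric, of q])
    (simp add: pip_sum_right pip_smult_right[symmetric] smult_monom del: poly_as_sum_of_monoms)

lemma pip_one: "pip M 1 q = (\<integral>z. poly q z \<partial>M)"
  by (simp add: pip_def)

end

text \<open>Orthogonality of \<open>szego a k\<close> to 1 expresses the moment of order
  \<open>k\<close> by the lower ones, with the same coefficients for both measures.\<close>

theorem orth_moments_unique:
  assumes "circle_measure M" "circle_measure M'" "measure M UNIV = measure M' UNIV"
    and "orth M a n" "orth M' a n" "degree q \<le> n"
  shows "(\<integral>z. poly q z \<partial>M) = (\<integral>z. poly q z \<partial>M')"
proof -
  interpret M: circle_measure M by fact
  interpret M': circle_measure M' by fact
  have mom: "pip M 1 (monom 1 k) = pip M' 1 (monom 1 k)" if "k \<le> n" for k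
    using that
  proof (induction k rule: less_induct)
    case (less k)
    show ?case
    proof (cases "k = 0")
      case True
      then show ?thesis
        using assms(3) by (simp add: M.pip_one M'.pip_one poly_monom scaleR_conv_of_real)
    next
      case False
      have *: "pip N 1 (monom 1 k) = - (\<Sum>i<k. coeff (szego a k) i * pip N 1 (monom 1 i))"
        if "circle_measure N" "orth N a n" for N
      proof -
        interpret N: circle_measure N by fact
        have "0 = pip N 1 (szego a k)"
          using that(2) less.prems False by (simp add: orth_def flip: monom_eq_1)
        also have "\<dots> = (\<Sum>i<k. coeff (szego a k) i * pip N 1 (monom 1 i)) + pip N 1 (monom 1 k)"
          by (subst N.pip_one_poly) (simp add: lessThan_Suc_atMost[symmetric])
        finally show ?thesis by (simp add: eq_neg_iff_add_eq_0 add.commute)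
      qed
      show ?thesis
        unfolding *[OF assms(1,4)] *[OF assms(2,5)]
        using less by (intro arg_cong[of _ _ uminus] sum.cong) auto
    qed
  qed
  have "pip M 1 q = pip M' 1 q"
    unfolding M.pip_one_poly[of q] M'.pip_one_poly[of q]
    using mom assms(6) by (intro sum.cong) auto
  then show ?thesis by (simp add: M.pip_one M'.pip_one)
qed

section \<open>The Bernstein-Szego measure realizes the truncated coefficients\<close>

context
  fixes a :: "nat \<Rightarrow> complex" and n :: nat
  assumes roots: "\<And>w. poly (szego a n) w = 0 \<Longrightarrow> cmod w < 1"
    and a_less: "\<And>j. j < n \<Longrightarrow> cmod (a j) < 1"
begin

lemma szego_nonzero_circle: "cmod z = 1 \<Longrightarrow> poly (szego a n) z \<noteq> 0"
  using roots[of z] by auto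

lemma bs_density_pos: "cmod z = 1 \<Longrightarrow> bs_density a n z > 0"
  using kappa_pos[of n a] a_less szego_nonzero_circle[of z] by (simp add: bs_density_def)

lemma bs_density_measurable [measurable]: "bs_density a n \<in> borel_measurable borel"
proof -
  have "(\<lambda>z. (cmod (poly (szego a n) z))\<^sup>2) \<in> borel_measurable borel"
    by (intro borel_measurable_continuous_onI continuous_intros)
  then show ?thesis unfolding bs_density_def[abs_def] by measurable
qed

lemma bs_density_bounded: "\<exists>B. \<forall>z. cmod z = 1 \<longrightarrow> bs_density a n z \<le> B"
proof -
  have "continuous_on (sphere 0 1) (bs_density a n)"
    unfolding bs_density_def[abs_def]
    using szego_nonzero_circle by (intro continuous_intros) auto
  then show ?thesis using continuous_on_circle_bounded by (fastforce simp: abs_le_iff)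
qed

lemma circle_measure_bernstein_szego: "circle_measure (bernstein_szego a n)"
proof -
  obtain B where "\<forall>z. cmod z = 1 \<longrightarrow> bs_density a n z \<le> B" using bs_density_bounded ..
  then show ?thesis
    unfolding bernstein_szego_def
    by (intro circle_measure_density[OF circ.circle_measure_axioms]) (auto intro: less_imp_le bs_density_pos)
qed

interpretation bs: circle_measure "bernstein_szego a n" by (rule circle_measure_bernstein_szego)

lemma integral_bernstein_szego:
  fixes g :: "complex \<Rightarrow> 'b::{banach, second_countable_topology}"
  assumes "g \<in> borel_measurable borel"
  shows "(\<integral>z. g z \<partial>bernstein_szego a n) = (\<integral>z. bs_density a n z *\<^sub>R g z \<partial>circ)"
  unfolding bernstein_szego_def
  by (rule circ.integral_density_circle) (use assms bs_density_pos in \<open>auto intro: less_imp_le\<close>)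

text \<open>One factor of \<open>\<bar>\<Phi>\<^sub>n\<bar>\<^sup>2\<close> cancels and the other
  one, times \<open>z ^ n\<close>, is the reversed polynomial. What remains is a multiple of
  \<open>z ^ (n + i - j)\<close> divided by a polynomial without zeros in the closed disc, and its
  mean is the value at 0.\<close>

lemma bernstein_szego_orth_top:
  assumes "j < n + i"
  shows "pip (bernstein_szego a n) (monom 1 j) (szego (vtrunc a n) (n + i)) = 0"
proof -
  let ?P = "szego a n" and ?R = "rev_poly (szego a n)"
  have m1: "(\<lambda>z. cnj (poly (monom 1 j) z) * poly (szego (vtrunc a n) (n + i)) z) \<in> borel_measurable borel"
    by (rule measurable_pip)
  have m2: "(\<lambda>z. kappa a n * (z ^ (n + i - j) / poly ?R z)) \<in> borel_measurable borel"
  proof -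
    have [measurable]: "(\<lambda>z. z ^ (n + i - j) :: complex) \<in> borel_measurable borel"
      "(\<lambda>z. poly ?R z) \<in> borel_measurable borel"
      by (intro borel_measurable_continuous_onI continuous_intros)+
    show ?thesis by measurable
  qed
  have "pip (bernstein_szego a n) (monom 1 j) (szego (vtrunc a n) (n + i)) =
     (\<integral>z. bs_density a n z *\<^sub>R (cnj (poly (monom 1 j) z) * poly (szego (vtrunc a n) (n + i)) z) \<partial>circ)"
    unfolding pip_def by (rule integral_bernstein_szego[OF m1])
  also have "\<dots> = (\<integral>z. kappa a n * (z ^ (n + i - j) / poly ?R z) \<partial>circ)"
  proof (rule circ.integral_cong_circle)
    fix z :: complex assume z: "cmod z = 1"
    have P0: "poly ?P z \<noteq> 0" using szego_nonzero_circle z .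
    have z0: "z \<noteq> 0" using z by auto
    have "bs_density a n z *\<^sub>R (cnj (poly (monom 1 j) z) * poly (szego (vtrunc a n) (n + i)) z) =
      kappa a n / (poly ?P z * cnj (poly ?P z)) * (cnj z ^ j * z ^ i * poly ?P z)"
      unfolding bs_density_def szego_vtrunc scaleR_conv_of_real of_real_divide complex_norm_square
      by (simp add: poly_monom)
    also have "\<dots> = kappa a n * ((cnj z ^ j * z ^ (n + i)) / (z ^ n * cnj (poly ?P z)))"
      using P0 z0 by (simp add: divide_simps power_add)
    also have "\<dots> = kappa a n * (z ^ (n + i - j) / poly ?R z)"
      using assms z by (simp add: circle_cnj_power_diff poly_rev_poly_circle)
    finally show "bs_density a n z *\<^sub>R (cnj (poly (monom 1 j) z) * poly (szego (vtrunc a n) (n + i)) z) =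
      kappa a n * (z ^ (n + i - j) / poly ?R z)" .
  qed (use m1 m2 in measurable)
  also have "\<dots> = kappa a n * (0 ^ (n + i - j) / poly ?R 0)"
    using rev_poly_nonzero[of ?P] roots
    by (intro mean_value_circ m2 continuous_intros holomorphic_intros) auto
  also have "\<dots> = 0" using assms by simp
  finally show ?thesis .
qed

lemma bernstein_szego_orth: "orth (bernstein_szego a n) (vtrunc a n) m"
proof -
  have "orth (bernstein_szego a n) (vtrunc a n) (n + m)"
    by (rule bs.orth_of_top[OF bernstein_szego_orth_top]) (auto simp: vtrunc_def a_less)
  then show ?thesis by (rule orth_mono) simp
qed

lemma bernstein_szego_orth': "orth (bernstein_szego a n) a n"
  using bernstein_szego_orth[of n] szego_cong[of _ a "vtrunc a n"]
  by (auto simp: orth_def vtrunc_def)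

text \<open>The norm of \<open>szego a n\<close> is computed twice: the density cancels it to
  \<open>kappa a n\<close>, and \<open>pip_szego_self\<close> gives \<open>kappa a n\<close> times
  the total mass.\<close>

lemma measure_bernstein_szego: "measure (bernstein_szego a n) UNIV = 1"
proof -
  let ?P = "szego a n"
  have kp: "kappa a n > 0" using kappa_pos a_less by blast
  have "pip (bernstein_szego a n) ?P ?P =
     (\<integral>z. bs_density a n z *\<^sub>R (cnj (poly ?P z) * poly ?P z) \<partial>circ)"
    unfolding pip_def by (rule integral_bernstein_szego[OF measurable_pip])
  also have "\<dots> = (\<integral>z. complex_of_real (kappa a n) \<partial>circ)"
  proof (rule circ.integral_cong_circle)
    fix z :: complex assume z: "cmod z = 1"
    show "bs_density a n z *\<^sub>R (cnj (poly ?P z) * poly ?P z) = complex_of_real (kappa a n)"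
      unfolding bs_density_def scaleR_conv_of_real of_real_divide complex_norm_square
      using szego_nonzero_circle[OF z] by simp
  qed (use measurable_pip in measurable)
  also have "\<dots> = kappa a n" by (simp add: circ.prob_space[simplified])
  finally have "complex_of_real (kappa a n * measure (bernstein_szego a n) UNIV) = kappa a n"
    using bs.pip_szego_self[OF bernstein_szego_orth' order_refl] by simp
  then have "kappa a n * measure (bernstein_szego a n) UNIV = kappa a n" by (simp only: of_real_eq_iff)
  then show ?thesis using kp by simp
qed

end

section \<open>Verblunsky coefficients of a measure\<close>

lemma monic_degree_0: "degree p = 0 \<Longrightarrow> lead_coeff p = 1 \<Longrightarrow> p = (1 :: complex poly)"
  by (auto elim!: degree_eq_zeroE simp: one_pCons)

context circle_measure
begin

text \<open>Two monic candidates differ by a polynomial of smaller degree that is orthogonal to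
  itself. The first premise excludes the branch of \<open>opuc\<close> for the last index of a
  finitely supported measure.\<close>

lemma opuc_eqI:
  assumes "\<not> (finite (msupport M) \<and> n = card (msupport M))"
    and p: "lead_coeff p = 1" "degree p = n" "\<And>j. j < n \<Longrightarrow> pip M (monom 1 j) p = 0"
    and posdef: "\<And>q. degree q < n \<Longrightarrow> pip M q q = 0 \<Longrightarrow> q = 0"
  shows "opuc M n = p"
proof -
  have "(THE p. lead_coeff p = 1 \<and> degree p = n \<and> (\<forall>q. degree q < n \<longrightarrow> pip M q p = 0)) = p"
  proof (rule the_equality)
    show "lead_coeff p = 1 \<and> degree p = n \<and> (\<forall>q. degree q < n \<longrightarrow> pip M q p = 0)"
      using p pip_orthogonal(1)[of n p] by (auto simp: coeff_eq_0)
  next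
    fix p' assume p': "lead_coeff p' = 1 \<and> degree p' = n \<and> (\<forall>q. degree q < n \<longrightarrow> pip M q p' = 0)"
    show "p' = p"
    proof (cases n)
      case 0
      then show ?thesis using p' p monic_degree_0 by metis
    next
      case (Suc k)
      define q where "q = p' - p"
      have "coeff q i = 0" if "i > k" for i
        using that p p' Suc by (cases "i = n") (auto simp: q_def coeff_eq_0)
      then have deg: "degree q < n" using Suc degree_le[of k q] by auto
      have "pip M q q = pip M q p' - pip M q p" unfolding q_def[symmetric] by (simp add: q_def pip_diff_right)
      also have "\<dots> = 0"
        using p' deg pip_orthogonal(1)[of n p q] p(3) by (auto simp: coeff_eq_0)
      finally show ?thesis using posdef[OF deg] by (simp add: q_def)
    qed
  qed
  then show ?thesis using assms(1) by (simp only: opuc_def pip_def if_False)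
qed

lemma posdef_infinite_support:
  assumes "infinite (msupport M)" "pip M q q = 0"
  shows "q = 0"
proof (rule ccontr)
  assume "q \<noteq> 0"
  then have "finite {z. poly q z = 0}" by (rule poly_roots_finite)
  then obtain z where z: "z \<in> msupport M" "poly q z \<noteq> 0"
    using assms(1) by (metis (mono_tags, lifting) mem_Collect_eq rev_finite_subset subsetI)
  have int: "integrable M (\<lambda>z. (cmod (poly q z))\<^sup>2)"
    by (intro integrable_continuous continuous_intros)
  have "(\<integral>z. (cmod (poly q z))\<^sup>2 \<partial>M) = 0"
    using assms(2) by (simp only: pip_self of_real_eq_0_iff)
  then have "AE z in M. (cmod (poly q z))\<^sup>2 = 0"
    using integral_nonneg_eq_0_iff_AE[OF int] by simp
  then have ae: "AE z in M. z \<notin> {z. poly q z \<noteq> 0}" by simp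
  have op: "open {z. poly q z \<noteq> 0}"
    by (intro open_Collect_neq continuous_intros)
  then have "emeasure M {z. poly q z \<noteq> 0} = 0"
    using ae AE_iff_measurable[of "{z. poly q z \<noteq> 0}" M] by (auto simp: sets_borel)
  moreover have "emeasure M {z. poly q z \<noteq> 0} > 0"
    using z op by (auto simp: msupport_def)
  ultimately show False by simp
qed

text \<open>Serves to solve for the coefficient that makes the next polynomial orthogonal to 1;
  orthogonality to the higher powers holds for every coefficient by
  \<open>orth_Suc_monom\<close>.\<close>

lemma pip_one_rev_poly:
  assumes "degree p = n" "lead_coeff p = 1" "\<And>j. j < n \<Longrightarrow> pip M (monom 1 j) p = 0"
  shows "pip M 1 (rev_poly p) = pip M p p"
proof -
  have "pip M 1 (rev_poly p) = pip M p (monom 1 n)"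
    using pip_rev_poly_monom[of 0 p] assms(1) by simp
  also have "\<dots> = pip M p p - pip M p (p - monom 1 n)" by (simp add: pip_diff_right)
  also have "pip M p (p - monom 1 n) = 0"
    by (rule pip_orthogonal(2)[OF assms(3)]) (use assms(1,2) in \<open>auto simp: coeff_monom coeff_eq_0\<close>)
  finally show ?thesis by simp
qed

lemma orth_Suc_monom:
  assumes "orth M a n" "0 < j" "j \<le> n"
  shows "pip M (monom 1 j) (szego a (Suc n)) = 0"
proof -
  obtain i where i: "j = Suc i" using assms(2) by (cases j) auto
  have "monom 1 j = [:0, 1:] * (monom 1 i :: complex poly)" by (simp add: i monom_Suc)
  then have "pip M (monom 1 j) ([:0, 1:] * szego a n) = pip M (monom 1 i) (szego a n)"
    by (simp only: pip_X)
  also have "\<dots> = 0" using assms i by (auto simp: orth_def)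
  finally show ?thesis
    using orth_rev_poly[OF assms(1) order_refl assms(2,3)] by (simp only: szego.simps pip_diff_right pip_smult_right) simp
qed

lemma pip_orthogonal_shift:
  assumes "\<And>j. 0 < j \<Longrightarrow> j \<le> n \<Longrightarrow> pip M (monom 1 j) p = 0" "coeff q 0 = 0" "degree q \<le> n"
  shows "pip M q p = 0"
proof -
  have "pip M q p = (\<Sum>i\<le>degree q. cnj (coeff q i) * pip M (monom 1 i) p)"
    by (subst poly_as_sum_of_monoms[symmetric, of q])
      (simp add: pip_sum_left pip_smult_left[symmetric] smult_monom del: poly_as_sum_of_monoms)
  also have "\<dots> = 0"
  proof (intro sum.neutral ballI)
    fix i assume "i \<in> {..degree q}"
    then show "cnj (coeff q i) * pip M (monom 1 i) p = 0" using assms by (cases "i = 0") auto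
  qed
  finally show ?thesis .
qed

end

text \<open>The recursion in \<open>has_verblunsky\<close> concerns a definite description, about
  which nothing is known until existence is shown. In each degree a polynomial is therefore
  constructed with a suitable coefficient, identified with \<open>opuc\<close> by uniqueness, and
  only then compared with the recursion for \<alpha>.\<close>

theorem has_verblunsky_orth:
  assumes "has_verblunsky \<mu> \<alpha>"
  shows "orth \<mu> \<alpha> n" "opuc \<mu> n = szego \<alpha> n"
proof -
  interpret circle_measure \<mu>
    using assms by (intro circle_prob_circle_measure) (simp add: has_verblunsky_def)
  have inf: "infinite (msupport \<mu>)" and rec: "\<And>n. verblunsky_rec \<mu> n (\<alpha> n)"
    using assms by (auto simp: has_verblunsky_def)
  have posdef: "q = 0" if "pip \<mu> q q = 0" for q
    using posdef_infinite_support[OF inf that] .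
  have "orth \<mu> \<alpha> n \<and> opuc \<mu> n = szego \<alpha> n"
  proof (induction n)
    case 0
    have "opuc \<mu> 0 = 1" by (rule opuc_eqI) (use inf posdef in auto)
    then show ?case by (simp add: orth_def)
  next
    case (Suc n)
    then have orth: "orth \<mu> \<alpha> n" and op: "opuc \<mu> n = szego \<alpha> n" by auto
    let ?P = "szego \<alpha> n"
    have one: "pip \<mu> 1 (rev_poly ?P) = pip \<mu> ?P ?P"
      by (rule pip_one_rev_poly[of _ n]) (use orth in \<open>auto simp: orth_def\<close>)
    have nz: "pip \<mu> ?P ?P \<noteq> 0" using posdef[of ?P] by auto
    \<comment> \<open>Solves the condition that the next polynomial be orthogonal to 1. It is never
      compared with \<open>\<alpha> n\<close> itself; only the two resulting polynomials
      are.\<close>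
    define b where "b = cnj (pip \<mu> 1 ([:0, 1:] * ?P) / pip \<mu> ?P ?P)"
    define \<beta> where "\<beta> = \<alpha>(n := b)"
    have szb: "szego \<beta> n = ?P" by (rule szego_cong) (simp add: \<beta>_def)
    have "szego \<beta> k = szego \<alpha> k" if "k \<le> n" for k
      by (rule szego_cong) (use that in \<open>auto simp: \<beta>_def\<close>)
    then have orthb: "orth \<mu> \<beta> n" using orth by (simp add: orth_def)
    have "pip \<mu> 1 (szego \<beta> (Suc n)) = pip \<mu> 1 ([:0, 1:] * ?P) - cnj b * pip \<mu> ?P ?P"
      by (simp only: szego.simps szb pip_diff_right pip_smult_right one) (simp add: \<beta>_def)
    also have "\<dots> = 0" using nz by (simp add: b_def)
    finally have "pip \<mu> (monom 1 0) (szego \<beta> (Suc n)) = 0" by simp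
    then have orthS: "pip \<mu> (monom 1 j) (szego \<beta> (Suc n)) = 0" if "j < Suc n" for j
      using that orth_Suc_monom[OF orthb, of j] by (cases "j = 0") auto
    have "opuc \<mu> (Suc n) = szego \<beta> (Suc n)"
      by (rule opuc_eqI[OF _ lead_coeff_szego degree_szego]) (use inf posdef orthS in blast)+
    moreover have "opuc \<mu> (Suc n) = szego \<alpha> (Suc n)"
      using rec[of n] op by (simp add: verblunsky_rec_def)
    ultimately show ?case
      using orth orthS by (auto simp: orth_def le_Suc_eq)
  qed
  then show "orth \<mu> \<alpha> n" "opuc \<mu> n = szego \<alpha> n" by auto
qed

section \<open>Para-orthogonal polynomials and quadrature\<close>

text \<open>The push-forward moves the point measure from \<open>W\<close> to the Borel sets of the
  plane.\<close>

definition finite_support_measure :: "complex set \<Rightarrow> (complex \<Rightarrow> real) \<Rightarrow> complex measure" where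
  "finite_support_measure W p = distr (point_measure W (\<lambda>w. ennreal (p w))) borel (\<lambda>w. w)"

context
  fixes W :: "complex set" and p :: "complex \<Rightarrow> real"
  assumes finW: "finite W" and W_circle: "\<And>w. w \<in> W \<Longrightarrow> cmod w = 1" and p_pos: "\<And>w. w \<in> W \<Longrightarrow> p w > 0"
begin

lemma integral_finite_support_measure:
  fixes f :: "complex \<Rightarrow> 'b::{banach, second_countable_topology}"
  assumes "f \<in> borel_measurable borel"
  shows "(\<integral>z. f z \<partial>finite_support_measure W p) = (\<Sum>w\<in>W. p w *\<^sub>R f w)"
  unfolding finite_support_measure_def
  by (subst integral_distr) (use assms finW p_pos in \<open>auto simp: lebesgue_integral_point_measure_finite less_imp_le
      measurable_point_measure_eq1 intro!: sum.cong\<close>)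

lemma emeasure_finite_support_measure:
  assumes "A \<in> sets borel"
  shows "emeasure (finite_support_measure W p) A = (\<Sum>w\<in>W \<inter> A. ennreal (p w))"
  unfolding finite_support_measure_def using assms finW
  by (subst emeasure_distr)
    (auto simp: measurable_point_measure_eq1 space_point_measure emeasure_point_measure_finite Int_commute)

lemma circle_measure_finite_support: "circle_measure (finite_support_measure W p)"
proof -
  have [simp]: "sets (finite_support_measure W p) = sets borel" "space (finite_support_measure W p) = UNIV"
    by (simp_all add: finite_support_measure_def)
  have "emeasure (finite_support_measure W p) UNIV < \<infinity>"
    using finW by (simp add: emeasure_finite_support_measure less_top[symmetric])
  then have "finite_measure (finite_support_measure W p)" by (intro finite_measureI) auto
  moreover have "AE z in finite_support_measure W p. cmod z = 1"
  proof (subst AE_iff_measurable[OF _ refl])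
    have s: "{z. cmod z \<noteq> 1} \<in> sets borel" by measurable
    show "{x \<in> space (finite_support_measure W p). cmod x \<noteq> 1} \<in> sets (finite_support_measure W p)"
      using s by simp
    have "W \<inter> {z. cmod z \<noteq> 1} = {}" using W_circle by auto
    then show "emeasure (finite_support_measure W p) {x \<in> space (finite_support_measure W p). cmod x \<noteq> 1} = 0"
      using s by (simp add: emeasure_finite_support_measure)
  qed
  ultimately show ?thesis by (simp add: circle_measure_def circle_measure_axioms_def)
qed

lemma msupport_finite_support: "msupport (finite_support_measure W p) = W"
proof (intro equalityI subsetI)
  fix z assume z: "z \<in> msupport (finite_support_measure W p)"
  show "z \<in> W"
  proof (rule ccontr)
    assume "z \<notin> W"
    moreover have "open (- W)" using finW by (simp add: finite_imp_closed open_Compl)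
    ultimately have "emeasure (finite_support_measure W p) (- W) > 0"
      using z by (auto simp: msupport_def)
    moreover have "W \<inter> - W = {}" by auto
    then have "emeasure (finite_support_measure W p) (- W) = 0"
      using \<open>open (- W)\<close> by (subst emeasure_finite_support_measure) auto
    ultimately show False by simp
  qed
next
  fix z assume z: "z \<in> W"
  show "z \<in> msupport (finite_support_measure W p)"
    unfolding msupport_def
  proof (intro CollectI allI impI)
    fix U assume U: "open U \<and> z \<in> U"
    have "0 < ennreal (p z)" using p_pos z by simp
    also have "\<dots> \<le> (\<Sum>w\<in>W \<inter> U. ennreal (p w))"
      using finW z U by (intro member_le_sum) auto
    also have "\<dots> = emeasure (finite_support_measure W p) U"
      using U by (subst emeasure_finite_support_measure) auto
    finally show "emeasure (finite_support_measure W p) U > 0" .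
  qed
qed

lemma pip_finite_support: "pip (finite_support_measure W p) q r = (\<Sum>w\<in>W. p w *\<^sub>R (cnj (poly q w) * poly r w))"
  unfolding pip_def by (rule integral_finite_support_measure[OF measurable_pip])

end

text \<open>Reversal relative to a fixed \<open>n\<close>, in contrast to \<open>rev_poly\<close>,
  which uses the degree of \<open>p\<close>: the polynomials it is applied to may have smaller
  degree, and the power \<open>z ^ n\<close> has to be common to all of them.\<close>

definition poly_star :: "nat \<Rightarrow> complex poly \<Rightarrow> complex poly" where
  "poly_star n p = (\<Sum>i\<le>n. monom (cnj (coeff p i)) (n - i))"

lemma poly_star_circle:
  assumes "degree p \<le> n" "cmod z = 1"
  shows "poly (poly_star n p) z = z ^ n * cnj (poly p z)"
proof -
  have "poly p z = (\<Sum>i\<le>n. coeff p i * z ^ i)"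
    by (subst poly_as_sum_of_monoms'[OF assms(1), symmetric]) (simp only: poly_sum poly_monom)
  then have "z ^ n * cnj (poly p z) = (\<Sum>i\<le>n. cnj (coeff p i) * (cnj z ^ i * z ^ n))"
    by (simp add: sum_distrib_left mult_ac)
  also have "\<dots> = (\<Sum>i\<le>n. cnj (coeff p i) * z ^ (n - i))"
    using assms(2) by (intro sum.cong) (auto simp: circle_cnj_power_diff)
  finally show ?thesis by (simp add: poly_star_def poly_sum poly_monom)
qed

lemma degree_poly_star: "degree (poly_star n p) \<le> n"
  unfolding poly_star_def by (intro degree_sum_le) (auto intro: order_trans[OF degree_monom_le])

lemma prod_roots_dvd:
  fixes r :: "complex poly"
  assumes "finite A" "\<And>w. w \<in> A \<Longrightarrow> poly r w = 0"
  shows "(\<Prod>w\<in>A. [:- w, 1:]) dvd r"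
  using assms
proof (induction A)
  case (insert w A)
  then obtain s where s: "r = (\<Prod>w\<in>A. [:- w, 1:]) * s" by (auto simp: dvd_def)
  have "poly (\<Prod>w\<in>A. [:- w, 1:]) w \<noteq> 0"
    using insert by (auto simp: poly_prod)
  then have "[:- w, 1:] dvd s"
    using insert.prems[of w] s by (simp add: poly_eq_0_iff_dvd[symmetric])
  then show ?case
    unfolding prod.insert[OF insert.hyps(1,2)] s mult.commute[of "[:- w, 1:]"]
    by (intro mult_dvd_mono dvd_refl)
qed auto

section \<open>Zeros of para-orthogonal polynomials and quadrature at these zeros\<close>

context circle_measure
begin

context
  fixes a :: "nat \<Rightarrow> complex" and n :: nat and Q :: "complex poly" and W :: "complex set"
  assumes Q_def: "Q = szego a (Suc n)" and W_def: "W = {w. poly Q w = 0}"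
    and orth: "orth M a n" and a_less: "\<And>j. j < n \<Longrightarrow> cmod (a j) < 1" and a_last: "cmod (a n) = 1"
    and mass: "measure M UNIV = 1"
begin

lemma degree_Q: "degree Q = Suc n" and Q_nonzero: "Q \<noteq> 0"
  unfolding Q_def by (rule degree_szego, rule szego_neq_0)

lemma posdef: "degree q \<le> n \<Longrightarrow> pip M q q = 0 \<Longrightarrow> q = 0"
  using orth_posdef[OF orth a_less] mass by simp

lemma para_orthogonal: "coeff q 0 = 0 \<Longrightarrow> degree q \<le> n \<Longrightarrow> pip M q Q = 0"
  unfolding Q_def using pip_orthogonal_shift[of n "szego a (Suc n)" q] orth_Suc_monom[OF orth] by blast

text \<open>Pairing with \<open>z q\<close> and using \<open>cnj z (z - 1 / cnj w) = - (cnj z - cnj w) / cnj w\<close> on the circle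
  would give \<open>\<parallel>(z - w) q\<parallel> = 0\<close>. This excludes roots off the circle, which come in pairs
  \<open>w, 1 / cnj w\<close>, as well as double roots on it.\<close>

lemma para_orthogonal_no_factor:
  assumes "w \<noteq> 0"
  shows "Q \<noteq> [:- w, 1:] * ([:- (1 / cnj w), 1:] * q)"
proof
  assume eq: "Q = [:- w, 1:] * ([:- (1 / cnj w), 1:] * q)"
  then have q0: "q \<noteq> 0" using Q_nonzero by auto
  have "[:- (1 / cnj w), 1:] * q \<noteq> 0" using q0 by (metis mult_eq_0_iff pCons_eq_0_iff zero_neq_one)
  then have "degree Q = 1 + degree ([:- (1 / cnj w), 1:] * q)"
    unfolding eq by (subst degree_mult_eq) auto
  also have "\<dots> = Suc (Suc (degree q))" using q0 by (subst degree_mult_eq) auto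
  finally have deg: "n = Suc (degree q)" by (simp add: degree_Q)
  let ?r = "[:- w, 1:] * q"
  have "0 = pip M ([:0, 1:] * q) Q"
    using q0 deg by (intro para_orthogonal[symmetric]) (auto simp: degree_mult_eq)
  also have "\<dots> = pip M ?r (Polynomial.smult (- 1 / cnj w) ?r)"
    unfolding pip_def
  proof (rule integral_cong_circle)
    fix z :: complex assume z: "cmod z = 1"
    have z1: "cnj z * z = 1" using circle_cnj_power(2)[OF z, of 1] by simp
    have "cnj (poly ([:0, 1:] * q) z) * poly Q z
        = cnj z * (z - 1 / cnj w) * (cnj (poly q z) * ((z - w) * poly q z))"
      unfolding eq poly_mult by simp
    also have "cnj z * (z - 1 / cnj w) = - 1 / cnj w * (cnj z - cnj w)"
      using assms z1 by (simp add: field_simps)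
    finally show "cnj (poly ([:0, 1:] * q) z) * poly Q z
        = cnj (poly ?r z) * poly (Polynomial.smult (- 1 / cnj w) ?r) z"
      unfolding poly_mult poly_smult by (simp add: mult_ac)
  qed (rule measurable_pip)+
  also have "\<dots> = - 1 / cnj w * pip M ?r ?r" by (rule pip_smult_right)
  finally have "pip M ?r ?r = 0" using assms by simp
  moreover have "degree ?r \<le> n" using q0 deg by (subst degree_mult_eq) auto
  ultimately have "?r = 0" by (rule posdef[rotated])
  then show False using q0 by (metis mult_eq_0_iff pCons_eq_0_iff zero_neq_one)
qed

lemma para_root_nonzero: "poly Q w = 0 \<Longrightarrow> w \<noteq> 0"
  using a_last by (auto simp: Q_def poly_rev_poly_0 lead_coeff_szego)

lemma para_root_circle:
  assumes "poly Q w = 0"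
  shows "cmod w = 1"
proof (rule ccontr)
  assume w1: "cmod w \<noteq> 1"
  have w0: "w \<noteq> 0" using para_root_nonzero assms .
  let ?P = "szego a n" and ?w = "1 / cnj w"
  \<comment> \<open>Because the last coefficient is unimodular, the equation
    \<open>poly Q w = 0\<close> is turned by conjugation into the same equation at the reflected
    point \<open>?w\<close>.\<close>
  have "a n * cnj (a n) = 1" using a_last complex_norm_square[of "a n"] by simp
  moreover have "w * poly ?P w = cnj (a n) * (w ^ n * cnj (poly ?P ?w))"
    using assms poly_rev_poly[OF w0, of ?P] by (simp add: Q_def)
  ultimately have "w ^ n * cnj (poly ?P ?w) = a n * (w * poly ?P w)"
    by (metis mult.assoc mult_1)
  then have "cnj (w ^ n * cnj (poly ?P ?w)) = cnj (a n * (w * poly ?P w))" by simp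
  then have *: "cnj w ^ n * poly ?P ?w = cnj (a n) * (cnj w * cnj (poly ?P w))" by simp
  have "poly (rev_poly ?P) ?w = ?w ^ n * cnj (poly ?P w)"
    using w0 by (subst poly_rev_poly) auto
  then have "poly Q ?w = ?w * poly ?P ?w - cnj (a n) * (?w ^ n * cnj (poly ?P w))" by (simp add: Q_def)
  also have "\<dots> = ?w ^ Suc n * (cnj w ^ n * poly ?P ?w - cnj (a n) * (cnj w * cnj (poly ?P w)))"
    using w0 by (simp add: field_simps)
  also have "\<dots> = 0" by (simp add: *)
  finally have root': "poly Q ?w = 0" .
  obtain q1 where q1: "Q = [:- w, 1:] * q1"
    using assms by (auto simp: poly_eq_0_iff_dvd dvd_def)
  have "w * cnj w \<noteq> 1"
  proof
    assume "w * cnj w = 1"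
    then have "(cmod w)\<^sup>2 = 1" by (metis complex_norm_square of_real_eq_1_iff)
    then show False using w1 norm_ge_zero[of w] by (auto simp: power2_eq_1_iff)
  qed
  then have "?w \<noteq> w" using w0 by (auto simp: field_simps)
  then have "poly q1 ?w = 0" using root' unfolding q1 poly_mult by simp
  then obtain q where "q1 = [:- ?w, 1:] * q"
    by (auto simp: poly_eq_0_iff_dvd dvd_def)
  then show False using para_orthogonal_no_factor[OF w0, of q] q1 by blast
qed

lemma para_rsquarefree: "rsquarefree Q"
  unfolding rsquarefree_roots
proof (intro allI notI)
  fix w assume w: "poly Q w = 0 \<and> poly (pderiv Q) w = 0"
  then have c: "cmod w = 1" and w0: "w \<noteq> 0" using para_root_circle para_root_nonzero by auto
  then have "1 / cnj w = w" using complex_norm_square[of w] by (auto simp: divide_eq_eq)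
  obtain q1 where q1: "Q = [:- w, 1:] * q1"
    using w by (auto simp: poly_eq_0_iff_dvd dvd_def)
  have "poly q1 w = 0" using w unfolding q1 pderiv_mult by (simp add: pderiv_pCons)
  then obtain q where "q1 = [:- w, 1:] * q"
    by (auto simp: poly_eq_0_iff_dvd dvd_def)
  then show False
    using para_orthogonal_no_factor[OF w0, of q] q1 \<open>1 / cnj w = w\<close> by metis
qed

lemma finite_para_roots: "finite W"
  unfolding W_def by (rule poly_roots_finite[OF Q_nonzero])

lemma para_decompose: "Q = (\<Prod>w\<in>W. [:- w, 1:])"
  using complex_poly_decompose_rsquarefree[OF para_rsquarefree] lead_coeff_szego[of a "Suc n"]
  by (simp only: W_def Q_def) simp

lemma card_para_roots: "card W = Suc n"
proof -
  have "degree (\<Prod>w\<in>W. [:- w, 1:]) = (\<Sum>w\<in>W. degree [:- w, 1:])"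
    by (rule degree_prod_eq_sum_degree) auto
  then show ?thesis using degree_Q by (simp flip: para_decompose)
qed

text \<open>The argument of Gauss quadrature: \<open>r = Q * s\<close> with
  \<open>degree s < n\<close>, and on the circle \<open>cnj z ^ n * s\<close> is the conjugate of
  \<open>poly_star n s\<close>. Since the degree of \<open>s\<close> is strictly smaller than
  \<open>n\<close>, this reversal has no constant term, so \<open>para_orthogonal\<close>
  applies.\<close>

lemma vanishing_moment:
  assumes "degree r \<le> 2 * n" "\<And>w. w \<in> W \<Longrightarrow> poly r w = 0"
  shows "pip M (monom 1 n) r = 0"
proof (cases "r = 0")
  case False
  have "Q dvd r"
    unfolding para_decompose by (rule prod_roots_dvd[OF finite_para_roots assms(2)])
  then obtain s where s: "r = Q * s" by (auto simp: dvd_def)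
  with False have "s \<noteq> 0" by auto
  then have deg: "degree s < n"
    using assms(1) unfolding s by (subst (asm) degree_mult_eq) (auto simp: Q_nonzero degree_Q)
  have "pip M (monom 1 n) r = pip M (poly_star n s) Q"
    unfolding pip_def
  proof (rule integral_cong_circle)
    fix z :: complex assume z: "cmod z = 1"
    show "cnj (poly (monom 1 n) z) * poly r z = cnj (poly (poly_star n s) z) * poly Q z"
      using z deg by (simp add: s poly_monom poly_star_circle)
  qed (rule measurable_pip)+
  also have "\<dots> = 0"
  proof (rule para_orthogonal[OF _ degree_poly_star])
    have "coeff (poly_star n s) 0 = (\<Sum>i\<le>n. coeff (monom (cnj (coeff s i)) (n - i)) 0)"
      by (simp add: poly_star_def coeff_sum)
    also have "\<dots> = 0"
    proof (intro sum.neutral ballI)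
      fix i assume "i \<in> {..n}"
      then show "coeff (monom (cnj (coeff s i)) (n - i)) 0 = 0"
        using deg by (cases "i = n") (auto simp: coeff_monom coeff_eq_0)
    qed
    finally show "coeff (poly_star n s) 0 = 0" .
  qed
  finally show ?thesis .
qed auto

definition lagrange_poly :: "complex \<Rightarrow> complex poly" where
  "lagrange_poly w = Polynomial.smult (1 / (\<Prod>v\<in>W - {w}. w - v)) (\<Prod>v\<in>W - {w}. [:- v, 1:])"

lemma poly_lagrange_poly: "v \<in> W \<Longrightarrow> w \<in> W \<Longrightarrow> poly (lagrange_poly w) v = (if v = w then 1 else 0)"
  using finite_para_roots by (auto simp: lagrange_poly_def poly_prod)

lemma degree_lagrange_poly: "w \<in> W \<Longrightarrow> degree (lagrange_poly w) \<le> n"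
proof -
  assume w: "w \<in> W"
  have "degree (\<Prod>v\<in>W - {w}. [:- v, 1:]) = (\<Sum>v\<in>W - {w}. degree [:- v, 1:])"
    by (rule degree_prod_eq_sum_degree) auto
  also have "\<dots> = n" using w finite_para_roots by (simp add: card_para_roots)
  finally show ?thesis unfolding lagrange_poly_def using degree_smult_le by metis
qed

text \<open>The quadrature weight in the form of a squared norm, which makes it real and
  positive.\<close>

definition weight :: "complex \<Rightarrow> real" where "weight w = Re (pip M (lagrange_poly w) (lagrange_poly w))"

lemma weight: "complex_of_real (weight w) = pip M (lagrange_poly w) (lagrange_poly w)"
  using pip_self_nonneg(2)[of "lagrange_poly w"] by (simp add: weight_def complex_eq_iff)

lemma weight_pos: "w \<in> W \<Longrightarrow> weight w > 0"
proof -
  assume w: "w \<in> W"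
  have "pip M (lagrange_poly w) (lagrange_poly w) \<noteq> 0"
    using posdef[OF degree_lagrange_poly[OF w]] poly_lagrange_poly[OF w w] by auto
  then have "weight w \<noteq> 0" by (simp flip: weight)
  then show ?thesis using pip_self_nonneg(1)[of "lagrange_poly w"] by (simp add: weight_def)
qed

lemma pip_poly_star:
  assumes "degree p \<le> n"
  shows "pip M (monom 1 n) (poly_star n p * q) = pip M p q"
  unfolding pip_def
proof (rule integral_cong_circle)
  fix z :: complex assume z: "cmod z = 1"
  show "cnj (poly (monom 1 n) z) * poly (poly_star n p * q) z = cnj (poly p z) * poly q z"
    using z assms circle_cnj_power(2)[OF z, of n] by (simp add: poly_monom poly_star_circle mult.assoc[symmetric])
qed (rule measurable_pip)+

text \<open>The integrand is brought to a polynomial of degree at most \<open>2 * n\<close> by the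
  factor \<open>z ^ n\<close>. Subtracting its interpolation by the functions
  \<open>\<bar>lagrange_poly w\<bar>\<^sup>2\<close>, treated in the same way, leaves a polynomial
  that vanishes on \<open>W\<close>.\<close>

lemma quadrature:
  assumes "degree p \<le> n" "degree q \<le> n"
  shows "pip M p q = (\<Sum>w\<in>W. weight w *\<^sub>R (cnj (poly p w) * poly q w))"
proof -
  define r where "r = poly_star n p * q -
    (\<Sum>w\<in>W. Polynomial.smult (cnj (poly p w) * poly q w) (poly_star n (lagrange_poly w) * lagrange_poly w))"
  have deg2: "degree (poly_star n f * g) \<le> 2 * n" if "degree g \<le> n" for f g
    using degree_mult_le[of "poly_star n f" g] degree_poly_star[of n f] that by linarith
  have "degree r \<le> 2 * n"
    unfolding r_def
    by (intro degree_diff_le degree_sum_le order_trans[OF degree_smult_le] deg2 assms degree_lagrange_poly finite_para_roots)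
  moreover have "poly r v = 0" if v: "v \<in> W" for v
  proof -
    have v1: "cmod v = 1" using v para_root_circle by (simp add: W_def)
    have "(\<Sum>w\<in>W. cnj (poly p w) * poly q w * (poly (poly_star n (lagrange_poly w)) v * poly (lagrange_poly w) v))
      = (\<Sum>w\<in>W. if w = v then v ^ n * (cnj (poly p v) * poly q v) else 0)"
      using v by (intro sum.cong) (auto simp: poly_star_circle[OF degree_lagrange_poly v1] poly_lagrange_poly)
    also have "\<dots> = v ^ n * (cnj (poly p v) * poly q v)"
      using v finite_para_roots by simp
    finally show ?thesis
      by (simp add: r_def poly_sum poly_star_circle[OF assms(1) v1])
  qed
  ultimately have "0 = pip M (monom 1 n) r" by (rule vanishing_moment[symmetric])
  also have "\<dots> = pip M p q - (\<Sum>w\<in>W. cnj (poly p w) * poly q w * pip M (lagrange_poly w) (lagrange_poly w))"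
    by (simp add: r_def pip_diff_right pip_sum_right pip_smult_right pip_poly_star[OF assms(1)]
        pip_poly_star[OF degree_lagrange_poly])
  finally show ?thesis by (simp add: weight[symmetric] scaleR_conv_of_real mult_ac)
qed

private abbreviation "N \<equiv> finite_support_measure W weight"

lemma W_circle: "w \<in> W \<Longrightarrow> cmod w = 1"
  using para_root_circle by (simp add: W_def)

lemma pip_quadrature_measure:
  assumes "degree p \<le> n" "degree q \<le> n"
  shows "pip N p q = pip M p q"
  using quadrature[OF assms] pip_finite_support[OF finite_para_roots W_circle weight_pos] by simp

lemma sum_weight: "(\<Sum>w\<in>W. weight w) = 1"
proof -
  have "complex_of_real (\<Sum>w\<in>W. weight w) = pip M 1 1"
    by (subst quadrature) (auto simp: scaleR_conv_of_real)
  also have "\<dots> = 1" using mass by (simp add: pip_def scaleR_conv_of_real)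
  finally show ?thesis by (metis of_real_eq_1_iff)
qed

lemma circle_prob_quadrature_measure: "circle_prob N"
proof -
  interpret N: circle_measure N
    by (rule circle_measure_finite_support[OF finite_para_roots W_circle weight_pos])
  have "emeasure N UNIV = (\<Sum>w\<in>W. ennreal (weight w))"
    using emeasure_finite_support_measure[OF finite_para_roots W_circle weight_pos, where A = UNIV] by simp
  also have "\<dots> = 1" using sum_weight weight_pos by (subst sum_ennreal) (auto intro: less_imp_le)
  finally have "prob_space N" by (intro prob_spaceI) simp
  then show ?thesis using N.AE_circle by (simp add: circle_prob_def N.sets_borel)
qed

text \<open>Exactness of the quadrature for pairs of degree at most \<open>n\<close> transfers the
  polynomials up to index \<open>n\<close>. At index \<open>n + 1\<close>, the size of the support,
  \<open>opuc\<close> is by definition the product over the support, which is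
  \<open>Q\<close>.\<close>

lemma has_verblunsky_quadrature_measure: "has_verblunsky_fin N (Suc n) a"
proof -
  interpret N: circle_measure N
    by (rule circle_measure_finite_support[OF finite_para_roots W_circle weight_pos])
  have supp: "msupport N = W"
    by (rule msupport_finite_support[OF finite_para_roots W_circle weight_pos])
  have op: "opuc N k = szego a k" if "k \<le> n" for k
  proof (rule N.opuc_eqI[OF _ lead_coeff_szego degree_szego])
    show "\<not> (finite (msupport N) \<and> k = card (msupport N))"
      using that by (simp add: supp card_para_roots)
    show "pip N (monom 1 j) (szego a k) = 0" if "j < k" for j
      using that \<open>k \<le> n\<close> orth degree_monom_le[of "1 :: complex" j]
      by (subst pip_quadrature_measure) (auto simp: orth_def)
    show "q = 0" if "degree q < k" "pip N q q = 0" for q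
      using that \<open>k \<le> n\<close> posdef[of q] pip_quadrature_measure[of q q] by auto
  qed
  have opQ: "opuc N (Suc n) = szego a (Suc n)"
    using finite_para_roots para_decompose by (simp only: opuc_def supp card_para_roots Q_def) simp
  have "verblunsky_rec N k (a k)" if "k < Suc n" for k
  proof (cases "k = n")
    case True
    then show ?thesis using op[of n] opQ by (simp add: verblunsky_rec_def)
  next
    case False
    then show ?thesis using op[of k] op[of "Suc k"] that by (simp add: verblunsky_rec_def)
  qed
  then show ?thesis
    by (simp add: has_verblunsky_fin_def circle_prob_quadrature_measure supp finite_para_roots card_para_roots)
qed

end

theorem para_orthogonal_measure:
  assumes "orth M a n" "\<And>j. j < n \<Longrightarrow> cmod (a j) < 1" "cmod (a n) = 1" "measure M UNIV = 1"
  obtains W p where "finite W" "card W = Suc n" "\<And>w. w \<in> W \<Longrightarrow> cmod w = 1" "\<And>w. w \<in> W \<Longrightarrow> p w > 0"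
    "(\<Sum>w\<in>W. p w) = 1" "has_verblunsky_fin (finite_support_measure W p) (Suc n) a"
    "szego a (Suc n) = (\<Prod>w\<in>W. [:- w, 1:])"
proof -
  note * = refl refl assms
  show ?thesis
    by (rule that[OF finite_para_roots[OF *] card_para_roots[OF *] W_circle[OF *] weight_pos[OF *]
          sum_weight[OF *] has_verblunsky_quadrature_measure[OF *] para_decompose[OF *]])
qed

end

section \<open>Traces of CMV matrices\<close>

lemma measurable_powi [measurable]:
  assumes [measurable]: "f \<in> borel_measurable M"
  shows "(\<lambda>x. f x powi l :: complex) \<in> borel_measurable M"
  by (cases "l \<ge> 0") (simp_all add: power_int_def)

lemma measurable_cmv_monom [measurable]: "cmv_monom n \<in> borel_measurable borel"
  unfolding cmv_monom_def[abs_def] by (cases "even n") simp_all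

lemma measurable_cmv_basis [measurable]: "cmv_basis \<mu> n \<in> borel_measurable borel"
proof (induction n rule: less_induct)
  case (less n)
  have [measurable]: "(\<lambda>z. \<Sum>k<n. l2_inner \<mu> (cmv_basis \<mu> k) (cmv_monom n) * cmv_basis \<mu> k z) \<in> borel_measurable borel"
    using less by (intro borel_measurable_sum borel_measurable_times) auto
  show ?case by (subst cmv_basis.simps) (simp add: Let_def)
qed

definition cmv_exponent :: "nat \<Rightarrow> int" where
  "cmv_exponent n = (if even n then - int (n div 2) else int (Suc n div 2))"

lemma cmv_monom_powi: "cmv_monom n z = z powi cmv_exponent n"
  by (simp add: cmv_monom_def cmv_exponent_def)

lemma inj_cmv_exponent: "cmv_exponent i = cmv_exponent j \<Longrightarrow> i = j"
  by (auto simp: cmv_exponent_def split: if_splits elim!: evenE oddE)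

text \<open>Multiplication by \<open>z ^ (n div 2)\<close> turns the first \<open>n + 1\<close> CMV
  monomials into ordinary monomials of degree at most \<open>n\<close>.\<close>

lemma cmv_exponent_bounds: "j \<le> n \<Longrightarrow> 0 \<le> int (n div 2) + cmv_exponent j \<and> int (n div 2) + cmv_exponent j \<le> int n"
proof -
  assume "j \<le> n"
  then show ?thesis
    unfolding cmv_exponent_def by (cases "even j") (simp, linarith, simp, presburger)
qed

context
  fixes W :: "complex set" and p :: "complex \<Rightarrow> real" and N :: nat
  assumes finW: "finite W" and W_circle: "\<And>w. w \<in> W \<Longrightarrow> cmod w = 1" and p_pos: "\<And>w. w \<in> W \<Longrightarrow> p w > 0"
    and card_W: "card W = N"
begin

private abbreviation "\<mu> \<equiv> finite_support_measure W p"
private abbreviation "e \<equiv> cmv_basis \<mu>"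

lemma W_nonzero: "w \<in> W \<Longrightarrow> w \<noteq> 0"
  using W_circle[of w] by auto

lemma l2_inner_finite_support:
  assumes [measurable]: "f \<in> borel_measurable borel" "g \<in> borel_measurable borel"
  shows "l2_inner \<mu> f g = (\<Sum>w\<in>W. p w * (cnj (f w) * g w))"
proof -
  have "cnj \<in> borel_measurable borel" by (intro borel_measurable_continuous_onI continuous_intros)
  then have [measurable]: "(\<lambda>z. cnj (f z)) \<in> borel_measurable borel"
    by (rule measurable_compose[OF assms(1)])
  show ?thesis
    unfolding l2_inner_def
    by (subst integral_finite_support_measure[OF finW W_circle p_pos]) (auto simp: scaleR_conv_of_real)
qed

lemma l2_norm_finite_support:
  assumes [measurable]: "f \<in> borel_measurable borel"
  shows "(l2_norm \<mu> f)\<^sup>2 = (\<Sum>w\<in>W. p w * (cmod (f w))\<^sup>2)"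
proof -
  have "(\<integral>z. (cmod (f z))\<^sup>2 \<partial>\<mu>) = (\<Sum>w\<in>W. p w * (cmod (f w))\<^sup>2)"
    by (subst integral_finite_support_measure[OF finW W_circle p_pos]) auto
  moreover have "\<dots> \<ge> 0" using p_pos by (intro sum_nonneg mult_nonneg_nonneg) (auto intro: less_imp_le)
  ultimately show ?thesis by (simp add: l2_norm_def)
qed

text \<open>After clearing negative powers a vanishing combination is a polynomial of degree at most
  \<open>n < N\<close> with the \<open>N\<close> points of \<open>W\<close> among its zeros; its
  coefficients are the \<open>c j\<close> because the exponents are distinct.\<close>

lemma cmv_monom_independent:
  assumes "n < N" "\<And>w. w \<in> W \<Longrightarrow> (\<Sum>j\<le>n. c j * cmv_monom j w) = 0" "i \<le> n"
  shows "c i = 0"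
proof -
  define x where "x j = nat (int (n div 2) + cmv_exponent j)" for j
  have x: "int (x j) = int (n div 2) + cmv_exponent j" if "j \<le> n" for j
    using cmv_exponent_bounds[OF that] by (simp add: x_def)
  have x_le: "x j \<le> n" if "j \<le> n" for j
    using cmv_exponent_bounds[OF that] by (simp add: x_def nat_le_iff)
  define P where "P = (\<Sum>j\<le>n. monom (c j) (x j))"
  have degP: "degree P \<le> n"
    unfolding P_def by (intro degree_sum_le) (auto intro: order_trans[OF degree_monom_le x_le])
  have "poly P w = 0" if w: "w \<in> W" for w
  proof -
    have "w ^ x j = w ^ (n div 2) * cmv_monom j w" if "j \<le> n" for j
      using W_nonzero[OF w] unfolding cmv_monom_powi
      by (metis power_int_add power_int_of_nat x[OF that])
    then have "poly P w = (\<Sum>j\<le>n. w ^ (n div 2) * (c j * cmv_monom j w))"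
      unfolding P_def poly_sum poly_monom by (intro sum.cong) auto
    also have "\<dots> = 0" using assms(2)[OF w] by (simp flip: sum_distrib_left)
    finally show ?thesis .
  qed
  then have sub: "W \<subseteq> {w. poly P w = 0}" by auto
  have "P = 0"
  proof (rule ccontr)
    assume "P \<noteq> 0"
    then have "card W \<le> degree P"
      using card_mono[OF poly_roots_finite sub] card_poly_roots_bound[of P] by simp
    then show False using degP assms(1) card_W by simp
  qed
  moreover have "coeff P (x i) = (\<Sum>j\<le>n. if j = i then c i else 0)"
    unfolding P_def coeff_sum
  proof (intro sum.cong refl)
    fix j assume "j \<in> {..n}"
    then show "coeff (monom (c j) (x j)) (x i) = (if j = i then c i else 0)"
      using inj_cmv_exponent[of j i] x[of j] x[of i] assms(3) by (auto simp: coeff_monom)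
  qed
  ultimately show ?thesis using assms(3) by simp
qed

text \<open>Functions are compared on \<open>W\<close> only, that is, as elements of the
  finite-dimensional space of the measure.\<close>

definition in_span :: "nat \<Rightarrow> (complex \<Rightarrow> complex) \<Rightarrow> bool" where
  "in_span n f \<longleftrightarrow> (\<exists>c. \<forall>w\<in>W. f w = (\<Sum>j<n. c j * cmv_monom j w))"

lemma in_span_mono: "in_span k f \<Longrightarrow> k \<le> n \<Longrightarrow> in_span n f"
proof -
  assume "in_span k f" "k \<le> n"
  then obtain c where c: "\<forall>w\<in>W. f w = (\<Sum>j<k. c j * cmv_monom j w)" by (auto simp: in_span_def)
  have "(\<Sum>j<n. (if j < k then c j else 0) * cmv_monom j w) = (\<Sum>j<k. c j * cmv_monom j w)" for w
    using \<open>k \<le> n\<close> by (intro sum.mono_neutral_cong_right) auto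
  with c show ?thesis unfolding in_span_def by (intro exI[of _ "\<lambda>j. if j < k then c j else 0"]) simp
qed

lemma in_span_add: "in_span n f \<Longrightarrow> in_span n g \<Longrightarrow> in_span n (\<lambda>w. f w + g w)"
  unfolding in_span_def
proof (elim exE)
  fix c d assume "\<forall>w\<in>W. f w = (\<Sum>j<n. c j * cmv_monom j w)" "\<forall>w\<in>W. g w = (\<Sum>j<n. d j * cmv_monom j w)"
  then show "\<exists>c. \<forall>w\<in>W. f w + g w = (\<Sum>j<n. c j * cmv_monom j w)"
    by (intro exI[of _ "\<lambda>j. c j + d j"]) (simp add: distrib_right sum.distrib)
qed

lemma in_span_scale: "in_span n f \<Longrightarrow> in_span n (\<lambda>w. b * f w)"
  unfolding in_span_def
proof (elim exE)
  fix c assume "\<forall>w\<in>W. f w = (\<Sum>j<n. c j * cmv_monom j w)"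
  then show "\<exists>c. \<forall>w\<in>W. b * f w = (\<Sum>j<n. c j * cmv_monom j w)"
    by (intro exI[of _ "\<lambda>j. b * c j"]) (simp add: sum_distrib_left mult.assoc)
qed

lemma in_span_zero: "in_span n (\<lambda>w. 0)"
  unfolding in_span_def by (intro exI[of _ "\<lambda>_. 0"]) simp

lemma in_span_sum: "(\<And>k. k \<in> A \<Longrightarrow> in_span n (f k)) \<Longrightarrow> in_span n (\<lambda>w. \<Sum>k\<in>A. f k w)"
  by (induction A rule: infinite_finite_induct) (auto intro: in_span_zero in_span_add)

lemma in_span_monom: "in_span (Suc n) (cmv_monom n)"
  unfolding in_span_def by (intro exI[of _ "\<lambda>j. if j = n then 1 else 0"]) (simp add: if_distrib if_distribR cong: if_cong)

lemma cmv_monom_not_in_span: "n < N \<Longrightarrow> \<not> in_span n (cmv_monom n)"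
proof
  assume n: "n < N" and "in_span n (cmv_monom n)"
  then obtain c where c: "\<forall>w\<in>W. cmv_monom n w = (\<Sum>j<n. c j * cmv_monom j w)" by (auto simp: in_span_def)
  have "(c(n := -1)) n = 0"
  proof (rule cmv_monom_independent[where n = n and i = n and c = "c(n := -1)"])
    fix w assume "w \<in> W"
    then show "(\<Sum>j\<le>n. (c(n := -1)) j * cmv_monom j w) = 0"
      using c by (simp add: lessThan_Suc_atMost[symmetric])
  qed (use n in auto)
  then show False by simp
qed

lemma l2_inner_diff_right:
  assumes [measurable]: "f \<in> borel_measurable borel" "g \<in> borel_measurable borel" "h \<in> borel_measurable borel"
  shows "l2_inner \<mu> f (\<lambda>z. g z - h z) = l2_inner \<mu> f g - l2_inner \<mu> f h"
  by (simp add: l2_inner_finite_support right_diff_distrib sum_subtractf)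

lemma l2_inner_cnj:
  assumes [measurable]: "f \<in> borel_measurable borel" "g \<in> borel_measurable borel"
  shows "cnj (l2_inner \<mu> f g) = l2_inner \<mu> g f"
  by (simp add: l2_inner_finite_support mult_ac)

lemma cmv_basis_orthonormal_span:
  "n < N \<Longrightarrow> in_span (Suc n) (e n) \<and> (\<forall>k<n. l2_inner \<mu> (e k) (e n) = 0) \<and> l2_inner \<mu> (e n) (e n) = 1"
proof (induction n rule: less_induct)
  case (less n)
  define b where "b k = l2_inner \<mu> (e k) (cmv_monom n)" for k
  define r where "r = (\<lambda>z. cmv_monom n z - (\<Sum>k<n. b k * e k z))"
  have [measurable]: "(\<lambda>z. \<Sum>k<n. b k * e k z) \<in> borel_measurable borel"
    by (intro borel_measurable_sum borel_measurable_times) auto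
  have [measurable]: "r \<in> borel_measurable borel"
    unfolding r_def by simp
  have en: "e n = (\<lambda>z. r z / l2_norm \<mu> r)"
    by (subst cmv_basis.simps) (simp add: Let_def r_def b_def)
  have orthn: "l2_inner \<mu> (e k) (e l) = (if k = l then 1 else 0)" if kl: "k < n" "l < n" for k l
  proof -
    consider "k = l" | "k < l" | "l < k" by linarith
    then show ?thesis
    proof cases
      case 3
      then have "l2_inner \<mu> (e l) (e k) = 0" using less kl by auto
      then show ?thesis using 3 l2_inner_cnj[of "e l" "e k"] by simp
    qed (use less kl in auto)
  qed
  have r_orth: "l2_inner \<mu> (e k) r = 0" if k: "k < n" for k
  proof -
    have "l2_inner \<mu> (e k) (\<lambda>z. \<Sum>l<n. b l * e l z) = (\<Sum>l<n. b l * l2_inner \<mu> (e k) (e l))"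
      by (simp add: l2_inner_finite_support sum_distrib_left mult_ac) (subst sum.swap, simp)
    also have "\<dots> = (\<Sum>l<n. if k = l then b k else 0)"
      by (intro sum.cong) (auto simp: orthn k)
    also have "\<dots> = b k" using k by simp
    finally show ?thesis
      unfolding r_def by (subst l2_inner_diff_right) (auto simp: b_def)
  qed
  have span_sum: "in_span n (\<lambda>z. \<Sum>k<n. b k * e k z)"
  proof (intro in_span_sum in_span_scale)
    fix k assume "k \<in> {..<n}"
    then show "in_span n (e k)" using less in_span_mono[of "Suc k" "e k" n] by auto
  qed
  \<comment> \<open>This keeps the norm in the Gram-Schmidt step from being 0, where division would
    yield the zero function.\<close>
  have "\<exists>w\<in>W. r w \<noteq> 0"
  proof (rule ccontr)
    assume "\<not> ?thesis"
    then have "\<forall>w\<in>W. cmv_monom n w = (\<Sum>k<n. b k * e k w)" by (simp add: r_def)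
    with span_sum have "in_span n (cmv_monom n)" by (simp add: in_span_def)
    then show False using cmv_monom_not_in_span less.prems by blast
  qed
  then obtain w where w: "w \<in> W" "r w \<noteq> 0" by auto
  have "(\<Sum>w\<in>W. p w * (cmod (r w))\<^sup>2) > 0"
    by (rule sum_pos2[OF finW w(1)]) (use w p_pos in \<open>auto simp: less_imp_le\<close>)
  then have "(l2_norm \<mu> r)\<^sup>2 > 0" by (simp add: l2_norm_finite_support)
  then have nz: "l2_norm \<mu> r \<noteq> 0" by auto
  have "in_span (Suc n) (\<lambda>z. (1 / l2_norm \<mu> r) * (cmv_monom n z + (-1) * (\<Sum>k<n. b k * e k z)))"
    by (intro in_span_scale in_span_add in_span_monom in_span_mono[OF span_sum]) simp
  then have "in_span (Suc n) (e n)" by (simp add: en r_def)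
  moreover have "l2_inner \<mu> (e k) (e n) = 0" if "k < n" for k
  proof -
    have "l2_inner \<mu> (e k) (e n) = l2_inner \<mu> (e k) r / l2_norm \<mu> r"
      unfolding en by (subst (1 2) l2_inner_finite_support) (auto simp: sum_divide_distrib)
    then show ?thesis using r_orth[OF that] by simp
  qed
  moreover have "l2_inner \<mu> (e n) (e n) = 1"
  proof -
    have "l2_inner \<mu> (e n) (e n) = (\<Sum>w\<in>W. p w * (cmod (r w))\<^sup>2) / (l2_norm \<mu> r)\<^sup>2"
      unfolding en
      by (subst l2_inner_finite_support)
        (auto simp: sum_divide_distrib power2_eq_square[of "l2_norm \<mu> r"] complex_norm_square mult_ac
          simp del: of_real_power intro!: sum.cong)
    also have "\<dots> = 1" using nz by (simp flip: l2_norm_finite_support)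
    finally show ?thesis by simp
  qed
  ultimately show ?case by blast
qed

lemma cmv_basis_orthonormal:
  assumes "i < N" "j < N"
  shows "(\<Sum>w\<in>W. p w * (cnj (e i w) * e j w)) = (if i = j then 1 else 0)"
proof -
  have "l2_inner \<mu> (e i) (e j) = (if i = j then 1 else 0)"
  proof -
    consider "i = j" | "i < j" | "j < i" by linarith
    then show ?thesis
    proof cases
      case 3
      then have "l2_inner \<mu> (e j) (e i) = 0" using cmv_basis_orthonormal_span[of i] assms by auto
      then show ?thesis using 3 l2_inner_cnj[of "e j" "e i"] by simp
    qed (use cmv_basis_orthonormal_span[of j] assms in auto)
  qed
  then show ?thesis by (simp add: l2_inner_finite_support)
qed

text \<open>Orthonormality says that a matrix has a right inverse. It is square because
  \<open>card W = N\<close>, so the inverse is two-sided, and the other product is the completeness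
  relation.\<close>

lemma cmv_basis_complete:
  assumes "v \<in> W" "w \<in> W"
  shows "(\<Sum>k<N. cnj (e k v) * e k w) * p w = (if v = w then 1 else 0)"
proof -
  obtain h where h: "bij_betw h {..<N} W"
    using finW card_W by (metis ex_bij_betw_nat_finite atLeast0LessThan)
  define A where "A = mat N N (\<lambda>(k, i). complex_of_real (sqrt (p (h i))) * e k (h i))"
  define B where "B = mat N N (\<lambda>(i, k). complex_of_real (sqrt (p (h i))) * cnj (e k (h i)))"
  have AB: "A \<in> carrier_mat N N" "B \<in> carrier_mat N N" by (simp_all add: A_def B_def)
  have hW: "h i \<in> W" if "i < N" for i using h that by (auto simp: bij_betw_def)
  have sq: "complex_of_real (sqrt (p (h i))) * complex_of_real (sqrt (p (h i))) = p (h i)" if "i < N" for i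
    using p_pos[OF hW[OF that]] by (simp flip: of_real_mult)
  have "A * B = 1\<^sub>m N"
  proof (rule eq_matI)
    fix i j assume ij: "i < dim_row (1\<^sub>m N :: complex mat)" "j < dim_col (1\<^sub>m N :: complex mat)"
    have "(A * B) $$ (i, j) = (\<Sum>l<N. p (h l) * (cnj (e j (h l)) * e i (h l)))"
      using ij AB by (auto simp: A_def B_def scalar_prod_def atLeast0LessThan sq[symmetric] mult_ac
          simp del: of_real_mult intro!: sum.cong)
    also have "\<dots> = (\<Sum>w\<in>W. p w * (cnj (e j w) * e i w))"
      by (rule sum.reindex_bij_betw[OF h])
    finally show "(A * B) $$ (i, j) = 1\<^sub>m N $$ (i, j)"
      using ij cmv_basis_orthonormal[of j i] by auto
  qed (use AB in auto)
  then have BA: "B * A = 1\<^sub>m N" by (rule mat_mult_left_right_inverse[OF AB])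
  obtain i j where ij: "i < N" "j < N" "v = h i" "w = h j"
    using assms h by (auto simp: bij_betw_def)
  have ne: "complex_of_real (sqrt (p (h i))) \<noteq> 0" "complex_of_real (sqrt (p (h j))) \<noteq> 0"
    using p_pos[OF hW[OF ij(1)]] p_pos[OF hW[OF ij(2)]] by auto
  have "(if i = j then 1 else 0) = (B * A) $$ (i, j)" using BA ij by simp
  also have "\<dots> = sqrt (p (h i)) * sqrt (p (h j)) * (\<Sum>k<N. cnj (e k v) * e k w)"
    using ij AB by (auto simp: A_def B_def scalar_prod_def atLeast0LessThan sum_distrib_left mult_ac
        intro!: sum.cong)
  finally have eq: "complex_of_real (sqrt (p (h i))) * complex_of_real (sqrt (p (h j))) * (\<Sum>k<N. cnj (e k v) * e k w) = (if i = j then 1 else 0)" by simp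
  have iff: "i = j \<longleftrightarrow> v = w" using h ij by (auto simp: bij_betw_def inj_on_def)
  show ?thesis
  proof (cases "v = w")
    case True
    then show ?thesis using eq iff ij sq[of i] by (simp add: mult.commute)
  next
    case False
    then show ?thesis using eq iff ne by auto
  qed
qed

text \<open>Multiplication by \<open>w powi l\<close> in the CMV basis. As \<open>l\<close> varies
  these matrices form a group, which provides the powers and the inverse of the CMV matrix at
  once.\<close>

definition mult_mat :: "int \<Rightarrow> complex mat" where
  "mult_mat l = mat N N (\<lambda>(i, j). \<Sum>w\<in>W. p w * (cnj (e i w) * (w powi l * e j w)))"

lemma mult_mat_carrier [simp]: "mult_mat l \<in> carrier_mat N N"
  by (simp add: mult_mat_def)

lemma cmv_matrix_mult_mat: "cmv_matrix \<mu> N = mult_mat 1"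
  unfolding cmv_matrix_def mult_mat_def
  by (rule cong_mat) (auto simp: l2_inner_finite_support)

lemma mult_mat_0: "mult_mat 0 = 1\<^sub>m N"
  by (rule eq_matI) (auto simp: mult_mat_def cmv_basis_orthonormal)

lemma mult_mat_mult: "mult_mat l * mult_mat m = mult_mat (l + m)"
proof (rule eq_matI)
  fix i j assume "i < dim_row (mult_mat (l + m))" "j < dim_col (mult_mat (l + m))"
  then have ij: "i < N" "j < N" by (simp_all add: mult_mat_def)
  have "(mult_mat l * mult_mat m) $$ (i, j) =
    (\<Sum>k<N. (\<Sum>w\<in>W. p w * (cnj (e i w) * (w powi l * e k w))) * (\<Sum>v\<in>W. p v * (cnj (e k v) * (v powi m * e j v))))"
    using ij by (simp add: mult_mat_def scalar_prod_def atLeast0LessThan)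
  also have "\<dots> = (\<Sum>k<N. \<Sum>w\<in>W. \<Sum>v\<in>W. (p v * cnj (e i w) * w powi l * v powi m * e j v) * (cnj (e k v) * e k w * p w))"
    by (simp add: sum_product mult_ac)
  also have "\<dots> = (\<Sum>w\<in>W. \<Sum>v\<in>W. \<Sum>k<N. (p v * cnj (e i w) * w powi l * v powi m * e j v) * (cnj (e k v) * e k w * p w))"
    by (subst sum.swap, rule sum.cong, simp, subst sum.swap, simp)
  also have "\<dots> = (\<Sum>w\<in>W. \<Sum>v\<in>W. (p v * cnj (e i w) * w powi l * v powi m * e j v) * ((\<Sum>k<N. cnj (e k v) * e k w) * p w))"
    by (simp add: sum_distrib_left sum_distrib_right)
  also have "\<dots> = (\<Sum>w\<in>W. \<Sum>v\<in>W. if v = w then p w * (cnj (e i w) * (w powi (l + m) * e j w)) else 0)"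
    by (intro sum.cong refl) (auto simp: cmv_basis_complete power_int_add W_nonzero)
  also have "\<dots> = (\<Sum>w\<in>W. p w * (cnj (e i w) * (w powi (l + m) * e j w)))"
    using finW by simp
  finally show "(mult_mat l * mult_mat m) $$ (i, j) = mult_mat (l + m) $$ (i, j)"
    using ij by (simp add: mult_mat_def)
qed (simp_all add: mult_mat_def)

lemma mult_mat_power: "mult_mat l ^\<^sub>m n = mult_mat (l * int n)"
proof (induction n)
  case 0
  then show ?case by (simp add: mult_mat_0) (simp add: mult_mat_def)
next
  case (Suc n)
  then show ?case by (simp add: mult_mat_mult algebra_simps)
qed

text \<open>The inverse found by elimination is identified through uniqueness; failure of the
  elimination is impossible since \<open>mult_mat (- 1)\<close> shows the matrix to be a
  unit.\<close>

lemma mat_inverse_mult_mat: "mat_inverse (mult_mat 1) = Some (mult_mat (- 1))"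
proof (cases "mat_inverse (mult_mat 1)")
  case None
  have "mult_mat 1 \<in> Units (ring_mat TYPE(complex) N ())"
    using mult_mat_mult[of 1 "-1"] mult_mat_mult[of "-1" 1]
    by (auto simp: Units_def ring_mat_def mult_mat_0 intro!: bexI[of _ "mult_mat (-1)"])
  then show ?thesis using mat_inverse(1)[OF mult_mat_carrier None, of "()"] by simp
next
  case (Some B)
  note B = mat_inverse(2)[OF mult_mat_carrier Some]
  have "B = B * (mult_mat 1 * mult_mat (- 1))"
    using B right_mult_one_mat[of B N N] by (simp add: mult_mat_mult mult_mat_0)
  also have "\<dots> = (B * mult_mat 1) * mult_mat (- 1)"
    using B by (intro assoc_mult_mat[symmetric, of _ N N _ N _ N]) auto
  also have "\<dots> = mult_mat (- 1)"
    using B by (simp add: left_mult_one_mat[OF mult_mat_carrier])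
  finally show ?thesis using Some by simp
qed

lemma mat_powi_mult_mat: "mat_powi (mult_mat 1) l = mult_mat l"
  by (auto simp: mat_powi_def mat_inverse_mult_mat mult_mat_power)

text \<open>Completeness at a single point,
  \<open>(\<Sum>i<N. cnj (e i w) * e i w) * p w = 1\<close>, gives each \<open>w\<close> the weight
  1; no diagonalization is required.\<close>

lemma trace_mult_mat: "(\<Sum>i<N. mult_mat l $$ (i, i)) = (\<Sum>w\<in>W. w powi l)"
proof -
  have "(\<Sum>i<N. mult_mat l $$ (i, i)) = (\<Sum>i<N. \<Sum>w\<in>W. w powi l * (cnj (e i w) * e i w * p w))"
    by (simp add: mult_mat_def mult_ac)
  also have "\<dots> = (\<Sum>w\<in>W. w powi l * ((\<Sum>i<N. cnj (e i w) * e i w) * p w))"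
    by (subst sum.swap) (simp add: sum_distrib_left sum_distrib_right)
  also have "\<dots> = (\<Sum>w\<in>W. w powi l)"
    by (intro sum.cong) (auto simp: cmv_basis_complete)
  finally show ?thesis .
qed

theorem trace_laurent_cmv:
  "mat_trace (laurent_mat V (cmv_matrix \<mu> N)) = (\<Sum>w\<in>W. laurent_eval V w)"
proof -
  have dims: "dim_row (mult_mat 1) = N" "dim_col (mult_mat 1) = N" by (simp_all add: mult_mat_def)
  have "mat_trace (laurent_mat V (cmv_matrix \<mu> N)) =
     (\<Sum>i<N. \<Sum>l\<in>Poly_Mapping.keys V. Poly_Mapping.lookup V l * mult_mat l $$ (i, i))"
    by (simp add: mat_trace_def laurent_mat_def cmv_matrix_mult_mat dims mat_powi_mult_mat)
  also have "\<dots> = (\<Sum>l\<in>Poly_Mapping.keys V. Poly_Mapping.lookup V l * (\<Sum>i<N. mult_mat l $$ (i, i)))"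
    by (subst sum.swap) (simp add: sum_distrib_left)
  also have "\<dots> = (\<Sum>w\<in>W. laurent_eval V w)"
    by (simp add: trace_mult_mat laurent_eval_def sum_distrib_left) (rule sum.swap)
  finally show ?thesis .
qed

end

section \<open>The logarithmic potential\<close>

lemma AE_circ_neq: "AE w in circ. w \<noteq> z"
proof -
  have "countable {t. cis t = z}"
  proof (cases "\<exists>s. cis s = z")
    case True
    then obtain s where s: "cis s = z" ..
    have "{t. cis t = z} \<subseteq> range (\<lambda>n::int. s + 2 * pi * real_of_int n)"
      using s by (auto simp: complex_eq_iff image_iff) (metis sin_cos_eq_iff)
    then show ?thesis by (rule countable_subset) auto
  qed auto
  then have "{t. cis t = z} \<in> null_sets lborel" by (rule countable_imp_null_set_lborel)
  then have "AE t in lborel. cis t \<noteq> z" by (auto dest: AE_not_in)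
  then have "AE t in uniform_measure lborel {0..<2 * pi}. cis t \<noteq> z"
    by (intro AE_uniform_measureI) auto
  then show ?thesis unfolding circ_def by (subst AE_distr_iff) auto
qed

lemma integral_circ_power_cnj: "(\<integral>w. w ^ n * cnj w ^ k \<partial>circ) = (if k = n then 1 else 0)"
proof (cases "k \<le> n")
  case True
  have "(\<integral>w. w ^ n * cnj w ^ k \<partial>circ) = (\<integral>w. w ^ (n - k) \<partial>circ)"
    by (rule circ.integral_cong_circle)
      (use True in \<open>auto intro!: borel_measurable_continuous_onI continuous_intros
        simp: mult.commute[of "_ ^ n"] circle_cnj_power_diff\<close>)
  then show ?thesis using True by (simp add: integral_circ_power)
next
  case False
  have "(\<integral>w. w ^ n * cnj w ^ k \<partial>circ) = (\<integral>w. cnj (w ^ (k - n)) \<partial>circ)"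
  proof (rule circ.integral_cong_circle)
    fix w :: complex assume "cmod w = 1"
    then have "cnj (cnj w ^ n * w ^ k) = cnj (w ^ (k - n))"
      using False by (subst circle_cnj_power_diff) auto
    then show "w ^ n * cnj w ^ k = cnj (w ^ (k - n))" by simp
  qed (auto intro!: borel_measurable_continuous_onI continuous_intros)
  also have "\<dots> = cnj (\<integral>w. w ^ (k - n) \<partial>circ)" by (rule Bochner_Integration.integral_cnj)
  finally show ?thesis using False by (simp add: integral_circ_power)
qed

text \<open>Real part of the power series of \<open>ln (1 - v)\<close>. The term at
  \<open>k = 0\<close> is 0 because division by 0 gives 0.\<close>

lemma ln_one_minus_sums:
  assumes "cmod v < 1"
  shows "(\<lambda>k. - (v ^ k + cnj v ^ k) / (2 * of_nat k)) sums complex_of_real (ln (cmod (1 - v)))"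
proof -
  have s: "(\<lambda>k. - (v ^ k) / of_nat k) sums ln (1 - v)"
    using Ln_series'[of "- v"] assms by simp
  then have "(\<lambda>k. cnj (- (v ^ k) / of_nat k)) sums cnj (ln (1 - v))" by (subst sums_cnj)
  from sums_mult[OF sums_add[OF s this], of "1 / 2"]
  have "(\<lambda>k. - (v ^ k + cnj v ^ k) / (2 * of_nat k)) sums (1 / 2 * (ln (1 - v) + cnj (ln (1 - v))))"
    by (simp add: add_divide_distrib diff_divide_distrib mult.commute[of 2])
  moreover have "1 - v \<noteq> 0" using assms by auto
  then have "1 / 2 * (ln (1 - v) + cnj (ln (1 - v))) = complex_of_real (ln (cmod (1 - v)))"
    by (simp add: complex_add_cnj)
  ultimately show ?thesis by simp
qed

context
  fixes z :: complex
  assumes z: "cmod z = 1"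
begin

text \<open>For \<open>r < 1\<close> the logarithmic series may be integrated termwise, and only the
  conjugate power with \<open>k = n\<close> survives. At \<open>n = 0\<close> the right-hand side is
  a division by 0, hence 0, which is the correct mean of the logarithm.\<close>

lemma log_radial_moment:
  assumes r: "0 \<le> r" "r < (1 :: real)"
  shows "(\<integral>w. w ^ n * complex_of_real (ln (cmod (z - complex_of_real r * w))) \<partial>circ) = - ((complex_of_real r * z) ^ n) / (2 * of_nat n)"
proof -
  define v where "v w = complex_of_real r * cnj z * w" for w
  have cv: "cmod (v w) = r" if "cmod w = 1" for w
    using that r z by (simp add: v_def norm_mult)
  define f where "f k w = w ^ n * (- (v w ^ k + cnj (v w) ^ k) / (2 * of_nat k))" for k w
  have contf: "continuous_on UNIV (f k)" for k
    unfolding f_def v_def by (cases "k = 0") (auto intro!: continuous_intros)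
  have f_le: "cmod (f k w) \<le> r ^ k" if "cmod w = 1" for k w
  proof (cases "k = 0")
    case False
    have "cmod (f k w) = cmod (v w ^ k + cnj (v w) ^ k) / (2 * real k)"
      unfolding f_def norm_mult norm_divide norm_minus_cancel norm_power using that by simp
    also have "\<dots> \<le> (2 * r ^ k) / (2 * real k)"
      using norm_triangle_ineq[of "v w ^ k" "cnj (v w) ^ k"] cv[OF that]
      by (intro divide_right_mono) (auto simp: norm_power)
    also have "\<dots> \<le> r ^ k" using False r by (simp add: divide_simps mult_le_cancel_left1)
    finally show ?thesis .
  qed (simp add: f_def)
  have int: "integrable circ (f k)" for k by (rule circ.integrable_continuous[OF contf])
  have sg: "summable (\<lambda>k. r ^ k)" using r by (intro summable_geometric) auto
  have sumAE: "AE w in circ. summable (\<lambda>k. norm (f k w))"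
    using circ.AE_circle
  proof eventually_elim
    case (elim w)
    then show ?case by (intro summable_comparison_test'[OF sg, of 0]) (simp add: f_le)
  qed
  have norm_int: "norm (\<integral>w. norm (f k w) \<partial>circ) \<le> r ^ k" for k
  proof -
    have "(\<integral>w. norm (f k w) \<partial>circ) \<le> (\<integral>w. r ^ k \<partial>circ)"
      by (rule circ.integral_mono_circle) (auto intro: integrable_norm int f_le)
    then show ?thesis by (simp add: circ.prob_space[simplified])
  qed
  have sumint: "summable (\<lambda>k. \<integral>w. norm (f k w) \<partial>circ)"
    by (rule summable_comparison_test'[OF sg, of 0]) (rule norm_int)
  have fm [measurable]: "f k \<in> borel_measurable borel" for k by (rule borel_measurable_continuous_onI[OF contf])
  have meas: "(\<lambda>w. w ^ n * complex_of_real (ln (cmod (z - complex_of_real r * w)))) \<in> borel_measurable borel"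
  proof -
    have [measurable]: "(\<lambda>w. w ^ n :: complex) \<in> borel_measurable borel" "(\<lambda>w. cmod (z - complex_of_real r * w)) \<in> borel_measurable borel"
      by (intro borel_measurable_continuous_onI continuous_intros)+
    show ?thesis by measurable
  qed
  have "(\<integral>w. w ^ n * complex_of_real (ln (cmod (z - complex_of_real r * w))) \<partial>circ) = (\<integral>w. (suminf (\<lambda>k. f k w)) \<partial>circ)"
  proof (rule integral_cong_AE)
    show "AE w in circ. w ^ n * complex_of_real (ln (cmod (z - complex_of_real r * w))) = (suminf (\<lambda>k. f k w))"
      using circ.AE_circle
    proof eventually_elim
      case (elim w)
      have "cnj z * z = 1" using circle_cnj_power(2)[OF z, of 1] by simp
      then have "z - complex_of_real r * w = z * (1 - v w)" by (simp add: v_def algebra_simps)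
      then have "cmod (z - complex_of_real r * w) = cmod (1 - v w)" using z by (simp add: norm_mult)
      moreover have "(\<lambda>k. f k w) sums (w ^ n * complex_of_real (ln (cmod (1 - v w))))"
        unfolding f_def by (intro sums_mult ln_one_minus_sums) (use cv elim r in auto)
      ultimately show ?case by (simp add: sums_iff)
    qed
  qed (simp_all add: meas borel_measurable_suminf)
  also have "\<dots> = (suminf (\<lambda>k. \<integral>w. f k w \<partial>circ))"
    by (rule integral_suminf[OF int sumAE sumint])
  also have "(\<lambda>k. \<integral>w. f k w \<partial>circ) = (\<lambda>k. if k = n then - ((complex_of_real r * z) ^ n) / (2 * of_nat n) else 0)"
  proof
    fix k
    show "(\<integral>w. f k w \<partial>circ) = (if k = n then - ((complex_of_real r * z) ^ n) / (2 * of_nat n) else 0)"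
    proof (cases "k = 0")
      case False
      have "f k w = - ((complex_of_real r * cnj z) ^ k) / (2 * of_nat k) * w ^ (n + k) + - ((complex_of_real r * z) ^ k) / (2 * of_nat k) * (w ^ n * cnj w ^ k)" for w
        unfolding f_def v_def divide_inverse by (simp add: power_mult_distrib power_add algebra_simps)
      then have "(\<integral>w. f k w \<partial>circ) = - ((complex_of_real r * cnj z) ^ k) / (2 * of_nat k) * (\<integral>w. w ^ (n + k) \<partial>circ)
          + - ((complex_of_real r * z) ^ k) / (2 * of_nat k) * (\<integral>w. w ^ n * cnj w ^ k \<partial>circ)"
        by (simp only:) (subst Bochner_Integration.integral_add;
          (intro circ.integrable_continuous continuous_intros)?; simp)
      then show ?thesis using False by (simp add: integral_circ_power integral_circ_power_cnj)
    qed (simp add: f_def)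
  qed
  also have "suminf (\<lambda>k. if k = n then - ((complex_of_real r * z) ^ n) / (2 * of_nat n) else 0) = - ((complex_of_real r * z) ^ n) / (2 * of_nat n)"
    using sums_unique[OF sums_single[of n "\<lambda>k. - ((complex_of_real r * z) ^ n) / (2 * of_nat n)"]] by simp
  finally show ?thesis .
qed

private definition "R k = 1 - 1 / (real k + 1)"

lemma R: "0 \<le> R k" "R k < 1" and R_lim: "R \<longlonglongrightarrow> 1"
proof -
  show "R \<longlonglongrightarrow> 1" unfolding R_def by real_asymp
qed (auto simp: R_def field_simps)

lemma measurable_log_dist [measurable]: "(\<lambda>w. ln (cmod (z - complex_of_real r * w))) \<in> borel_measurable borel"
proof -
  have [measurable]: "(\<lambda>w. cmod (z - complex_of_real r * w)) \<in> borel_measurable borel"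
    by (intro borel_measurable_continuous_onI continuous_intros)
  show ?thesis by measurable
qed

lemma measurable_log_dist1 [measurable]: "(\<lambda>w. ln (cmod (z - w))) \<in> borel_measurable borel"
  using measurable_log_dist[of 1] by simp

text \<open>For \<open>\<bar>z\<bar> = \<bar>w\<bar> = 1\<close> one has \<open>\<bar>z - w\<bar> \<le> 2 \<bar>z - r w\<bar>\<close>; this is the domination in the limit \<open>r \<rightarrow> 1\<close>.\<close>

lemma log_radial_le: "cmod w = 1 \<Longrightarrow> ln (cmod (z - complex_of_real (R k) * w)) \<le> ln 2"
  and log_radial_ge: "cmod w = 1 \<Longrightarrow> w \<noteq> z \<Longrightarrow> ln (cmod (z - w)) - ln 2 \<le> ln (cmod (z - complex_of_real (R k) * w))"
proof -
  assume w: "cmod w = 1"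
  have Rw: "cmod (complex_of_real (R k) * w) = R k" using w R[of k] by (simp add: norm_mult)
  have pos: "0 < cmod (z - complex_of_real (R k) * w)"
    using norm_triangle_ineq2[of z "complex_of_real (R k) * w"] Rw z R[of k] by linarith
  have "cmod (z - complex_of_real (R k) * w) \<le> 2"
    using norm_triangle_ineq4[of z "complex_of_real (R k) * w"] Rw z R[of k] by simp
  then show "ln (cmod (z - complex_of_real (R k) * w)) \<le> ln 2" using pos by simp
  assume "w \<noteq> z"
  then have p1: "0 < cmod (z - w)" by auto
  have "z - w = (z - complex_of_real (R k) * w) - complex_of_real (1 - R k) * w" by (simp add: algebra_simps)
  then have "cmod (z - w) \<le> cmod (z - complex_of_real (R k) * w) + cmod (complex_of_real (1 - R k) * w)"
    using norm_triangle_ineq4[of "z - complex_of_real (R k) * w" "complex_of_real (1 - R k) * w"] by (simp only:)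
  also have "cmod (complex_of_real (1 - R k) * w) = 1 - R k" using w R[of k]
    by (simp only: norm_mult norm_of_real) simp
  also have "1 - R k \<le> cmod (z - complex_of_real (R k) * w)"
    using norm_triangle_ineq2[of z "complex_of_real (R k) * w"] Rw z by simp
  finally have "cmod (z - w) \<le> 2 * cmod (z - complex_of_real (R k) * w)" by simp
  then have "ln (cmod (z - w)) \<le> ln (2 * cmod (z - complex_of_real (R k) * w))" using p1 pos by simp
  then show "ln (cmod (z - w)) - ln 2 \<le> ln (cmod (z - complex_of_real (R k) * w))"
    using pos by (simp add: ln_mult)
qed

lemma log_radial_lim: "w \<noteq> z \<Longrightarrow> (\<lambda>k. ln (cmod (z - complex_of_real (R k) * w))) \<longlonglongrightarrow> ln (cmod (z - w))"
  using tendsto_intros(1) by (auto intro!: tendsto_eq_intros R_lim)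

lemma integrable_log_radial: "integrable circ (\<lambda>w. ln (cmod (z - complex_of_real (R k) * w)))"
proof (rule circ.integrable_bounded)
  fix w :: complex assume w: "cmod w = 1"
  have Rw: "cmod (complex_of_real (R k) * w) = R k" using w R[of k] by (simp add: norm_mult)
  have "1 - R k \<le> cmod (z - complex_of_real (R k) * w)"
    using norm_triangle_ineq2[of z "complex_of_real (R k) * w"] Rw z by simp
  then have "ln (1 - R k) \<le> ln (cmod (z - complex_of_real (R k) * w))"
    using R[of k] by (subst ln_le_cancel_iff) auto
  then show "norm (ln (cmod (z - complex_of_real (R k) * w))) \<le> \<bar>ln (1 - R k)\<bar> + ln 2"
    using log_radial_le[OF w, of k] ln_gt_zero[of "2 :: real"] unfolding real_norm_def by linarith
qed measurable

text \<open>The logarithm is bounded above by \<open>ln 2\<close>, so \<open>ln 2\<close> minus it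
  is nonnegative. Its integral for radius less than 1 is exactly \<open>ln 2\<close>, and Fatou's
  lemma carries this bound to radius 1.\<close>

theorem integrable_log_dist: "integrable circ (\<lambda>w. ln (cmod (z - w)))"
proof -
  have "(\<integral>w. ln (cmod (z - complex_of_real (R k) * w)) \<partial>circ) = 0" for k
  proof -
    have "complex_of_real (\<integral>w. ln (cmod (z - complex_of_real (R k) * w)) \<partial>circ) = 0"
      using log_radial_moment[of "R k" 0] R[of k] by simp
    then show ?thesis by simp
  qed
  then have i: "(\<integral>\<^sup>+w. ennreal (ln 2 - ln (cmod (z - complex_of_real (R k) * w))) \<partial>circ) = ennreal (ln 2)" for k
    using integrable_log_radial[of k] circ.AE_circle log_radial_le
    by (subst nn_integral_eq_integral) (auto simp: circ.prob_space[simplified])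
  have "(\<integral>\<^sup>+w. ennreal (ln 2 - ln (cmod (z - w))) \<partial>circ)
     = (\<integral>\<^sup>+w. liminf (\<lambda>k. ennreal (ln 2 - ln (cmod (z - complex_of_real (R k) * w)))) \<partial>circ)"
  proof (rule nn_integral_cong_AE)
    show "AE w in circ. ennreal (ln 2 - ln (cmod (z - w))) = liminf (\<lambda>k. ennreal (ln 2 - ln (cmod (z - complex_of_real (R k) * w))))"
      using AE_circ_neq[of z]
    proof eventually_elim
      case (elim w)
      have "(\<lambda>k. ennreal (ln 2 - ln (cmod (z - complex_of_real (R k) * w)))) \<longlonglongrightarrow> ennreal (ln 2 - ln (cmod (z - w)))"
        by (intro tendsto_intros log_radial_lim elim)
      then show ?case by (simp add: lim_imp_Liminf)
    qed
  qed
  also have "\<dots> \<le> liminf (\<lambda>k. \<integral>\<^sup>+w. ennreal (ln 2 - ln (cmod (z - complex_of_real (R k) * w))) \<partial>circ)"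
    by (rule nn_integral_liminf) simp
  also have "\<dots> = ennreal (ln 2)" by (simp add: i Liminf_const)
  finally have fin: "(\<integral>\<^sup>+w. ennreal (ln 2 - ln (cmod (z - w))) \<partial>circ) < \<infinity>"
    by (simp add: order.strict_trans1 ennreal_less_top)
  have "integrable circ (\<lambda>w. ln 2 - ln (cmod (z - w)))"
  proof (rule integrableI_nonneg)
    show "AE w in circ. 0 \<le> ln 2 - ln (cmod (z - w))"
      using circ.AE_circle AE_circ_neq[of z]
    proof eventually_elim
      case (elim w)
      have "cmod (z - w) \<le> 2" using norm_triangle_ineq4[of z w] elim z by simp
      then show ?case using elim by simp
    qed
  qed (use fin in auto)
  from Bochner_Integration.integrable_diff[OF circ.integrable_continuous[OF continuous_on_const, of "ln 2"] this]
  show ?thesis by simp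
qed

theorem log_dist_moment:
  "(\<integral>w. w ^ n * complex_of_real (ln (cmod (z - w))) \<partial>circ) = - (z ^ n) / (2 * of_nat n)"
proof -
  have [measurable]: "(\<lambda>w. w ^ n :: complex) \<in> borel_measurable borel"
    by (intro borel_measurable_continuous_onI continuous_intros)
  have "(\<lambda>k. \<integral>w. w ^ n * complex_of_real (ln (cmod (z - complex_of_real (R k) * w))) \<partial>circ) \<longlonglongrightarrow>
    (\<integral>w. w ^ n * complex_of_real (ln (cmod (z - w))) \<partial>circ)"
  proof (rule integral_dominated_convergence)
    show "integrable circ (\<lambda>w. \<bar>ln (cmod (z - w))\<bar> + ln 2)"
      by (intro Bochner_Integration.integrable_add integrable_abs integrable_log_dist) auto
    show "AE w in circ. (\<lambda>k. w ^ n * complex_of_real (ln (cmod (z - complex_of_real (R k) * w)))) \<longlonglongrightarrow> w ^ n * complex_of_real (ln (cmod (z - w)))"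
      using AE_circ_neq[of z] by eventually_elim (intro tendsto_intros log_radial_lim)
    show "AE w in circ. norm (w ^ n * complex_of_real (ln (cmod (z - complex_of_real (R k) * w)))) \<le> \<bar>ln (cmod (z - w))\<bar> + ln 2" for k
      using AE_circ_neq[of z] circ.AE_circle
    proof eventually_elim
      case (elim w)
      then show ?case
        using log_radial_le[of w k] log_radial_ge[of w k] by (simp add: norm_mult norm_power)
    qed
  qed simp_all
  moreover have "(\<lambda>k. - ((complex_of_real (R k) * z) ^ n) / (2 * of_nat n)) \<longlonglongrightarrow> - ((complex_of_real 1 * z) ^ n) / (2 * of_nat n)"
  proof -
    have "(\<lambda>k. complex_of_real (R k) * z) \<longlonglongrightarrow> complex_of_real 1 * z"
      by (intro tendsto_intros tendsto_of_real R_lim)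
    then show ?thesis by (cases "n = 0") (auto intro!: tendsto_intros simp del: of_real_1 mult_1)
  qed
  ultimately show ?thesis
    using R by (simp add: log_radial_moment LIMSEQ_unique)
qed

corollary integral_log_dist: "(\<integral>w. ln (cmod (z - w)) \<partial>circ) = 0"
proof -
  have "complex_of_real (\<integral>w. ln (cmod (z - w)) \<partial>circ) = 0"
    using log_dist_moment[of 0] by simp
  then show ?thesis by simp
qed

end

section \<open>Trigonometric polynomials\<close>

text \<open>On the circle every real trigonometric polynomial is the real part of an ordinary
  polynomial, so moments of nonnegative order suffice later on.\<close>

definition real_trig :: "(complex \<Rightarrow> real) \<Rightarrow> bool" where
  "real_trig f \<longleftrightarrow> (\<exists>p. \<forall>z. cmod z = 1 \<longrightarrow> f z = Re (poly p z))"

lemma real_trigI: "(\<And>z. cmod z = 1 \<Longrightarrow> f z = Re (poly p z)) \<Longrightarrow> real_trig f"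
  by (auto simp: real_trig_def)

lemma real_trig_poly: "real_trig (\<lambda>z. Re (poly p z))"
  by (rule real_trigI) (rule refl)

lemma real_trig_cong: "(\<And>z. cmod z = 1 \<Longrightarrow> f z = g z) \<Longrightarrow> real_trig f \<longleftrightarrow> real_trig g"
  by (auto simp: real_trig_def)

lemma real_trig_const: "real_trig (\<lambda>z. c)"
  by (rule real_trigI[where p = "[:complex_of_real c:]"]) simp

lemma real_trig_add: "real_trig f \<Longrightarrow> real_trig g \<Longrightarrow> real_trig (\<lambda>z. f z + g z)"
  unfolding real_trig_def by (metis poly_add plus_complex.sel(1))

lemma real_trig_sum: "(\<And>i. i \<in> A \<Longrightarrow> real_trig (f i)) \<Longrightarrow> real_trig (\<lambda>z. \<Sum>i\<in>A. f i z)"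
  by (induction A rule: infinite_finite_induct) (auto intro: real_trig_const real_trig_add)

lemma real_trig_Re_mult: "real_trig (\<lambda>z. Re (c * z))"
  by (rule real_trigI[where p = "[:0, c:]"]) (simp add: mult.commute)

lemma real_trig_monomials: "real_trig (\<lambda>z. Re (c * (z ^ i * cnj z ^ j)))"
proof (cases "j \<le> i")
  case True
  show ?thesis
  proof (rule real_trigI[where p = "monom c (i - j)"])
    fix z :: complex assume "cmod z = 1"
    then show "Re (c * (z ^ i * cnj z ^ j)) = Re (poly (monom c (i - j)) z)"
      using True circle_cnj_power_diff[of z j i] by (simp add: poly_monom mult.commute)
  qed
next
  case False
  show ?thesis
  proof (rule real_trigI[where p = "monom (cnj c) (j - i)"])
    fix z :: complex assume z: "cmod z = 1"
    have "z ^ i * cnj z ^ j = cnj (cnj z ^ i * z ^ j)" by simp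
    also have "\<dots> = cnj (z ^ (j - i))" using False z by (subst circle_cnj_power_diff) auto
    finally have eq: "z ^ i * cnj z ^ j = cnj (z ^ (j - i))" .
    have "Re (c * cnj (z ^ (j - i))) = Re (cnj (cnj c * z ^ (j - i)))"
      by (simp only: complex_cnj_mult complex_cnj_cnj)
    also have "\<dots> = Re (cnj c * z ^ (j - i))" by (rule cnj.sel(1))
    finally show "Re (c * (z ^ i * cnj z ^ j)) = Re (poly (monom (cnj c) (j - i)) z)"
      by (simp only: poly_monom eq)
  qed
qed

lemma real_trig_mult:
  assumes "real_trig f" "real_trig g"
  shows "real_trig (\<lambda>z. f z * g z)"
proof -
  obtain p q where p: "\<And>z. cmod z = 1 \<Longrightarrow> f z = Re (poly p z)" and q: "\<And>z. cmod z = 1 \<Longrightarrow> g z = Re (poly q z)"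
    using assms by (auto simp: real_trig_def)
  \<comment> \<open>From \<open>Re u * Re v = Re (u * v) / 2 + Re (u * cnj v) / 2\<close>; the
    second part is a sum of the monomials of \<open>real_trig_monomials\<close>.\<close>
  have "real_trig (\<lambda>z. Re (poly (Polynomial.smult (1 / 2) (p * q)) z) +
    (\<Sum>i\<le>degree p. \<Sum>j\<le>degree q. Re (coeff p i * cnj (coeff q j) / 2 * (z ^ i * cnj z ^ j))))"
    by (intro real_trig_add real_trig_sum real_trig_monomials real_trig_poly)
  moreover have "Re (poly p z) * Re (poly q z) = Re (poly (Polynomial.smult (1 / 2) (p * q)) z) +
    (\<Sum>i\<le>degree p. \<Sum>j\<le>degree q. Re (coeff p i * cnj (coeff q j) / 2 * (z ^ i * cnj z ^ j)))" for z
  proof -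
    have "(\<Sum>i\<le>degree p. \<Sum>j\<le>degree q. Re (coeff p i * cnj (coeff q j) / 2 * (z ^ i * cnj z ^ j)))
      = Re (\<Sum>i\<le>degree p. \<Sum>j\<le>degree q. (coeff p i * z ^ i) * cnj (coeff q j * z ^ j) / 2)"
      by (simp add: mult_ac)
    also have "\<dots> = Re (poly p z * cnj (poly q z) / 2)"
      by (simp add: poly_altdef[of p] poly_altdef[of q] sum_product sum_divide_distrib)
    finally show ?thesis by (simp add: field_simps)
  qed
  ultimately have "real_trig (\<lambda>z. Re (poly p z) * Re (poly q z))" by (simp only:)
  then show ?thesis
    using real_trig_cong[of "\<lambda>z. f z * g z" "\<lambda>z. Re (poly p z) * Re (poly q z)"] p q by simp
qed

lemma real_trig_power: "real_trig f \<Longrightarrow> real_trig (\<lambda>z. f z ^ n)"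
  by (induction n) (auto intro: real_trig_const real_trig_mult)

lemma real_trig_prod: "(\<And>i. i \<in> A \<Longrightarrow> real_trig (f i)) \<Longrightarrow> real_trig (\<lambda>z. \<Prod>i\<in>A. f i z)"
  by (induction A rule: infinite_finite_induct) (auto intro: real_trig_const real_trig_mult)

lemma laurent_eval_superset:
  assumes "finite A" "Poly_Mapping.keys V \<subseteq> A"
  shows "laurent_eval V z = (\<Sum>l\<in>A. Poly_Mapping.lookup V l * z powi l)"
  unfolding laurent_eval_def using assms
  by (intro sum.mono_neutral_left) (auto simp: in_keys_iff)

lemma sum_symmetric_int: "(\<Sum>l\<in>{- int d..int d}. f l) = f 0 + (\<Sum>n=1..d. f (int n) + f (- int n) :: 'a::comm_monoid_add)"
proof (induction d)
  case (Suc d)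
  have "{- int (Suc d)..int (Suc d)} = insert (int (Suc d)) (insert (- int (Suc d)) {- int d..int d})" by auto
  then have "(\<Sum>l\<in>{- int (Suc d)..int (Suc d)}. f l) = f (int (Suc d)) + (f (- int (Suc d)) + (\<Sum>l\<in>{- int d..int d}. f l))"
    by (simp del: of_nat_Suc)
  then show ?case using Suc by (simp add: ac_simps del: of_nat_Suc)
qed simp

lemma in_vars_cong:
  assumes "in_vars n P" "\<And>i. i < n \<Longrightarrow> x i = y i"
  shows "cp_eval P x = cp_eval P y"
  unfolding cp_eval_def
proof (intro sum.cong refl arg_cong2[of _ _ _ _ "(*)"] prod.cong)
  fix e v assume "e \<in> Poly_Mapping.keys P" "v \<in> Poly_Mapping.keys e"
  then have "v \<in> Inl ` {..<n} \<union> Inr ` {..<n}" using assms(1) by (auto simp: in_vars_def)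
  then show "(case v of Inl i \<Rightarrow> x i | Inr i \<Rightarrow> cnj (x i)) ^ Poly_Mapping.lookup e v =
      (case v of Inl i \<Rightarrow> y i | Inr i \<Rightarrow> cnj (y i)) ^ Poly_Mapping.lookup e v"
    using assms(2) by auto
qed

section \<open>The trace formula\<close>

text \<open>The density of \<eta> as it enters the trace formula and the entropy limits. That it is
  a trigonometric polynomial is what makes its potential a Laurent polynomial, see
  \<open>potential_exists\<close>.\<close>

locale circle_weight =
  fixes g :: "complex \<Rightarrow> real" and C :: real
  assumes g_measurable [measurable]: "g \<in> borel_measurable borel"
    and g_nonneg: "\<And>z. cmod z = 1 \<Longrightarrow> 0 \<le> g z"
    and g_le: "\<And>z. cmod z = 1 \<Longrightarrow> g z \<le> C"
    and integral_g: "(\<integral>z. g z \<partial>circ) = 1"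
begin

lemma integrable_weighted:
  fixes f :: "complex \<Rightarrow> 'b::{banach, second_countable_topology}"
  assumes "integrable circ f"
  shows "integrable circ (\<lambda>z. g z *\<^sub>R f z)"
proof (rule Bochner_Integration.integrable_bound)
  show "integrable circ (\<lambda>z. C *\<^sub>R f z)" using assms by simp
  show "AE z in circ. norm (g z *\<^sub>R f z) \<le> norm (C *\<^sub>R f z)"
    using circ.AE_circle
  proof eventually_elim
    case (elim z)
    then show ?case using g_nonneg[of z] g_le[of z] by (auto intro!: mult_right_mono)
  qed
  have "f \<in> borel_measurable borel" using assms by (simp add: integrable_iff_bounded)
  then show "(\<lambda>z. g z *\<^sub>R f z) \<in> borel_measurable circ" by simp
qed

lemma integrable_weighted_log: "cmod z = 1 \<Longrightarrow> integrable circ (\<lambda>w. g w * ln (cmod (z - w)))"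
  using integrable_weighted[OF integrable_log_dist, of z] by simp

lemma integral_density_log:
  assumes "cmod z = 1"
  shows "(\<integral>w. ln (cmod (z - w)) \<partial>density circ (\<lambda>z. ennreal (g z))) = (\<integral>w. g w * ln (cmod (z - w)) \<partial>circ)"
  using circ.integral_density_circle(1)[OF measurable_log_dist1[OF assms] g_measurable g_nonneg] by simp

theorem log_poly_roots:
  assumes "finite W" "\<And>w. w \<in> W \<Longrightarrow> cmod w = 1"
  shows "integrable circ (\<lambda>z. g z * ln (cmod (poly (\<Prod>w\<in>W. [:- w, 1:]) z)))" (is "integrable circ ?f")
    and "(\<integral>z. g z * ln (cmod (poly (\<Prod>w\<in>W. [:- w, 1:]) z)) \<partial>circ) = (\<Sum>w\<in>W. \<integral>z. g z * ln (cmod (w - z)) \<partial>circ)"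
proof -
  have "(\<lambda>z. cmod (poly (\<Prod>w\<in>W. [:- w, 1:]) z)) \<in> borel_measurable borel"
    by (intro borel_measurable_continuous_onI continuous_intros)
  then have m: "?f \<in> borel_measurable borel" by measurable
  have "AE z in circ. \<forall>w\<in>W. z \<noteq> w" using assms(1) AE_circ_neq by (simp add: AE_finite_all)
  then have ae: "AE z in circ. (\<Sum>w\<in>W. g z * ln (cmod (w - z))) = ?f z"
  proof eventually_elim
    case (elim z)
    then have "ln (cmod (poly (\<Prod>w\<in>W. [:- w, 1:]) z)) = (\<Sum>w\<in>W. ln (cmod (z - w)))"
      using assms(1) by (simp add: poly_prod prod_norm[symmetric] ln_prod)
    then show ?case by (simp add: sum_distrib_left norm_minus_commute)
  qed
  have i: "integrable circ (\<lambda>z. \<Sum>w\<in>W. g z * ln (cmod (w - z)))"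
    using assms(2) by (intro Bochner_Integration.integrable_sum integrable_weighted_log) auto
  then show "integrable circ ?f"
    using m by (subst integrable_cong_AE[OF _ _ ae, symmetric]) (auto simp: integrable_iff_bounded)
  have "(\<integral>z. ?f z \<partial>circ) = (\<integral>z. (\<Sum>w\<in>W. g z * ln (cmod (w - z))) \<partial>circ)"
    using m i ae by (intro integral_cong_AE) (auto simp: integrable_iff_bounded)
  also have "\<dots> = (\<Sum>w\<in>W. \<integral>z. g z * ln (cmod (w - z)) \<partial>circ)"
    using assms(2) by (intro Bochner_Integration.integral_sum integrable_weighted_log) auto
  finally show "(\<integral>z. ?f z \<partial>circ) = (\<Sum>w\<in>W. \<integral>z. g z * ln (cmod (w - z)) \<partial>circ)" .
qed

text \<open>Fubini: for fixed z the average over \<beta> is the potential of \<open>circ\<close> at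
  the unimodular point \<open>u z\<close>, which is 0.\<close>

theorem average_log:
  assumes [measurable]: "u \<in> borel_measurable borel" and u: "\<And>z. cmod z = 1 \<Longrightarrow> cmod (u z) = 1"
  shows "integrable circ (\<lambda>\<beta>. \<integral>z. g z * ln (cmod (\<beta> - u z)) \<partial>circ)"
    and "(\<integral>\<beta>. (\<integral>z. g z * ln (cmod (\<beta> - u z)) \<partial>circ) \<partial>circ) = 0"
proof -
  interpret pp: pair_sigma_finite circ circ by standard
  have [measurable_cong]: "sets circ = sets borel" by (rule circ.sets_borel)
  have m2: "(\<lambda>(z, \<beta>). g z * ln (cmod (\<beta> - u z))) \<in> borel_measurable (circ \<Otimes>\<^sub>M circ)"
    by measurable
  have in1: "integrable circ (\<lambda>\<beta>. ln (cmod (\<beta> - u z)))" and int0: "(\<integral>\<beta>. ln (cmod (\<beta> - u z)) \<partial>circ) = 0"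
    if "cmod z = 1" for z
    using integrable_log_dist[OF u[OF that]] integral_log_dist[OF u[OF that]] by (simp_all add: norm_minus_commute)
  \<comment> \<open>If \<open>y \<le> ln 2\<close>, then
    \<open>\<bar>y\<bar> \<le> 2 * ln 2 - y\<close>; the mean of the logarithm being 0, the constant
    remains.\<close>
  have bound: "(\<integral>\<beta>. norm (g z * ln (cmod (\<beta> - u z))) \<partial>circ) \<le> C * (2 * ln 2)" if z: "cmod z = 1" for z
  proof -
    have "(\<integral>\<beta>. norm (g z * ln (cmod (\<beta> - u z))) \<partial>circ) \<le> (\<integral>\<beta>. C * (2 * ln 2 - ln (cmod (\<beta> - u z))) \<partial>circ)"
    proof (rule integral_mono_AE)
      show "AE \<beta> in circ. norm (g z * ln (cmod (\<beta> - u z))) \<le> C * (2 * ln 2 - ln (cmod (\<beta> - u z)))"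
        using circ.AE_circle AE_circ_neq[of "u z"]
      proof eventually_elim
        case (elim \<beta>)
        have "cmod (\<beta> - u z) \<le> 2" using norm_triangle_ineq4[of \<beta> "u z"] elim u[OF z] by simp
        then have "ln (cmod (\<beta> - u z)) \<le> ln 2" using elim by simp
        then have "\<bar>ln (cmod (\<beta> - u z))\<bar> \<le> 2 * ln 2 - ln (cmod (\<beta> - u z))" using ln_gt_zero[of "2 :: real"] by linarith
        then show ?case
          unfolding real_norm_def abs_mult using g_nonneg[OF z] g_le[OF z] by (intro mult_mono) auto
      qed
    qed (use in1[OF z] in auto)
    also have "\<dots> = C * (2 * ln 2)"
      using in1[OF z] int0[OF z] by (simp add: circ.prob_space[simplified])
    finally show ?thesis .
  qed
  have int: "integrable (circ \<Otimes>\<^sub>M circ) (\<lambda>(z, \<beta>). g z * ln (cmod (\<beta> - u z)))"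
  proof (rule pp.Fubini_integrable[OF m2])
    have nm: "(\<lambda>z. \<integral>\<beta>. norm (g z * ln (cmod (\<beta> - u z))) \<partial>circ) \<in> borel_measurable circ" by measurable
    show "integrable circ (\<lambda>z. \<integral>\<beta>. norm (case (z, \<beta>) of (z, \<beta>) \<Rightarrow> g z * ln (cmod (\<beta> - u z))) \<partial>circ)"
      unfolding prod.case
      by (rule circ.integrable_bounded[where B = "C * (2 * ln 2)"])
        (use nm bound in \<open>auto simp: integral_nonneg_AE\<close>)
    show "AE z in circ. integrable circ (\<lambda>\<beta>. case (z, \<beta>) of (z, \<beta>) \<Rightarrow> g z * ln (cmod (\<beta> - u z)))"
      using circ.AE_circle by eventually_elim (simp add: in1)
  qed
  show "integrable circ (\<lambda>\<beta>. \<integral>z. g z * ln (cmod (\<beta> - u z)) \<partial>circ)"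
    using pp.integrable_snd[OF int] by simp
  have "(\<integral>\<beta>. (\<integral>z. g z * ln (cmod (\<beta> - u z)) \<partial>circ) \<partial>circ) = (\<integral>z. (\<integral>\<beta>. g z * ln (cmod (\<beta> - u z)) \<partial>circ) \<partial>circ)"
    by (rule pp.Fubini_integral[OF int])
  also have "\<dots> = (\<integral>z. 0 \<partial>circ)"
  proof (rule integral_cong_AE)
    show "AE z in circ. (\<integral>\<beta>. g z * ln (cmod (\<beta> - u z)) \<partial>circ) = 0"
      using circ.AE_circle by eventually_elim (simp add: int0)
  qed simp_all
  finally show "(\<integral>\<beta>. (\<integral>z. g z * ln (cmod (\<beta> - u z)) \<partial>circ) \<partial>circ) = 0" by simp
qed

end

lemma tendsto_cp_eval:
  assumes "\<And>i. ((\<lambda>n. x n i) \<longlongrightarrow> y i) F"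
  shows "((\<lambda>n. cp_eval P (x n)) \<longlongrightarrow> cp_eval P y) F"
  unfolding cp_eval_def
proof (intro tendsto_sum tendsto_mult tendsto_const tendsto_prod tendsto_power)
  fix v :: "nat + nat"
  show "((\<lambda>n. case v of Inl i \<Rightarrow> x n i | Inr i \<Rightarrow> cnj (x n i)) \<longlongrightarrow>
      (case v of Inl i \<Rightarrow> y i | Inr i \<Rightarrow> cnj (y i))) F"
    by (cases v) (auto intro!: assms tendsto_intros)
qed

context circle_weight
begin

theorem potential_exists:
  assumes "real_trig g"
  shows "\<exists>V. Poly_Mapping.lookup V 0 = 0 \<and>
    (\<forall>z. cmod z = 1 \<longrightarrow> laurent_eval V z = complex_of_real (2 * (\<integral>w. g w * ln (cmod (z - w)) \<partial>circ)))"
proof -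
  obtain p where p: "\<And>z. cmod z = 1 \<Longrightarrow> g z = Re (poly p z)"
    using assms by (auto simp: real_trig_def)
  define d where "d = degree p"
  \<comment> \<open>The coefficients of twice the potential, as dictated by
    \<open>log_dist_moment\<close> and its conjugate.\<close>
  define c where "c l = (if l > 0 then - coeff p (nat l) / (2 * of_nat (nat l))
      else if l < 0 then - cnj (coeff p (nat (- l))) / (2 * of_nat (nat (- l))) else 0)" for l :: int
  have c_zero: "c l = 0" if "l \<notin> {- int d..int d}" for l
    using that coeff_eq_0[of p "nat l"] coeff_eq_0[of p "nat (- l)"] by (auto simp: c_def d_def)
  define V where "V = Abs_poly_mapping c"
  have "finite {l. c l \<noteq> 0}" by (rule finite_subset[of _ "{- int d..int d}"]) (use c_zero in blast)+
  then have V: "Poly_Mapping.lookup V = c" unfolding V_def by (rule lookup_Abs_poly_mapping)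
  have "laurent_eval V z = complex_of_real (2 * (\<integral>w. g w * ln (cmod (z - w)) \<partial>circ))" if z: "cmod z = 1" for z
  proof -
    have z1: "inverse z = cnj z" using circle_cnj_power(1)[OF z, of 1] by (intro inverse_unique) simp
    define S where "S = (\<Sum>i\<le>d. coeff p i * (- (z ^ i) / (2 * of_nat i)))"
    have "laurent_eval V z = (\<Sum>l\<in>{- int d..int d}. c l * z powi l)"
      unfolding V[symmetric]
      by (rule laurent_eval_superset) (use c_zero V in \<open>auto simp del: atLeastAtMost_iff simp: in_keys_iff\<close>)
    also have "\<dots> = (\<Sum>n=1..d. c (int n) * z powi (int n) + c (- int n) * z powi (- int n))"
      by (simp add: sum_symmetric_int) (simp add: c_def)
    also have "\<dots> = (\<Sum>n=1..d. (coeff p n * (- (z ^ n) / (2 * of_nat n))) + cnj (coeff p n * (- (z ^ n) / (2 * of_nat n))))"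
      by (intro sum.cong refl) (simp add: c_def power_int_minus power_inverse[symmetric] z1)
    \<comment> \<open>The added term at \<open>n = 0\<close> is a division by 0, hence 0; the
      constant coefficient of \<open>p\<close> does not contribute to the potential.\<close>
    also have "\<dots> = (\<Sum>n\<in>{..d}. (coeff p n * (- (z ^ n) / (2 * of_nat n))) + cnj (coeff p n * (- (z ^ n) / (2 * of_nat n))))"
      by (rule sum.mono_neutral_left) (auto simp: not_less_eq_eq)
    also have "\<dots> = S + cnj S" by (simp only: S_def sum.distrib cnj_sum)
    also have "\<dots> = complex_of_real (2 * Re S)" by (rule complex_add_cnj)
    finally have eval: "laurent_eval V z = complex_of_real (2 * Re S)" .
    have i: "integrable circ (\<lambda>w. w ^ n * complex_of_real (ln (cmod (z - w))))" for n
    proof (rule Bochner_Integration.integrable_bound[OF integrable_log_dist[OF z]])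
      have [measurable]: "(\<lambda>w. w ^ n :: complex) \<in> borel_measurable borel"
        by (intro borel_measurable_continuous_onI continuous_intros)
      note [measurable] = measurable_log_dist1[OF z]
      show "(\<lambda>w. w ^ n * complex_of_real (ln (cmod (z - w)))) \<in> borel_measurable circ" by simp
      show "AE w in circ. norm (w ^ n * complex_of_real (ln (cmod (z - w)))) \<le> norm (ln (cmod (z - w)))"
        using circ.AE_circle by eventually_elim (simp add: norm_mult norm_power)
    qed
    have "S = (\<Sum>n\<le>d. coeff p n * (\<integral>w. w ^ n * complex_of_real (ln (cmod (z - w))) \<partial>circ))"
      by (simp add: S_def log_dist_moment[OF z])
    also have "\<dots> = (\<integral>w. (\<Sum>n\<le>d. coeff p n * (w ^ n * complex_of_real (ln (cmod (z - w))))) \<partial>circ)"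
      using i by (subst Bochner_Integration.integral_sum) auto
    also have "\<dots> = (\<integral>w. poly p w * complex_of_real (ln (cmod (z - w))) \<partial>circ)"
      by (simp add: poly_altdef d_def sum_distrib_right mult.assoc)
    finally have S: "S = (\<integral>w. poly p w * complex_of_real (ln (cmod (z - w))) \<partial>circ)" .
    have ip: "integrable circ (\<lambda>w. poly p w * complex_of_real (ln (cmod (z - w))))"
      using i unfolding poly_altdef sum_distrib_right mult.assoc
      by (intro Bochner_Integration.integrable_sum integrable_mult_right) auto
    have "Re S = (\<integral>w. Re (poly p w * complex_of_real (ln (cmod (z - w)))) \<partial>circ)"
      unfolding S using ip by (rule integral_Re[symmetric])
    also have "\<dots> = (\<integral>w. g w * ln (cmod (z - w)) \<partial>circ)"
    proof (rule circ.integral_cong_circle)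
      note [measurable] = measurable_log_dist1[OF z]
      have [measurable]: "poly p \<in> borel_measurable borel"
        by (intro borel_measurable_continuous_onI continuous_intros)
      show "(\<lambda>w. Re (poly p w * complex_of_real (ln (cmod (z - w))))) \<in> borel_measurable borel" by simp
      show "(\<lambda>w. g w * ln (cmod (z - w))) \<in> borel_measurable borel" by simp
    qed (simp add: p)
    finally show ?thesis using eval by simp
  qed
  moreover have "Poly_Mapping.lookup V 0 = 0" by (simp add: V) (simp add: c_def)
  ultimately show ?thesis by blast
qed

text \<open>The trace formula is applied to the coefficients \<open>\<alpha>\<^sub>0, \<dots>, \<alpha>\<^sub>n\<^sub>-\<^sub>1, 0, \<dots>, 0, \<beta>\<close> with \<open>d\<close> zeros
  and then averaged over \<open>\<beta>\<close>: since \<open>\<integral> ln \<bar>\<beta> - u\<bar> = 0\<close> for \<open>\<bar>u\<bar> = 1\<close>, the potential of the zeros of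
  the para-orthogonal polynomial averages to that of \<open>\<Phi>\<^sub>n\<close>, and the boundary term depends on
  \<open>\<beta>\<close> alone.\<close>

theorem trace_formula:
  assumes pot: "\<And>z. cmod z = 1 \<Longrightarrow>
      laurent_eval V z = complex_of_real (2 * (\<integral>w. g w * ln (cmod (z - w)) \<partial>circ))"
    and dec: "trace_decomposition V Fm Fp G"
    and \<alpha>: "\<And>j. cmod (\<alpha> j) < 1"
    and roots: "\<And>n w. poly (szego \<alpha> n) w = 0 \<Longrightarrow> cmod w < 1"
  obtains K where "\<And>n. laurent_degree V \<le> n \<Longrightarrow>
    2 * (\<integral>z. g z * ln (cmod (poly (szego \<alpha> n) z)) \<partial>circ) =
      K + (\<Sum>j<n. Re (cp_shift G (vtrunc \<alpha> n) j))"
proof -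
  define d where "d = laurent_degree V"
  \<comment> \<open>The terms of the decomposition that reach \<beta>. It sits at index
    \<open>n + d\<close>, the last of the \<open>d\<close> arguments of \<open>Fp\<close> starting
    at \<open>n + 1\<close> and of the \<open>d + 1\<close> arguments of \<open>G\<close> starting
    at \<open>n\<close>; all their other arguments are the inserted zeros.\<close>
  define c where "c \<beta> = Re (cp_eval Fp (\<lambda>i. if Suc i = d then \<beta> else 0)) + Re (cp_eval G (\<lambda>i. if i = d then \<beta> else 0))"
    for \<beta> :: complex
  define K where "K = Re (cp_shift Fm \<alpha> 0) + (\<integral>\<beta>. c \<beta> \<partial>circ)"
  have vars: "in_vars d Fm" "in_vars d Fp" "in_vars (Suc d) G"
    using dec by (auto simp: trace_decomposition_def Let_def d_def)
  have "2 * (\<integral>z. g z * ln (cmod (poly (szego \<alpha> n) z)) \<partial>circ) = K + (\<Sum>j<n. Re (cp_shift G (vtrunc \<alpha> n) j))"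
    if n: "d \<le> n" for n
  proof -
    let ?P = "szego \<alpha> n" and ?b = "bernstein_szego \<alpha> n"
    define T where "T = (\<integral>z. g z * ln (cmod (poly ?P z)) \<partial>circ)"
    \<comment> \<open>Chosen such that the para-orthogonal polynomial, times \<beta>, is
      \<open>z * poly (monom 1 d * ?P) z * (\<beta> - u z)\<close>. On the circle \<open>u\<close>
      is unimodular, being the inverse of a Blaschke product.\<close>
    define u where "u z = poly (rev_poly (monom 1 d * ?P)) z / (z * poly (monom 1 d * ?P) z)" for z
    define D where "D \<beta> = (\<integral>z. g z * ln (cmod (\<beta> - u z)) \<partial>circ)" for \<beta>
    have Pnz: "poly ?P z \<noteq> 0" if "cmod z = 1" for z using roots[of n z] that by auto
    interpret b: circle_measure ?b by (rule circle_measure_bernstein_szego) (use roots \<alpha> in auto)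
    have [measurable]: "poly q \<in> borel_measurable borel" for q :: "complex poly"
      by (intro borel_measurable_continuous_onI continuous_intros)
    have u_meas [measurable]: "u \<in> borel_measurable borel"
      unfolding u_def by simp
    have u_norm: "cmod (u z) = 1" if z: "cmod z = 1" for z
      using Pnz[OF z] z by (simp add: u_def norm_divide norm_mult norm_power poly_rev_poly_circle poly_monom)
    have iT: "integrable circ (\<lambda>z. g z * ln (cmod (poly ?P z)))"
    proof -
      have "continuous_on (sphere 0 1) (\<lambda>z. ln (cmod (poly ?P z)))"
        using Pnz by (intro continuous_intros) auto
      then obtain B where B: "\<forall>z. cmod z = 1 \<longrightarrow> norm (ln (cmod (poly ?P z))) \<le> B"
        using continuous_on_circle_bounded by blast
      have "integrable circ (\<lambda>z. ln (cmod (poly ?P z)))"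
        by (rule circ.integrable_bounded[where B = B]) (use B in auto)
      from integrable_weighted[OF this] show ?thesis by simp
    qed
    have key: "2 * T + 2 * D \<beta> = Re (cp_shift Fm \<alpha> 0) + (\<Sum>j<n. Re (cp_shift G (vtrunc \<alpha> n) j)) + c \<beta>"
      if \<beta>: "cmod \<beta> = 1" for \<beta>
    proof -
      define a where "a = (vtrunc \<alpha> n)(n + d := \<beta>)"
      have a_lt: "a j = vtrunc \<alpha> n j" if "j < n + d" for j using that by (simp add: a_def)
      have a_last: "a (n + d) = \<beta>" by (simp add: a_def)
      have sz: "szego a k = szego (vtrunc \<alpha> n) k" if "k \<le> n + d" for k
        by (rule szego_cong) (use that a_lt in auto)
      have "orth ?b (vtrunc \<alpha> n) (n + d)"
        by (rule bernstein_szego_orth) (use roots \<alpha> in auto)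
      then have orth: "orth ?b a (n + d)" by (auto simp: orth_def sz)
      have a_less: "cmod (a j) < 1" if "j < n + d" for j
        using a_lt[OF that] \<alpha> by (simp add: vtrunc_def)
      have mass: "measure ?b UNIV = 1" by (rule measure_bernstein_szego) (use roots \<alpha> in auto)
      obtain W p where W: "finite W" "card W = Suc (n + d)" "\<And>w. w \<in> W \<Longrightarrow> cmod w = 1" "\<And>w. w \<in> W \<Longrightarrow> p w > 0"
        "has_verblunsky_fin (finite_support_measure W p) (Suc (n + d)) a"
        "szego a (Suc (n + d)) = (\<Prod>w\<in>W. [:- w, 1:])"
        using b.para_orthogonal_measure[OF orth a_less _ mass] \<beta> a_last by metis
      let ?Q = "szego a (Suc (n + d))"
      have "mat_trace (laurent_mat V (cmv_matrix (finite_support_measure W p) (Suc (n + d)))) =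
          cp_shift Fm a 0 + cp_shift Fp a (Suc (n + d) - d) + (\<Sum>j = 0..Suc (n + d) - 1 - d. cp_shift G a j)"
      proof -
        have H: "mat_trace (laurent_mat V (cmv_matrix \<nu> N)) =
             cp_shift Fm \<gamma> 0 + cp_shift Fp \<gamma> (N - d) + (\<Sum>j = 0..N - 1 - d. cp_shift G \<gamma> j)"
          if "d < N" "\<forall>j<N - 1. cmod (\<gamma> j) < 1" "cmod (\<gamma> (N - 1)) = 1" "has_verblunsky_fin \<nu> N \<gamma>" for N \<gamma> \<nu>
          using dec that unfolding trace_decomposition_def Let_def d_def by blast
        show ?thesis by (rule H) (use W(5) a_less a_last \<beta> in auto)
      qed
      then have "(\<Sum>w\<in>W. laurent_eval V w) = cp_shift Fm a 0 + cp_shift Fp a (Suc n) + (\<Sum>j = 0..n. cp_shift G a j)"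
        by (subst (asm) trace_laurent_cmv[OF W(1,3,4,2)]) auto
      then have trace: "(\<Sum>w\<in>W. Re (laurent_eval V w)) =
          Re (cp_shift Fm a 0) + Re (cp_shift Fp a (Suc n)) + (\<Sum>j = 0..n. Re (cp_shift G a j))"
        by (metis (mono_tags, lifting) Re_sum plus_complex.sel(1) sum.cong)
      have "(\<Sum>w\<in>W. Re (laurent_eval V w)) = 2 * (\<Sum>w\<in>W. \<integral>z. g z * ln (cmod (w - z)) \<partial>circ)"
        using W(3) by (simp add: pot sum_distrib_left)
      also have "\<dots> = 2 * (\<integral>z. g z * ln (cmod (poly ?Q z)) \<partial>circ)"
        by (simp only: W(6) log_poly_roots(2)[OF W(1,3)])
      also have "(\<integral>z. g z * ln (cmod (poly ?Q z)) \<partial>circ) = T + D \<beta>"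
      proof -
        have iQ: "integrable circ (\<lambda>z. g z * ln (cmod (poly ?Q z)))"
          unfolding W(6) by (rule log_poly_roots(1)[OF W(1,3)])
        have "AE z in circ. \<forall>w\<in>W. z \<noteq> w" using W(1) AE_circ_neq by (simp add: AE_finite_all)
        then have ae: "AE z in circ. g z * ln (cmod (poly ?Q z)) - g z * ln (cmod (poly ?P z)) = g z * ln (cmod (\<beta> - u z))"
          using circ.AE_circle
        proof eventually_elim
          case (elim z)
          let ?S = "monom 1 d * ?P"
          have Q0: "poly ?Q z \<noteq> 0" unfolding W(6) poly_prod using elim W(1) by auto
          have S: "szego a (n + d) = ?S" by (simp add: sz szego_vtrunc)
          have nz: "z * poly ?S z \<noteq> 0" using Pnz elim by (auto simp: poly_monom)
          have Qz: "poly ?Q z = z * poly ?S z - cnj \<beta> * poly (rev_poly ?S) z"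
            using S a_last by simp
          have "\<beta> * cnj \<beta> = 1" using circle_cnj_power(1)[OF \<beta>, of 1] by simp
          then have "\<beta> * poly ?Q z = (z * poly ?S z) * (\<beta> - u z)"
            unfolding Qz u_def using nz by (simp add: right_diff_distrib mult.assoc[symmetric])
          then have "cmod (\<beta> * poly ?Q z) = cmod ((z * poly ?S z) * (\<beta> - u z))" by simp
          then have eq: "cmod (poly ?Q z) = cmod (poly ?P z) * cmod (\<beta> - u z)"
            using \<beta> elim by (simp add: norm_mult poly_monom norm_power)
          then have "ln (cmod (poly ?Q z)) = ln (cmod (poly ?P z)) + ln (cmod (\<beta> - u z))"
            using Q0 Pnz elim by (subst eq, subst ln_mult) auto
          then show ?case by (simp add: algebra_simps)
        qed
        have "(\<integral>z. g z * ln (cmod (poly ?Q z)) \<partial>circ) - T = (\<integral>z. g z * ln (cmod (poly ?Q z)) - g z * ln (cmod (poly ?P z)) \<partial>circ)"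
          unfolding T_def by (rule Bochner_Integration.integral_diff[OF iQ iT, symmetric])
        also have "\<dots> = D \<beta>"
          unfolding D_def by (rule integral_cong_AE) (use ae in simp_all)
        finally show ?thesis by simp
      qed
      finally have lhs: "(\<Sum>w\<in>W. Re (laurent_eval V w)) = 2 * T + 2 * D \<beta>" by simp
      have "cp_shift Fm a 0 = cp_shift Fm \<alpha> 0"
        unfolding cp_shift_def by (rule in_vars_cong[OF vars(1)]) (use n in \<open>auto simp: a_def vtrunc_def\<close>)
      moreover have "cp_shift Fp a (Suc n) = cp_eval Fp (\<lambda>i. if Suc i = d then \<beta> else 0)"
        unfolding cp_shift_def by (rule in_vars_cong[OF vars(2)]) (auto simp: a_def vtrunc_def)
      moreover have "cp_shift G a n = cp_eval G (\<lambda>i. if i = d then \<beta> else 0)"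
        unfolding cp_shift_def by (rule in_vars_cong[OF vars(3)]) (auto simp: a_def vtrunc_def)
      moreover have "cp_shift G a j = cp_shift G (vtrunc \<alpha> n) j" if "j < n" for j
        unfolding cp_shift_def using that by (intro in_vars_cong[OF vars(3)]) (auto simp: a_def)
      then have "(\<Sum>j<n. Re (cp_shift G a j)) = (\<Sum>j<n. Re (cp_shift G (vtrunc \<alpha> n) j))" by simp
      moreover have "(\<Sum>j = 0..n. Re (cp_shift G a j)) = (\<Sum>j<n. Re (cp_shift G a j)) + Re (cp_shift G a n)"
        by (simp add: atLeast0AtMost lessThan_Suc_atMost[symmetric])
      ultimately show ?thesis using trace lhs by (simp add: c_def)
    qed
    \<comment> \<open>In this notation \<open>key\<close> reads
      \<open>c \<beta> = 2 * D \<beta> - k\<close>, with \<open>k\<close> free of \<beta>. As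
      \<open>D\<close> has mean 0, averaging over \<beta> evaluates \<open>k\<close>.\<close>
    define k where "k = Re (cp_shift Fm \<alpha> 0) + (\<Sum>j<n. Re (cp_shift G (vtrunc \<alpha> n) j)) - 2 * T"
    have iD: "integrable circ D" and intD: "(\<integral>\<beta>. D \<beta> \<partial>circ) = 0"
      unfolding D_def using average_log[OF u_meas u_norm] by auto
    have [measurable]: "D \<in> borel_measurable borel" using iD by (simp add: integrable_iff_bounded)
    have "continuous_on UNIV c"
      unfolding c_def continuous_on_def
      by (intro ballI tendsto_intros tendsto_cp_eval) (auto intro!: tendsto_intros)
    then have "c \<in> borel_measurable borel" by (rule borel_measurable_continuous_onI)
    then have "(\<integral>\<beta>. c \<beta> \<partial>circ) = (\<integral>\<beta>. 2 * D \<beta> - k \<partial>circ)"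
    proof (intro circ.integral_cong_circle)
      show "c \<beta> = 2 * D \<beta> - k" if "cmod \<beta> = 1" for \<beta>
        using key[OF that] unfolding k_def by linarith
    qed simp_all
    also have "\<dots> = - k" using iD intD by (simp add: circ.prob_space[simplified])
    finally show ?thesis by (simp add: K_def k_def T_def)
  qed
  then show ?thesis using that[of K] by (simp add: d_def)
qed

end

section \<open>Approximation by trigonometric polynomials\<close>

lemma bounded_linear_complex_real:
  assumes "bounded_linear (f :: complex \<Rightarrow> real)"
  shows "f z = Re ((complex_of_real (f 1) - \<i> * complex_of_real (f \<i>)) * z)"
proof -
  interpret bounded_linear f by fact
  have "z = Re z *\<^sub>R 1 + Im z *\<^sub>R \<i>" by (simp add: complex_eq_iff)
  then have "f z = f (Re z *\<^sub>R 1 + Im z *\<^sub>R \<i>)" by simp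
  also have "\<dots> = Re z * f 1 + Im z * f \<i>" unfolding add scale by simp
  finally show ?thesis by (simp add: mult.commute)
qed

lemma real_polynomial_function_trig:
  assumes "real_polynomial_function (f :: complex \<Rightarrow> real)"
  shows "real_trig f"
  using assms
proof induction
  case (linear f)
  show ?case
    by (subst bounded_linear_complex_real[OF linear, abs_def]) (rule real_trig_Re_mult)
qed (auto intro: real_trig_const real_trig_add real_trig_mult)

context circle_measure
begin

lemma inner_compact:
  assumes "A \<in> sets borel" "\<delta> > 0"
  obtains K where "K \<subseteq> A" "compact K" "measure M A - \<delta> < measure M K"
proof (cases "measure M A - \<delta> < 0")
  case True
  then show ?thesis using that[of "{}"] by simp
next
  case False
  have "emeasure M (space M) \<noteq> \<infinity>" by simp
  then have "emeasure M A = (SUP K\<in>{K. K \<subseteq> A \<and> compact K}. emeasure M K)"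
    by (rule inner_regular[OF sets_borel _ assms(1)])
  moreover have "ennreal (measure M A - \<delta>) < emeasure M A"
    using assms(2) False by (simp add: emeasure_eq_measure ennreal_less_iff)
  ultimately obtain K where "K \<subseteq> A" "compact K" "ennreal (measure M A - \<delta>) < emeasure M K"
    by (auto simp: less_SUP_iff)
  then show ?thesis using that False by (simp add: emeasure_eq_measure ennreal_less_iff)
qed

lemma continuous_approx_indicator:
  assumes A: "A \<in> sets borel" and "e > 0"
  obtains g :: "complex \<Rightarrow> real" where "continuous_on UNIV g" "(\<integral>z. \<bar>indicator A z - g z\<bar> \<partial>M) < e"
proof -
  have cA: "- A \<in> sets borel" using A by simp
  obtain K where K: "K \<subseteq> A" "compact K" "measure M A - e / 2 < measure M K"
    using inner_compact[OF A, of "e / 2"] assms(2) by auto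
  obtain L where L: "L \<subseteq> - A" "compact L" "measure M (- A) - e / 2 < measure M L"
    using inner_compact[OF cA, of "e / 2"] assms(2) by auto
  have disj: "K \<inter> L = {}" using K L by auto
  obtain g :: "complex \<Rightarrow> real" where g: "continuous_on UNIV g" "\<And>x. g x \<in> closed_segment 1 0"
    "\<And>x. x \<in> K \<Longrightarrow> g x = 1" "\<And>x. x \<in> L \<Longrightarrow> g x = 0"
    using Urysohn[of K L "1::real" 0] K(2) L(2) disj compact_imp_closed by metis
  have g01: "0 \<le> g x" "g x \<le> 1" for x
    using g(2)[of x] by (auto simp: closed_segment_eq_real_ivl)
  have s: "K \<in> sets M" "L \<in> sets M" "A \<in> sets M" "- A \<in> sets M"
    using K(2) L(2) A by (auto simp: sets_borel borel_compact)
  have "(\<integral>z. \<bar>indicator A z - g z\<bar> \<partial>M) \<le> (\<integral>z. indicator (- (K \<union> L)) z \<partial>M)"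
  proof (rule integral_mono)
    show "integrable M (\<lambda>z. \<bar>indicator A z - g z\<bar>)"
      using s(3) by (intro integrable_abs Bochner_Integration.integrable_diff integrable_continuous[OF g(1)]
          integrable_real_indicator) (auto simp: less_top[symmetric])
    show "integrable M (\<lambda>z. indicator (- (K \<union> L)) z :: real)"
      using s by (intro integrable_real_indicator) (auto simp: less_top[symmetric] sets_borel)
    show "\<bar>indicator A z - g z\<bar> \<le> indicator (- (K \<union> L)) z" for z
      using g01[of z] g(3)[of z] g(4)[of z] K(1) L(1) by (auto simp: indicator_def)
  qed
  also have "\<dots> = measure M (- (K \<union> L))" using s by simp
  also have "\<dots> = measure M UNIV - measure M (K \<union> L)"
    using finite_measure_compl[of "K \<union> L"] s by (simp add: Compl_eq_Diff_UNIV)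
  also have "measure M (K \<union> L) = measure M K + measure M L"
    using s disj by (intro finite_measure_Union) auto
  also have "measure M UNIV = measure M A + measure M (- A)"
    using finite_measure_Union[of A "- A"] s by simp
  finally have "(\<integral>z. \<bar>indicator A z - g z\<bar> \<partial>M) < e" using K(3) L(3) by linarith
  then show ?thesis using that g(1) by blast
qed

theorem continuous_approx_integrable:
  assumes "integrable M (f :: complex \<Rightarrow> real)"
  shows "\<forall>e>0. \<exists>g. continuous_on UNIV g \<and> (\<integral>z. \<bar>f z - g z\<bar> \<partial>M) < e"
  using assms
proof (induction rule: integrable_induct)
  case (base A c)
  show ?case
  proof (intro allI impI)
    fix e :: real assume "e > 0"
    then have "e / (\<bar>c\<bar> + 1) > 0" by simp
    then obtain g where g: "continuous_on UNIV g" "(\<integral>z. \<bar>indicator A z - g z\<bar> \<partial>M) < e / (\<bar>c\<bar> + 1)"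
      using continuous_approx_indicator base(1) unfolding sets_borel by metis
    have eq: "\<bar>indicator A z *\<^sub>R c - c * g z\<bar> = \<bar>c\<bar> * \<bar>indicator A z - g z\<bar>" for z
      by (simp add: abs_mult[symmetric] algebra_simps)
    have "(\<integral>z. \<bar>indicator A z *\<^sub>R c - c * g z\<bar> \<partial>M) = \<bar>c\<bar> * (\<integral>z. \<bar>indicator A z - g z\<bar> \<partial>M)"
      unfolding eq by simp
    also have "\<dots> \<le> \<bar>c\<bar> * (e / (\<bar>c\<bar> + 1))" using g(2) by (intro mult_left_mono) auto
    also have "\<dots> < e" using \<open>e > 0\<close> by (simp add: divide_simps)
    finally show "\<exists>g. continuous_on UNIV g \<and> (\<integral>z. \<bar>indicator A z *\<^sub>R c - g z\<bar> \<partial>M) < e"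
      using g(1) by (intro exI[of _ "\<lambda>z. c * g z"]) (auto intro!: continuous_intros)
  qed
next
  case (add f f')
  show ?case
  proof (intro allI impI)
    fix e :: real assume "e > 0"
    then have "e / 2 > 0" by simp
    then obtain g g' where g: "continuous_on UNIV g" "(\<integral>z. \<bar>f z - g z\<bar> \<partial>M) < e / 2"
      "continuous_on UNIV g'" "(\<integral>z. \<bar>f' z - g' z\<bar> \<partial>M) < e / 2"
      using add.IH by metis
    note i = add.hyps integrable_continuous[OF g(1)] integrable_continuous[OF g(3)]
    have "(\<integral>z. \<bar>f z + f' z - (g z + g' z)\<bar> \<partial>M) \<le> (\<integral>z. \<bar>f z - g z\<bar> + \<bar>f' z - g' z\<bar> \<partial>M)"
      by (rule integral_mono) (use i in auto)
    also have "\<dots> < e" using g(2,4) i by simp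
    finally show "\<exists>g. continuous_on UNIV g \<and> (\<integral>z. \<bar>f z + f' z - g z\<bar> \<partial>M) < e"
      using g(1,3) by (intro exI[of _ "\<lambda>z. g z + g' z"]) (auto intro!: continuous_intros)
  qed
next
  case (lim f s)
  show ?case
  proof (intro allI impI)
    fix e :: real assume "e > 0"
    have int_diff: "integrable M (\<lambda>z. \<bar>f z - s i z\<bar>)" for i using lim.hyps by simp
    have "(\<lambda>i. \<integral>z. \<bar>f z - s i z\<bar> \<partial>M) \<longlonglongrightarrow> (\<integral>z. 0 \<partial>M)"
    proof (rule integral_dominated_convergence)
      show "integrable M (\<lambda>z. 3 * \<bar>f z\<bar>)" using lim.hyps by simp
      show "AE z in M. (\<lambda>i. \<bar>f z - s i z\<bar>) \<longlonglongrightarrow> 0"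
      proof (rule AE_I2)
        fix z assume "z \<in> space M"
        then have "(\<lambda>i. \<bar>f z - s i z\<bar>) \<longlonglongrightarrow> \<bar>f z - f z\<bar>"
          using lim.hyps by (intro tendsto_intros) auto
        then show "(\<lambda>i. \<bar>f z - s i z\<bar>) \<longlonglongrightarrow> 0" by simp
      qed
      show "AE z in M. norm \<bar>f z - s i z\<bar> \<le> 3 * \<bar>f z\<bar>" for i
      proof (rule AE_I2)
        fix z assume "z \<in> space M"
        then have "norm (s i z) \<le> 2 * norm (f z)" using lim.hyps by blast
        then show "norm \<bar>f z - s i z\<bar> \<le> 3 * \<bar>f z\<bar>" by (simp add: abs_le_iff) linarith
      qed
    qed (use int_diff[THEN borel_measurable_integrable] in auto)
    then have "(\<lambda>i. \<integral>z. \<bar>f z - s i z\<bar> \<partial>M) \<longlonglongrightarrow> 0" by simp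
    then have "eventually (\<lambda>i. (\<integral>z. \<bar>f z - s i z\<bar> \<partial>M) < e / 2) sequentially"
      by (rule order_tendstoD(2)) (use \<open>e > 0\<close> in simp)
    then obtain i where i: "(\<integral>z. \<bar>f z - s i z\<bar> \<partial>M) < e / 2" by (auto simp: eventually_sequentially)
    have "e / 2 > 0" using \<open>e > 0\<close> by simp
    then obtain g where g: "continuous_on UNIV g" "(\<integral>z. \<bar>s i z - g z\<bar> \<partial>M) < e / 2"
      using lim.IH by metis
    note int = lim.hyps integrable_continuous[OF g(1)]
    have "(\<integral>z. \<bar>f z - g z\<bar> \<partial>M) \<le> (\<integral>z. \<bar>f z - s i z\<bar> + \<bar>s i z - g z\<bar> \<partial>M)"
      by (rule integral_mono) (use int in auto)
    also have "\<dots> < e" using i g(2) int by simp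
    finally show "\<exists>g. continuous_on UNIV g \<and> (\<integral>z. \<bar>f z - g z\<bar> \<partial>M) < e"
      using g(1) by auto
  qed
qed

text \<open>Besides closeness in mean the approximant keeps a positive lower bound, so that the
  logarithm is Lipschitz along the approximation.\<close>

theorem real_trig_approx:
  assumes h: "h \<in> borel_measurable borel" "\<And>z. a \<le> h z" "\<And>z. h z \<le> b" and "0 < a" "e > 0"
  obtains p where "\<And>z. cmod z = 1 \<Longrightarrow> a / 2 \<le> Re (poly p z)" "(\<integral>z. \<bar>h z - Re (poly p z)\<bar> \<partial>M) < e"
proof -
  have ih: "integrable M h"
    by (rule integrable_bounded[where B = "\<bar>a\<bar> + \<bar>b\<bar>"], rule h(1)) (use h(2,3) in \<open>smt (verit) real_norm_def\<close>)
  have "e / 2 > 0" using assms by simp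
  then obtain g0 where g0: "continuous_on UNIV g0" "(\<integral>z. \<bar>h z - g0 z\<bar> \<partial>M) < e / 2"
    using continuous_approx_integrable[OF ih] by blast
  \<comment> \<open>As \<open>h\<close> is itself at least \<open>a\<close>, cutting off below does
    not increase the distance.\<close>
  define g where "g z = max a (g0 z)" for z
  have gc: "continuous_on UNIV g" unfolding g_def by (intro continuous_intros g0)
  note ig = integrable_continuous[OF gc]
  have "(\<integral>z. \<bar>h z - g z\<bar> \<partial>M) \<le> (\<integral>z. \<bar>h z - g0 z\<bar> \<partial>M)"
  proof (rule integral_mono)
    show "\<bar>h z - g z\<bar> \<le> \<bar>h z - g0 z\<bar>" for z using h(2)[of z] by (auto simp: g_def max_def)
  qed (use ih ig integrable_continuous[OF g0(1)] in auto)
  with g0(2) have gh: "(\<integral>z. \<bar>h z - g z\<bar> \<partial>M) < e / 2" by simp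
  \<comment> \<open>The first bound preserves the lower bound \<open>a / 2\<close>, the second one
    keeps the uniform error below \<open>e / 2\<close> after integration.\<close>
  define \<delta> where "\<delta> = min (a / 2) (e / (2 * (measure M UNIV + 1)))"
  have \<delta>: "\<delta> > 0" using assms(4,5) by (simp add: \<delta>_def add_nonneg_pos)
  obtain f where f: "real_polynomial_function f" "\<And>z. z \<in> sphere 0 1 \<Longrightarrow> \<bar>g z - f z\<bar> < \<delta>"
    using Stone_Weierstrass_real_polynomial_function[of "sphere (0::complex) 1" g \<delta>] \<delta>
      continuous_on_subset[OF gc] by auto
  obtain p where p: "\<And>z. cmod z = 1 \<Longrightarrow> f z = Re (poly p z)"
    using real_polynomial_function_trig[OF f(1)] by (auto simp: real_trig_def)
  have close: "\<bar>g z - Re (poly p z)\<bar> < \<delta>" if "cmod z = 1" for z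
    using f(2)[of z] p[OF that] that by simp
  have ip: "integrable M (\<lambda>z. Re (poly p z))"
    by (intro integrable_continuous continuous_intros)
  show ?thesis
  proof (rule that)
    show "a / 2 \<le> Re (poly p z)" if "cmod z = 1" for z
    proof -
      have "a \<le> g z" by (simp add: g_def)
      then show ?thesis using close[OF that] by (simp add: \<delta>_def abs_if split: if_splits)
    qed
    have "(\<integral>z. \<bar>h z - Re (poly p z)\<bar> \<partial>M) \<le> (\<integral>z. \<bar>h z - g z\<bar> + \<delta> \<partial>M)"
    proof (rule integral_mono_circle)
      show "\<bar>h z - Re (poly p z)\<bar> \<le> \<bar>h z - g z\<bar> + \<delta>" if "cmod z = 1" for z
        using close[OF that] by linarith
    qed (use ih ig ip in auto)
    also have "\<dots> = (\<integral>z. \<bar>h z - g z\<bar> \<partial>M) + \<delta> * measure M UNIV"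
      using ih ig by simp
    also have "\<delta> * measure M UNIV \<le> (e / (2 * (measure M UNIV + 1))) * measure M UNIV"
      by (intro mult_right_mono) (auto simp: \<delta>_def)
    also have "\<dots> = e / 2 * (measure M UNIV / (measure M UNIV + 1))" by simp
    also have "\<dots> \<le> e / 2 * 1"
    proof (rule mult_left_mono)
      have "0 < measure M UNIV + 1" using measure_nonneg[of M UNIV] by linarith
      then show "measure M UNIV / (measure M UNIV + 1) \<le> 1" by simp
    qed (use assms(5) in simp)
    finally show "(\<integral>z. \<bar>h z - Re (poly p z)\<bar> \<partial>M) < e" using gh by simp
  qed
qed

end

text \<open>Approximation in mean with respect to the sum yields one trigonometric polynomial that
  is close to \<open>h\<close> for both measures simultaneously.\<close>

definition sum_measure :: "complex measure \<Rightarrow> complex measure \<Rightarrow> complex measure" where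
  "sum_measure M N = measure_of UNIV (sets borel) (\<lambda>A. emeasure M A + emeasure N A)"

context
  fixes M N :: "complex measure"
  assumes M: "circle_measure M" and N: "circle_measure N"
begin

interpretation M: circle_measure M by (rule M)
interpretation N: circle_measure N by (rule N)

lemma sets_sum_measure [simp]: "sets (sum_measure M N) = sets borel"
  unfolding sum_measure_def by (subst sets_measure_of) (auto simp: sigma_algebra.sigma_sets_eq[OF sets.sigma_algebra_axioms[of borel, simplified]])

lemma emeasure_sum_measure:
  assumes "A \<in> sets borel"
  shows "emeasure (sum_measure M N) A = emeasure M A + emeasure N A"
  unfolding sum_measure_def
proof (rule emeasure_measure_of_sigma)
  show "sigma_algebra UNIV (sets borel :: complex set set)" using sets.sigma_algebra_axioms[of borel] by simp
  show "positive (sets borel) (\<lambda>A. emeasure M A + emeasure N A)" by (simp add: positive_def)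
  show "countably_additive (sets borel) (\<lambda>A. emeasure M A + emeasure N A)"
  proof (rule countably_additiveI)
    fix A :: "nat \<Rightarrow> complex set"
    assume A: "range A \<subseteq> sets borel" "disjoint_family A" "(\<Union>i. A i) \<in> sets borel"
    have "suminf (\<lambda>i. emeasure M (A i) + emeasure N (A i)) = suminf (\<lambda>i. emeasure M (A i)) + suminf (\<lambda>i. emeasure N (A i))"
      by (rule suminf_add[symmetric]) auto
    then show "suminf (\<lambda>i. emeasure M (A i) + emeasure N (A i)) = emeasure M (\<Union> (range A)) + emeasure N (\<Union> (range A))"
      using A by (simp add: suminf_emeasure M.sets_borel N.sets_borel)
  qed
qed (rule assms)

lemma circle_measure_sum: "circle_measure (sum_measure M N)"
proof -
  have sp: "space (sum_measure M N) = UNIV" using sets_eq_imp_space_eq[OF sets_sum_measure] by simp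
  have "emeasure (sum_measure M N) UNIV < \<infinity>"
    by (simp add: emeasure_sum_measure M.emeasure_eq_measure N.emeasure_eq_measure)
  then have "finite_measure (sum_measure M N)" by (intro finite_measureI) (simp add: sp)
  moreover have "AE z in sum_measure M N. cmod z = 1"
  proof (subst AE_iff_measurable[OF _ refl])
    have s: "{z. cmod z \<noteq> 1} \<in> sets borel" by measurable
    show "{x \<in> space (sum_measure M N). cmod x \<noteq> 1} \<in> sets (sum_measure M N)" using s by (simp add: sp)
    have "emeasure M {z. cmod z \<noteq> 1} = 0" "emeasure N {z. cmod z \<noteq> 1} = 0"
      using s M.AE_circle N.AE_circle AE_iff_measurable[of "{z. cmod z \<noteq> 1}" M] AE_iff_measurable[of "{z. cmod z \<noteq> 1}" N]
      by (auto simp: M.sets_borel N.sets_borel)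
    then show "emeasure (sum_measure M N) {x \<in> space (sum_measure M N). cmod x \<noteq> 1} = 0"
      using s by (simp add: sp emeasure_sum_measure)
  qed
  ultimately show ?thesis by (simp add: circle_measure_def circle_measure_axioms_def)
qed

lemma integral_sum_measure_ge:
  fixes f :: "complex \<Rightarrow> real"
  assumes f: "f \<in> borel_measurable borel" "\<And>z. 0 \<le> f z" and int: "integrable (sum_measure M N) f"
  shows "(\<integral>z. f z \<partial>M) \<le> (\<integral>z. f z \<partial>sum_measure M N)" "(\<integral>z. f z \<partial>N) \<le> (\<integral>z. f z \<partial>sum_measure M N)"
proof -
  have *: "(\<integral>z. f z \<partial>K) \<le> (\<integral>z. f z \<partial>sum_measure M N)"
    if K: "circle_measure K" "\<And>A. A \<in> sets borel \<Longrightarrow> emeasure K A \<le> emeasure (sum_measure M N) A" for K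
  proof -
    interpret K: circle_measure K by (rule K)
    have "K \<le> sum_measure M N"
      using K(2) by (subst le_measure) (auto simp: K.sets_borel)
    then have "(\<integral>\<^sup>+z. ennreal (f z) \<partial>K) \<le> (\<integral>\<^sup>+z. ennreal (f z) \<partial>sum_measure M N)"
      by (rule nn_integral_mono_measure[rotated]) (simp add: K.sets_borel)
    also have "\<dots> = ennreal (\<integral>z. f z \<partial>sum_measure M N)"
      by (rule nn_integral_eq_integral[OF int]) (use f in auto)
    finally have "enn2real (\<integral>\<^sup>+z. ennreal (f z) \<partial>K) \<le> (\<integral>z. f z \<partial>sum_measure M N)"
      using f(2) by (intro enn2real_leI) (auto simp: integral_nonneg_AE)
    then show ?thesis using f by (subst integral_eq_nn_integral) auto
  qed
  show "(\<integral>z. f z \<partial>M) \<le> (\<integral>z. f z \<partial>sum_measure M N)"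
    by (rule *[OF M]) (simp add: emeasure_sum_measure)
  show "(\<integral>z. f z \<partial>N) \<le> (\<integral>z. f z \<partial>sum_measure M N)"
    by (rule *[OF N]) (simp add: emeasure_sum_measure)
qed

end

section \<open>Semicontinuity of the entropy\<close>

lemma ln_diff_le:
  assumes "0 < c" "c \<le> x" "c \<le> (y :: real)"
  shows "\<bar>ln x - ln y\<bar> \<le> \<bar>x - y\<bar> / c"
proof -
  have *: "ln x - ln y \<le> \<bar>x - y\<bar> / c" if "c \<le> x" "c \<le> y" for x y
  proof -
    have pos: "0 < x" "0 < y" using that assms(1) by auto
    then have "ln x - ln y = ln (x / y)" by (simp add: ln_div)
    also have "\<dots> \<le> x / y - 1" using pos by (intro ln_le_minus_one) simp
    also have "\<dots> = (x - y) / y" using pos by (simp add: field_simps)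
    also have "\<dots> \<le> \<bar>x - y\<bar> / y" using pos by (intro divide_right_mono) auto
    also have "\<dots> \<le> \<bar>x - y\<bar> / c" using that assms(1) pos by (intro divide_left_mono) auto
    finally show ?thesis .
  qed
  show ?thesis using *[OF assms(2,3)] *[OF assms(3,2)] by (simp add: abs_le_iff abs_minus_commute)
qed

lemma abs_x_ln_x_le:
  assumes "0 \<le> x" "x \<le> (C :: real)"
  shows "\<bar>x * ln x\<bar> \<le> 1 + C\<^sup>2"
proof (cases "x = 0")
  case False
  then have x: "0 < x" using assms by simp
  have "x * ln x \<le> x * x" using x ln_le_minus_one[OF x] by (intro mult_left_mono) auto
  also have "\<dots> \<le> C * C" using assms by (intro mult_mono) auto
  finally have 1: "x * ln x \<le> C\<^sup>2" by (simp add: power2_eq_square)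
  have "- ln x \<le> 1 / x - 1" using ln_le_minus_one[of "1 / x"] x by (simp add: ln_div)
  then have "x * - ln x \<le> x * (1 / x - 1)" using x by (intro mult_left_mono) auto
  also have "x * (1 / x - 1) = 1 - x" using x by (simp add: right_diff_distrib)
  finally have "- (x * ln x) \<le> 1" using x by simp
  with 1 show ?thesis by (simp add: abs_le_iff) (smt (verit) zero_le_power2)
qed simp

text \<open>Nonnegativity of the variance of \<open>\<bar>f\<bar>\<close> under the probability
  measure \<open>circ\<close>.\<close>

lemma circ_L1_le_L2:
  fixes f :: "complex \<Rightarrow> real"
  assumes "integrable circ f" "integrable circ (\<lambda>z. (f z)\<^sup>2)"
  shows "(\<integral>z. \<bar>f z\<bar> \<partial>circ) \<le> sqrt (\<integral>z. (f z)\<^sup>2 \<partial>circ)"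
proof -
  define m where "m = (\<integral>z. \<bar>f z\<bar> \<partial>circ)"
  have "0 \<le> (\<integral>z. (\<bar>f z\<bar> - m)\<^sup>2 \<partial>circ)" by simp
  also have "\<dots> = (\<integral>z. (f z)\<^sup>2 - 2 * m * \<bar>f z\<bar> + m\<^sup>2 \<partial>circ)"
    by (simp add: power2_diff algebra_simps)
  also have "\<dots> = (\<integral>z. (f z)\<^sup>2 \<partial>circ) - m\<^sup>2"
    using assms by (simp add: m_def[symmetric] circ.prob_space[simplified] power2_eq_square)
  finally show ?thesis unfolding m_def by (intro real_le_rsqrt) simp
qed

locale szego_measure = circle_measure M for M +
  fixes \<alpha> :: "nat \<Rightarrow> complex"
  assumes orth: "\<And>n. orth M \<alpha> n" and \<alpha>_less: "\<And>j. cmod (\<alpha> j) < 1" and mass: "measure M UNIV = 1"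
begin

lemma roots: "poly (szego \<alpha> n) w = 0 \<Longrightarrow> cmod w < 1"
  using szego_root_in_disc[OF orth, of n w] \<alpha>_less mass by simp

lemma density_pos: "cmod z = 1 \<Longrightarrow> bs_density \<alpha> n z > 0"
  by (rule bs_density_pos) (auto simp: roots \<alpha>_less)

lemma density_measurable [measurable]: "bs_density \<alpha> n \<in> borel_measurable borel"
  by (rule bs_density_measurable) (auto simp: roots \<alpha>_less)

lemma emeasure_UNIV: "emeasure M UNIV = 1"
  by (simp add: emeasure_eq_measure mass)

text \<open>\<open>ln \<bar>\<phi>\<^sub>n\<bar>\<^sup>2\<close> on the circle, for the orthonormal polynomial \<open>\<phi>\<^sub>n\<close>.\<close>

definition log_phi_sq :: "nat \<Rightarrow> complex \<Rightarrow> real" where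
  "log_phi_sq n z = - ln (bs_density \<alpha> n z)"

lemma log_phi_sq_measurable [measurable]: "log_phi_sq n \<in> borel_measurable borel"
  unfolding log_phi_sq_def[abs_def] by simp

lemma log_phi_sq_bounded: "\<exists>B. \<forall>z. cmod z = 1 \<longrightarrow> \<bar>log_phi_sq n z\<bar> \<le> B"
proof -
  have nz: "poly (szego \<alpha> n) z \<noteq> 0" if "cmod z = 1" for z using roots[of n z] that by auto
  have kp: "kappa \<alpha> n \<noteq> 0" using kappa_pos[of n \<alpha>] \<alpha>_less by (metis less_irrefl)
  have "continuous_on (sphere 0 1) (log_phi_sq n)"
    unfolding log_phi_sq_def[abs_def] bs_density_def
    using nz kp by (intro continuous_intros) auto
  then show ?thesis using continuous_on_circle_bounded by fastforce
qed

lemma integrable_bounded_log_phi_sq: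
  assumes "f \<in> borel_measurable borel" "\<And>z. cmod z = 1 \<Longrightarrow> \<bar>f z\<bar> \<le> C"
  shows "integrable circ (\<lambda>z. f z * log_phi_sq n z)"
proof -
  obtain B where B: "\<forall>z. cmod z = 1 \<longrightarrow> \<bar>log_phi_sq n z\<bar> \<le> B" using log_phi_sq_bounded by blast
  have "norm (f z * log_phi_sq n z) \<le> C * B" if z: "cmod z = 1" for z
    unfolding real_norm_def abs_mult using B[rule_format, OF z] assms(2)[OF z]
    by (intro mult_mono) auto
  moreover have "(\<lambda>z. f z * log_phi_sq n z) \<in> borel_measurable borel" using assms(1) by simp
  ultimately show ?thesis by (rule circ.integrable_bounded[rotated])
qed

lemma trig_moment:
  assumes "degree p \<le> n"
  shows "integrable circ (\<lambda>z. Re (poly p z) * bs_density \<alpha> n z)"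
    "(\<integral>z. Re (poly p z) * bs_density \<alpha> n z \<partial>circ) = (\<integral>z. Re (poly p z) \<partial>M)"
proof -
  have c: "circle_measure (bernstein_szego \<alpha> n)"
    by (rule circle_measure_bernstein_szego) (auto simp: roots \<alpha>_less)
  interpret b: circle_measure "bernstein_szego \<alpha> n" by fact
  have ip: "integrable (bernstein_szego \<alpha> n) (poly p)" "integrable M (poly p)"
    by (intro b.integrable_continuous integrable_continuous continuous_intros)+
  then have ir: "integrable (bernstein_szego \<alpha> n) (\<lambda>z. Re (poly p z))" by (intro integrable_Re)
  have m: "(\<lambda>z. Re (poly p z)) \<in> borel_measurable borel"
    by (intro borel_measurable_continuous_onI continuous_intros)
  note * = circ.integral_density_circle[OF m density_measurable[of n] less_imp_le[OF density_pos],
      folded bernstein_szego_def]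
  show "integrable circ (\<lambda>z. Re (poly p z) * bs_density \<alpha> n z)"
    using ir *(2) by (simp add: mult.commute)
  have mb: "measure M UNIV = measure (bernstein_szego \<alpha> n) UNIV"
    unfolding mass by (rule measure_bernstein_szego[symmetric]) (auto simp: roots \<alpha>_less)
  have ob: "orth (bernstein_szego \<alpha> n) \<alpha> n"
    by (rule bernstein_szego_orth') (auto simp: roots \<alpha>_less)
  have "(\<integral>z. poly p z \<partial>M) = (\<integral>z. poly p z \<partial>bernstein_szego \<alpha> n)"
    by (rule orth_moments_unique[OF circle_measure_axioms c mb orth ob assms])
  then have "(\<integral>z. Re (poly p z) \<partial>M) = (\<integral>z. Re (poly p z) \<partial>bernstein_szego \<alpha> n)"
    using ip by simp
  then show "(\<integral>z. Re (poly p z) * bs_density \<alpha> n z \<partial>circ) = (\<integral>z. Re (poly p z) \<partial>M)"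
    using *(1) by (simp add: mult.commute)
qed

text \<open>Lower semicontinuity of the entropy along the Bernstein-Szego approximations: \<open>ln t \<le> t - 1\<close> with
  \<open>t = h / (f \<bar>\<phi>\<^sub>n\<bar>\<^sup>2)\<close> gives the bound when \<open>h\<close> is a trigonometric polynomial, and the
  \<open>\<mu>\<close>-integral of \<open>h\<close> appears because \<open>\<bar>\<phi>\<^sub>n\<bar>\<^sup>-\<^sup>2\<close> and \<open>\<mu>\<close> have the same moments up to \<open>n\<close>.\<close>

theorem entropy_lower_bound:
  assumes f: "f \<in> borel_measurable borel" "\<And>z. cmod z = 1 \<Longrightarrow> 0 \<le> f z" "\<And>z. cmod z = 1 \<Longrightarrow> f z \<le> C"
    and h: "h \<in> borel_measurable borel" "\<And>z. a \<le> h z" "\<And>z. h z \<le> b" "0 < a" and "0 < e"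
  shows "eventually (\<lambda>n. (\<integral>z. f z * ln (h z) \<partial>circ) - (\<integral>z. f z * ln (f z) \<partial>circ) + (\<integral>z. f z \<partial>circ)
      - (\<integral>z. h z \<partial>M) - e \<le> (\<integral>z. f z * log_phi_sq n z \<partial>circ)) sequentially"
proof -
  have C: "C \<ge> 0" using f(2)[of 1] f(3)[of 1] by simp
  note [measurable] = f(1) h(1)
  \<comment> \<open>Passing from \<open>h\<close> to its approximant costs \<delta> in the integral
    over \<open>M\<close>. In the logarithmic integral it costs \<open>2 * C / a * \<delta>\<close>,
    where \<open>2 / a\<close> is the Lipschitz constant of the logarithm above \<open>a / 2\<close>
    and \<open>C\<close> bounds \<open>f\<close>.\<close>
  define \<delta> where "\<delta> = e / (2 * C / a + 1)"
  have pos: "2 * C / a + 1 > 0" using C h(4) by (simp add: add_nonneg_pos)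
  have \<delta>: "\<delta> > 0" using pos assms(8) by (simp add: \<delta>_def)
  interpret S: circle_measure "sum_measure M circ"
    by (rule circle_measure_sum[OF circle_measure_axioms circ.circle_measure_axioms])
  obtain p where p: "\<And>z. cmod z = 1 \<Longrightarrow> a / 2 \<le> Re (poly p z)"
    "(\<integral>z. \<bar>h z - Re (poly p z)\<bar> \<partial>sum_measure M circ) < \<delta>"
    using S.real_trig_approx[OF h \<delta>] by blast
  define k where "k z = Re (poly p z)" for z
  have k_cont: "continuous_on UNIV k" unfolding k_def by (intro continuous_intros)
  have k_meas [measurable]: "k \<in> borel_measurable borel" by (rule borel_measurable_continuous_onI[OF k_cont])
  have kpos: "a / 2 \<le> k z" "0 < k z" if "cmod z = 1" for z using p(1)[OF that] h(4) by (auto simp: k_def)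
  have hb: "\<bar>h z\<bar> \<le> \<bar>a\<bar> + \<bar>b\<bar>" for z using h(2,3)[of z] by linarith
  have int_h: "integrable M h" "integrable circ h" "integrable (sum_measure M circ) h"
    using hb by (auto intro!: integrable_bounded circ.integrable_bounded S.integrable_bounded[where B = "\<bar>a\<bar> + \<bar>b\<bar>"] simp del: measurable_circle)
  have int_k: "integrable M k" "integrable circ k" "integrable (sum_measure M circ) k"
    using k_cont by (auto intro: integrable_continuous circ.integrable_continuous S.integrable_continuous)
  have d1: "(\<integral>z. \<bar>h z - k z\<bar> \<partial>M) < \<delta>" and d2: "(\<integral>z. \<bar>h z - k z\<bar> \<partial>circ) < \<delta>"
    using integral_sum_measure_ge[OF circle_measure_axioms circ.circle_measure_axioms, of "\<lambda>z. \<bar>h z - k z\<bar>"]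
      p(2) int_h int_k by (simp_all add: k_def[symmetric])
  have int_fh: "integrable circ (\<lambda>z. f z * ln (h z))"
  proof (rule circ.integrable_bounded)
    fix z :: complex assume z: "cmod z = 1"
    have "ln a \<le> ln (h z)" "ln (h z) \<le> ln b" using h(2,3)[of z] h(4) by auto
    then show "norm (f z * ln (h z)) \<le> C * (\<bar>ln a\<bar> + \<bar>ln b\<bar>)"
      unfolding real_norm_def abs_mult using f(2,3)[OF z] C by (intro mult_mono) auto
  qed simp
  have int_ff: "integrable circ (\<lambda>z. f z * ln (f z))"
    by (rule circ.integrable_bounded[where B = "1 + C\<^sup>2"]) (use f abs_x_ln_x_le in auto)
  have int_f: "integrable circ f"
    by (rule circ.integrable_bounded[where B = C]) (use f in auto)
  have int_fk: "integrable circ (\<lambda>z. f z * ln (k z))"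
  proof (rule Bochner_Integration.integrable_bound)
    show "integrable circ (\<lambda>z. \<bar>f z * ln (h z)\<bar> + C * (\<bar>h z - k z\<bar> / (a / 2)))"
      using int_fh int_h int_k by simp
    show "AE z in circ. norm (f z * ln (k z)) \<le> norm (\<bar>f z * ln (h z)\<bar> + C * (\<bar>h z - k z\<bar> / (a / 2)))"
      using circ.AE_circle
    proof eventually_elim
      case (elim z)
      have "\<bar>ln (h z) - ln (k z)\<bar> \<le> \<bar>h z - k z\<bar> / (a / 2)"
        using h(2)[of z] h(4) kpos[OF elim] by (intro ln_diff_le) auto
      then have "\<bar>f z * (ln (h z) - ln (k z))\<bar> \<le> C * (\<bar>h z - k z\<bar> / (a / 2))"
        unfolding abs_mult using f(2,3)[OF elim] C by (intro mult_mono) auto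
      moreover have "f z * ln (k z) = f z * ln (h z) - f z * (ln (h z) - ln (k z))" by (simp add: algebra_simps)
      ultimately show ?case by simp
    qed
  qed simp
  have "(\<integral>z. f z * ln (h z) \<partial>circ) - (\<integral>z. f z * ln (k z) \<partial>circ) = (\<integral>z. f z * ln (h z) - f z * ln (k z) \<partial>circ)"
    using int_fh int_fk by simp
  also have "\<dots> \<le> (\<integral>z. C * (\<bar>h z - k z\<bar> / (a / 2)) \<partial>circ)"
  proof (rule circ.integral_mono_circle)
    fix z :: complex assume z: "cmod z = 1"
    have "\<bar>ln (h z) - ln (k z)\<bar> \<le> \<bar>h z - k z\<bar> / (a / 2)"
      using h(2)[of z] h(4) kpos[OF z] by (intro ln_diff_le) auto
    then have "\<bar>f z * (ln (h z) - ln (k z))\<bar> \<le> C * (\<bar>h z - k z\<bar> / (a / 2))"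
      unfolding abs_mult using f(2,3)[OF z] C by (intro mult_mono) auto
    then show "f z * ln (h z) - f z * ln (k z) \<le> C * (\<bar>h z - k z\<bar> / (a / 2))" by (simp add: algebra_simps)
  qed (use int_fh int_fk int_h int_k in auto)
  also have "\<dots> = 2 * C / a * (\<integral>z. \<bar>h z - k z\<bar> \<partial>circ)" by (simp add: mult.commute)
  also have "\<dots> \<le> 2 * C / a * \<delta>" using d2 C h(4) by (intro mult_left_mono) auto
  finally have e1: "(\<integral>z. f z * ln (h z) \<partial>circ) - 2 * C / a * \<delta> \<le> (\<integral>z. f z * ln (k z) \<partial>circ)" by simp
  have "(\<integral>z. k z \<partial>M) - (\<integral>z. h z \<partial>M) = (\<integral>z. k z - h z \<partial>M)" using int_h int_k by simp
  also have "\<dots> \<le> (\<integral>z. \<bar>h z - k z\<bar> \<partial>M)" using int_h int_k by (intro integral_mono) auto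
  finally have e2: "(\<integral>z. k z \<partial>M) \<le> (\<integral>z. h z \<partial>M) + \<delta>" using d1 by simp
  have "2 * C / a * \<delta> + \<delta> = (2 * C / a + 1) * \<delta>" by (simp add: algebra_simps)
  also have "\<dots> = e" unfolding \<delta>_def by (rule nonzero_mult_div_cancel_left[of _ e, unfolded times_divide_eq_right[symmetric]]) (use pos in linarith)
  finally have e3: "2 * C / a * \<delta> + \<delta> = e" .
  show ?thesis
  proof (rule eventually_sequentiallyI)
    \<comment> \<open>From this index on the Bernstein-Szego measure integrates the approximant
      exactly as \<open>M\<close> does.\<close>
    fix n assume n: "degree p \<le> n"
    note int_fl = integrable_bounded_log_phi_sq[of f C n]
    have ifl: "integrable circ (\<lambda>z. f z * log_phi_sq n z)" using int_fl f by simp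
    note tm = trig_moment[OF n, folded k_def]
    have "(\<integral>z. f z * ln (k z) \<partial>circ) - (\<integral>z. f z * ln (f z) \<partial>circ) - (\<integral>z. f z * log_phi_sq n z \<partial>circ)
       = (\<integral>z. f z * ln (k z) - f z * ln (f z) - f z * log_phi_sq n z \<partial>circ)"
      using int_fk int_ff ifl by simp
    also have "\<dots> \<le> (\<integral>z. k z * bs_density \<alpha> n z - f z \<partial>circ)"
    proof (rule circ.integral_mono_circle)
      fix z :: complex assume z: "cmod z = 1"
      have q: "0 < bs_density \<alpha> n z" and k: "0 < k z" using density_pos z kpos by auto
      show "f z * ln (k z) - f z * ln (f z) - f z * log_phi_sq n z \<le> k z * bs_density \<alpha> n z - f z"
      proof (cases "f z = 0")
        case True
        then show ?thesis using q k by simp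
      next
        case False
        then have fz: "0 < f z" using f(2)[OF z] by simp
        let ?t = "k z * bs_density \<alpha> n z / f z"
        have "ln ?t = ln (k z) - ln (f z) - log_phi_sq n z"
          using fz q k by (simp add: ln_div ln_mult log_phi_sq_def)
        then have "f z * (ln (k z) - ln (f z) - log_phi_sq n z) \<le> f z * (?t - 1)"
          using ln_le_minus_one[of ?t] fz q k by (intro mult_left_mono) auto
        then show ?thesis using fz by (simp add: algebra_simps)
      qed
    qed (use int_fk int_ff ifl tm int_f in auto)
    also have "\<dots> = (\<integral>z. k z \<partial>M) - (\<integral>z. f z \<partial>circ)" using tm int_f by simp
    finally show "(\<integral>z. f z * ln (h z) \<partial>circ) - (\<integral>z. f z * ln (f z) \<partial>circ) + (\<integral>z. f z \<partial>circ)
      - (\<integral>z. h z \<partial>M) - e \<le> (\<integral>z. f z * log_phi_sq n z \<partial>circ)"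
      using e1 e2 e3 by linarith
  qed
qed

end

section \<open>Rakhmanov's theorem\<close>

context szego_measure
begin

text \<open>The reciprocal of the Bernstein-Szego density is
  \<open>\<bar>\<phi>\<^sub>n\<bar>\<^sup>2\<close>, so this is the normalization of the orthonormal
  polynomial.\<close>

lemma integral_one_over_density:
  "integrable M (\<lambda>z. 1 / bs_density \<alpha> n z)" "(\<integral>z. 1 / bs_density \<alpha> n z \<partial>M) = 1"
proof -
  have kp: "kappa \<alpha> n > 0" using kappa_pos \<alpha>_less by blast
  have eq: "1 / bs_density \<alpha> n z = (cmod (poly (szego \<alpha> n) z))\<^sup>2 / kappa \<alpha> n" for z
    by (simp add: bs_density_def)
  show "integrable M (\<lambda>z. 1 / bs_density \<alpha> n z)"
    unfolding eq using kp by (intro integrable_continuous continuous_intros) auto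
  have "complex_of_real (\<integral>z. (cmod (poly (szego \<alpha> n) z))\<^sup>2 \<partial>M) = complex_of_real (kappa \<alpha> n)"
    using pip_szego_self[OF orth order_refl, of n] mass by (simp add: pip_self)
  then show "(\<integral>z. 1 / bs_density \<alpha> n z \<partial>M) = 1"
    unfolding eq using kp by (simp add: of_real_eq_iff del: of_real_power)
qed

context
  fixes D :: "complex \<Rightarrow> real"
  assumes D_meas [measurable]: "D \<in> borel_measurable borel" and D_nonneg: "\<And>z. 0 \<le> D z"
    and circ_eq: "circ = density M (\<lambda>z. ennreal (D z))"
begin

lemma integral_circ_M:
  assumes "g \<in> borel_measurable borel"
  shows "(\<integral>z. g z \<partial>circ) = (\<integral>z. D z * g z \<partial>M)" "integrable circ g \<longleftrightarrow> integrable M (\<lambda>z. D z * g z)"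
  using integral_density_circle[OF assms D_meas D_nonneg] by (simp_all add: circ_eq[symmetric])

lemma D_pos: "AE z in circ. 0 < D z"
  by (subst circ_eq, subst AE_density) auto

text \<open>Since \<open>D\<close> is the density of \<^term>\<open>circ\<close> with respect to \<open>\<mu>\<close>, the absolutely continuous part of \<open>\<mu>\<close>
  has density \<open>w = 1 / D\<close>, and the function below is \<open>\<bar>\<phi>\<^sub>n\<bar> w\<^sup>1\<^sup>/\<^sup>2\<close>. Where \<open>D = 0\<close>, a null set for
  \<^term>\<open>circ\<close>, it has the junk value \<open>0\<close>.\<close>

definition sqrt_ratio :: "nat \<Rightarrow> complex \<Rightarrow> real" where
  "sqrt_ratio n z = sqrt (1 / (bs_density \<alpha> n z * D z))"

lemma sqrt_ratio_measurable [measurable]: "sqrt_ratio n \<in> borel_measurable borel"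
  unfolding sqrt_ratio_def[abs_def] by simp

lemma sqrt_ratio_sq: "cmod z = 1 \<Longrightarrow> (sqrt_ratio n z)\<^sup>2 = 1 / (bs_density \<alpha> n z * D z)"
  using density_pos[of z n] D_nonneg[of z] by (simp add: sqrt_ratio_def)

lemma sqrt_ratio_nonneg: "cmod z = 1 \<Longrightarrow> 0 \<le> sqrt_ratio n z"
  using density_pos[of z n] D_nonneg[of z] by (simp add: sqrt_ratio_def)

lemma ln_sqrt_ratio: "cmod z = 1 \<Longrightarrow> 0 < D z \<Longrightarrow> log_phi_sq n z - ln (D z) = 2 * ln (sqrt_ratio n z)"
  using density_pos[of z n] by (simp add: sqrt_ratio_def log_phi_sq_def ln_sqrt ln_div ln_mult)

lemma sqrt_ratio_pos: "cmod z = 1 \<Longrightarrow> 0 < D z \<Longrightarrow> 0 < sqrt_ratio n z"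
  using density_pos[of z n] by (simp add: sqrt_ratio_def)

text \<open>The integral of \<open>\<bar>\<phi>\<^sub>n\<bar>\<^sup>2\<close> over the absolutely
  continuous part of \<open>M\<close> is at most the one over \<open>M\<close>, which is 1.
  Multiplication by \<open>D\<close> expresses the restriction to this part: the product vanishes
  where \<open>D = 0\<close>.\<close>

lemma integrable_sqrt_ratio_sq: "integrable circ (\<lambda>z. (sqrt_ratio n z)\<^sup>2)" and integral_sqrt_ratio_sq: "(\<integral>z. (sqrt_ratio n z)\<^sup>2 \<partial>circ) \<le> 1"
proof -
  have le: "D z * (sqrt_ratio n z)\<^sup>2 \<le> 1 / bs_density \<alpha> n z" "0 \<le> D z * (sqrt_ratio n z)\<^sup>2" if "cmod z = 1" for z
    using density_pos[OF that, of n] D_nonneg[of z] by (auto simp: sqrt_ratio_sq[OF that])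
  have "integrable M (\<lambda>z. D z * (sqrt_ratio n z)\<^sup>2)"
  proof (rule Bochner_Integration.integrable_bound[OF integral_one_over_density(1)[of n]])
    show "AE z in M. norm (D z * (sqrt_ratio n z)\<^sup>2) \<le> norm (1 / bs_density \<alpha> n z)"
      using AE_circle
    proof eventually_elim
      case (elim z)
      then show ?case using le[OF elim] density_pos[OF elim, of n] by (simp only: real_norm_def abs_of_nonneg)
    qed
  qed simp
  then show "integrable circ (\<lambda>z. (sqrt_ratio n z)\<^sup>2)" by (subst integral_circ_M(2)) auto
  have "(\<integral>z. (sqrt_ratio n z)\<^sup>2 \<partial>circ) = (\<integral>z. D z * (sqrt_ratio n z)\<^sup>2 \<partial>M)" by (subst integral_circ_M(1)) auto
  also have "\<dots> \<le> (\<integral>z. 1 / bs_density \<alpha> n z \<partial>M)"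
    by (rule integral_mono_circle) (use le \<open>integrable M _\<close> integral_one_over_density in auto)
  finally show "(\<integral>z. (sqrt_ratio n z)\<^sup>2 \<partial>circ) \<le> 1" by (simp add: integral_one_over_density)
qed

lemma integrable_sqrt_ratio: "integrable circ (sqrt_ratio n)"
proof (rule Bochner_Integration.integrable_bound)
  show "integrable circ (\<lambda>z. 1 + (sqrt_ratio n z)\<^sup>2)" using integrable_sqrt_ratio_sq by simp
  show "AE z in circ. norm (sqrt_ratio n z) \<le> norm (1 + (sqrt_ratio n z)\<^sup>2)"
  proof (rule AE_I2)
    fix z
    have "0 \<le> (\<bar>sqrt_ratio n z\<bar> - 1)\<^sup>2" by (rule zero_le_power2)
    then have "2 * \<bar>sqrt_ratio n z\<bar> \<le> 1 + (sqrt_ratio n z)\<^sup>2" by (simp add: power2_diff)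
    then show "norm (sqrt_ratio n z) \<le> norm (1 + (sqrt_ratio n z)\<^sup>2)" unfolding real_norm_def by linarith
  qed
qed simp

text \<open>\<open>entropy_lower_bound\<close> is applied to the indicator \<open>f\<close> of the
  set where \<open>D\<close> lies between \<open>1 / (b + 1)\<close> and \<open>b + 1\<close>, with
  \<open>h = D\<close> there. It says that the integral of \<open>2 * ln (sqrt_ratio n z)\<close>
  over this set is at least \<open>- a - e / 2\<close>, and \<open>ln x \<le> x - 1\<close> turns
  this into a lower bound for the integral of \<open>sqrt_ratio n\<close>. For large
  \<open>b\<close> the set has almost full measure.\<close>

lemma liminf_integral_sqrt_ratio:
  assumes "e > 0"
  shows "eventually (\<lambda>n. 1 - e \<le> (\<integral>z. sqrt_ratio n z \<partial>circ)) sequentially"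
proof -
  define E where "E b = {z. 1 / real (Suc b) \<le> D z \<and> D z \<le> real (Suc b)}" for b
  have E_meas [measurable]: "E b \<in> sets borel" for b unfolding E_def by measurable
  have "(\<lambda>b. \<integral>z. indicator (E b) z \<partial>circ) \<longlonglongrightarrow> (\<integral>z. 1 \<partial>circ :: real)"
  proof (rule integral_dominated_convergence[where w = "\<lambda>_. 1"])
    show "AE z in circ. (\<lambda>b. indicator (E b) z :: real) \<longlonglongrightarrow> 1"
      using D_pos
    proof eventually_elim
      case (elim z)
      obtain b1 where b1: "1 / D z < real b1" using reals_Archimedean2 by blast
      obtain b2 where b2: "D z < real b2" using reals_Archimedean2 by blast
      have "eventually (\<lambda>b. indicator (E b) z = (1 :: real)) sequentially"
      proof (rule eventually_sequentiallyI[of "max b1 b2"])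
        fix b assume "max b1 b2 \<le> b"
        then have "1 / D z \<le> real (Suc b)" "D z \<le> real (Suc b)" using b1 b2 by auto
        then have "z \<in> E b" using elim by (auto simp: E_def field_simps)
        then show "indicator (E b) z = (1 :: real)" by simp
      qed
      then show ?case by (rule tendsto_eventually)
    qed
  qed (auto simp: indicator_def)
  then have lim: "(\<lambda>b. \<integral>z. indicator (E b) z \<partial>circ) \<longlonglongrightarrow> (1 :: real)" by (simp add: circ.prob_space[simplified])
  have "(\<lambda>b. 1 / real (Suc b)) \<longlonglongrightarrow> 0" by real_asymp
  then have "eventually (\<lambda>b. 1 / real (Suc b) < e / 2) sequentially"
    by (rule order_tendstoD(2)) (use assms in simp)
  moreover have "eventually (\<lambda>b. 1 - e / 2 < (\<integral>z. indicator (E b) z \<partial>circ)) sequentially"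
    using lim by (rule order_tendstoD(1)) (use assms in simp)
  ultimately have "eventually (\<lambda>b. 1 / real (Suc b) < e / 2 \<and> 1 - e / 2 < (\<integral>z. indicator (E b) z \<partial>circ)) sequentially"
    by (rule eventually_conj)
  then obtain b where b: "1 / real (Suc b) < e / 2" "1 - e / 2 < (\<integral>z. indicator (E b) z \<partial>circ)"
    by (auto simp: eventually_sequentially)
  define I where "I = (\<integral>z. indicator (E b) z \<partial>circ :: real)"
  \<comment> \<open>Both the lower bound of \<open>D\<close> on \<open>E b\<close> and the value of
    \<open>h\<close> elsewhere, where it adds at most \<open>a\<close> to the integral over
    \<open>M\<close>.\<close>
  define a where "a = 1 / real (Suc b)"
  define h where "h z = (if z \<in> E b then D z else a)" for z
  have "a \<le> 1" by (simp add: a_def)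
  then have a: "0 < a" "a \<le> real (Suc b)" by (simp add: a_def, simp)
  have h: "h \<in> borel_measurable borel" "a \<le> h z" "h z \<le> real (Suc b)" for z
    using a unfolding h_def by (measurable, auto simp: E_def a_def)
  have iE: "integrable circ (\<lambda>z. indicator (E b) z :: real)"
    by (rule circ.integrable_bounded[where B = 1]) (auto simp: indicator_def)
  have iEM: "integrable M (\<lambda>z. D z * indicator (E b) z)"
    using iE by (subst integral_circ_M(2)[symmetric]) auto
  have "(\<integral>z. h z \<partial>M) \<le> (\<integral>z. D z * indicator (E b) z + a \<partial>M)"
  proof (rule integral_mono)
    show "integrable M h"
    proof (rule integrable_bounded[OF h(1)])
      show "norm (h z) \<le> real (Suc b)" for z unfolding real_norm_def using h(2,3)[of z] a by linarith
    qed
  qed (use iEM a in \<open>auto simp: h_def indicator_def\<close>)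
  also have "\<dots> = I + a"
    using iEM mass unfolding I_def by (subst integral_circ_M(1)[of "indicator (E b)"]) auto
  finally have hM: "(\<integral>z. h z \<partial>M) \<le> I + a" .
  have e2: "e / 2 > 0" using assms by simp
  have "eventually (\<lambda>n. (\<integral>z. indicator (E b) z * ln (h z) \<partial>circ) - (\<integral>z. indicator (E b) z * ln (indicator (E b) z) \<partial>circ)
      + (\<integral>z. indicator (E b) z \<partial>circ) - (\<integral>z. h z \<partial>M) - e / 2 \<le> (\<integral>z. indicator (E b) z * log_phi_sq n z \<partial>circ)) sequentially"
    by (rule entropy_lower_bound[where C = 1 and a = a and b = "real (Suc b)"]) (use h a e2 in \<open>auto simp: indicator_def\<close>)
  then show ?thesis
  proof eventually_elim
    case (elim n)
    have iL: "integrable circ (\<lambda>z. indicator (E b) z * log_phi_sq n z)"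
      by (rule integrable_bounded_log_phi_sq[where C = 1]) (auto simp: indicator_def)
    have iH: "integrable circ (\<lambda>z. indicator (E b) z * ln (h z))"
    proof (rule circ.integrable_bounded)
      fix z
      have "ln a \<le> ln (h z)" "ln (h z) \<le> ln (real (Suc b))" using h(2,3)[of z] a by auto
      then have "\<bar>ln (h z)\<bar> \<le> \<bar>ln a\<bar> + \<bar>ln (real (Suc b))\<bar>" by linarith
      then show "norm (indicator (E b) z * ln (h z)) \<le> \<bar>ln a\<bar> + \<bar>ln (real (Suc b))\<bar>"
        by (auto simp: indicator_def simp del: of_nat_Suc)
    qed (use h in simp)
    have z0: "(\<integral>z. indicator (E b) z * ln (indicator (E b) z) \<partial>circ) = (0::real)"
    proof -
      have "indicator (E b) z * ln (indicator (E b) z) = (0::real)" for z by (cases "z \<in> E b") auto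
      then show ?thesis by (simp only: integral_zero)
    qed
    have "2 * I - a - e / 2 \<le> 2 * I + (\<integral>z. indicator (E b) z * log_phi_sq n z \<partial>circ) - (\<integral>z. indicator (E b) z * ln (h z) \<partial>circ)"
      using elim z0 hM unfolding I_def by linarith
    also have "\<dots> = (\<integral>z. 2 * indicator (E b) z + indicator (E b) z * log_phi_sq n z - indicator (E b) z * ln (h z) \<partial>circ)"
      using iL iH iE by (simp add: I_def)
    also have "\<dots> \<le> (\<integral>z. 2 * sqrt_ratio n z \<partial>circ)"
    proof (rule circ.integral_mono_circle)
      fix z :: complex assume z: "cmod z = 1"
      show "2 * indicator (E b) z + indicator (E b) z * log_phi_sq n z - indicator (E b) z * ln (h z) \<le> 2 * sqrt_ratio n z"
      proof (cases "z \<in> E b")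
        case True
        then have "a \<le> D z" by (simp add: E_def a_def)
        then have Dz: "0 < D z" using a by simp
        then show ?thesis
          using True ln_sqrt_ratio[OF z Dz, of n] ln_le_minus_one[OF sqrt_ratio_pos[OF z Dz, of n]] by (simp add: h_def)
      qed (use sqrt_ratio_nonneg[OF z] in simp)
    qed (use iL iH iE integrable_sqrt_ratio in auto)
    finally have "2 * I - a - e / 2 \<le> 2 * (\<integral>z. sqrt_ratio n z \<partial>circ)" by simp
    then show ?case using b unfolding I_def[symmetric] a_def[symmetric] by linarith
  qed
qed

text \<open>The second moment is at most 1 and the first one is asymptotically at least 1, so
  \<open>\<integral> (sqrt_ratio n z - 1)\<^sup>2\<close> tends to 0. The minimum with 1 provides
  the upper half of the limit of the first moments.\<close>

theorem sqrt_ratio_tendsto: "(\<lambda>n. \<integral>z. \<bar>sqrt_ratio n z - 1\<bar> \<partial>circ) \<longlonglongrightarrow> 0"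
proof (rule tendsto_sandwich[OF _ _ tendsto_const])
  have i2: "integrable circ (\<lambda>z. (sqrt_ratio n z - 1)\<^sup>2)" for n
    using integrable_sqrt_ratio_sq[of n] integrable_sqrt_ratio[of n] by (simp add: power2_diff)
  show "eventually (\<lambda>n. (\<integral>z. \<bar>sqrt_ratio n z - 1\<bar> \<partial>circ) \<le> sqrt (2 - 2 * min 1 (\<integral>z. sqrt_ratio n z \<partial>circ))) sequentially"
  proof (intro always_eventually allI)
    fix n
    have "(\<integral>z. \<bar>sqrt_ratio n z - 1\<bar> \<partial>circ) \<le> sqrt (\<integral>z. (sqrt_ratio n z - 1)\<^sup>2 \<partial>circ)"
      using i2 integrable_sqrt_ratio[of n] by (intro circ_L1_le_L2) auto
    also have "(\<integral>z. (sqrt_ratio n z - 1)\<^sup>2 \<partial>circ) = (\<integral>z. (sqrt_ratio n z)\<^sup>2 \<partial>circ) - 2 * (\<integral>z. sqrt_ratio n z \<partial>circ) + 1"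
      using integrable_sqrt_ratio_sq[of n] integrable_sqrt_ratio[of n] by (simp add: power2_diff circ.prob_space[simplified])
    also have "\<dots> \<le> 2 - 2 * min 1 (\<integral>z. sqrt_ratio n z \<partial>circ)" using integral_sqrt_ratio_sq[of n] by simp
    finally show "(\<integral>z. \<bar>sqrt_ratio n z - 1\<bar> \<partial>circ) \<le> sqrt (2 - 2 * min 1 (\<integral>z. sqrt_ratio n z \<partial>circ))" by simp
  qed
  have "(\<lambda>n. min 1 (\<integral>z. sqrt_ratio n z \<partial>circ)) \<longlonglongrightarrow> 1"
  proof (rule order_tendstoI)
    fix x :: real assume "x < 1"
    then show "eventually (\<lambda>n. x < min 1 (\<integral>z. sqrt_ratio n z \<partial>circ)) sequentially"
      using liminf_integral_sqrt_ratio[of "(1 - x) / 2"] by (auto elim!: eventually_mono simp: min_def field_simps)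
  qed (auto intro!: always_eventually)
  then have "(\<lambda>n. sqrt (2 - 2 * min 1 (\<integral>z. sqrt_ratio n z \<partial>circ))) \<longlonglongrightarrow> sqrt (2 - 2 * 1)"
    by (intro tendsto_intros)
  then show "(\<lambda>n. sqrt (2 - 2 * min 1 (\<integral>z. sqrt_ratio n z \<partial>circ))) \<longlonglongrightarrow> 0" by simp
qed (auto intro!: always_eventually)

text \<open>With \<open>h = \<bar>1 - \<alpha>\<^sub>n b\<bar>\<close> for the Blaschke product \<open>b = z \<Phi>\<^sub>n / \<Phi>\<^sub>n\<^sup>*\<close> and
  \<open>\<rho> = (1 - \<bar>\<alpha>\<^sub>n\<bar>\<^sup>2)\<^sup>1\<^sup>/\<^sup>2\<close> one has \<open>h sqrt_ratio\<^sub>n = \<rho> sqrt_ratio\<^sub>n\<^sub>+\<^sub>1\<close> and \<open>\<integral> h\<^sup>2 - \<rho>\<^sup>2 = 2 \<bar>\<alpha>\<^sub>n\<bar>\<^sup>2\<close>.\<close>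

theorem rakhmanov: "\<alpha> \<longlonglongrightarrow> 0"
proof -
  have bound: "2 * (cmod (\<alpha> n))\<^sup>2 \<le> 3 * (2 * (\<integral>z. \<bar>sqrt_ratio n z - 1\<bar> \<partial>circ) + (\<integral>z. \<bar>sqrt_ratio (Suc n) z - 1\<bar> \<partial>circ))" for n
  proof -
    let ?P = "szego \<alpha> n" and ?R = "rev_poly (szego \<alpha> n)"
    define \<rho> where "\<rho> = sqrt (1 - (cmod (\<alpha> n))\<^sup>2)"
    have a1: "(cmod (\<alpha> n))\<^sup>2 < 1" using \<alpha>_less[of n] by (simp add: abs_square_less_1)
    have \<rho>: "0 < \<rho>" "\<rho> \<le> 1" "\<rho>\<^sup>2 = 1 - (cmod (\<alpha> n))\<^sup>2" using a1 by (auto simp: \<rho>_def)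
    define bl where "bl z = z * poly ?P z / poly ?R z" for z
    define h where "h z = cmod (1 - \<alpha> n * bl z)" for z
    have Rnz: "poly ?R z \<noteq> 0" if "cmod z \<le> 1" for z
      by (rule rev_poly_nonzero[OF _ that]) (rule roots)
    have Pnz: "poly ?P z \<noteq> 0" if "cmod z = 1" for z using roots[of n z] that by auto
    have [measurable]: "poly q \<in> borel_measurable borel" for q :: "complex poly"
      by (intro borel_measurable_continuous_onI continuous_intros)
    have bl_meas [measurable]: "bl \<in> borel_measurable borel" unfolding bl_def[abs_def] by simp
    have h_meas [measurable]: "h \<in> borel_measurable borel" unfolding h_def[abs_def] by simp
    have bl1: "cmod (bl z) = 1" if z: "cmod z = 1" for z
      using z Pnz[OF z] by (simp add: bl_def norm_divide norm_mult norm_power poly_rev_poly_circle)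
    have h_le: "h z \<le> 2" "0 \<le> h z" if z: "cmod z = 1" for z
      using norm_triangle_ineq4[of 1 "\<alpha> n * bl z"] bl1[OF z] \<alpha>_less[of n] by (auto simp: h_def norm_mult)
    have rel: "\<rho> * sqrt_ratio (Suc n) z = h z * sqrt_ratio n z" if z: "cmod z = 1" for z
    proof -
      have cz: "cnj z * z = 1" using circle_cnj_power(2)[OF z, of 1] by simp
      have R: "poly ?R z = z ^ n * cnj (poly ?P z)" using z by (simp add: poly_rev_poly_circle)
      have zn: "cnj z ^ n * z ^ n = 1" using circle_cnj_power(2)[OF z] .
      have "cmod (z * poly ?P z - cnj (\<alpha> n) * poly ?R z) = cmod (cnj (z * poly ?P z - cnj (\<alpha> n) * poly ?R z))" by (rule complex_mod_cnj[symmetric])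
      also have "cnj (z * poly ?P z - cnj (\<alpha> n) * poly ?R z) = cnj z * cnj (poly ?P z) - \<alpha> n * (cnj z ^ n * poly ?P z)"
        by (simp add: R)
      also have "\<dots> = cnj z * cnj (poly ?P z) * (1 - \<alpha> n * bl z)"
      proof -
        have "cnj z * cnj (poly ?P z) * bl z = (cnj z * z) * (cnj z ^ n * z ^ n) * (cnj (poly ?P z) * poly ?P z) / (z ^ n * cnj (poly ?P z))"
          by (simp only: zn) (simp add: bl_def R)
        also have "\<dots> = (cnj z * z) * (cnj z ^ n * poly ?P z)"
          using Pnz[OF z] z by (auto simp: field_simps)
        also have "\<dots> = cnj z ^ n * poly ?P z" by (simp only: cz) simp
        finally show ?thesis by (simp add: right_diff_distrib mult.left_commute)
      qed
      also have "cmod \<dots> = cmod (poly ?P z) * h z" using z by (simp add: norm_mult h_def)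
      finally have Q: "cmod (poly (szego \<alpha> (Suc n)) z) = cmod (poly ?P z) * h z" by simp
      have k: "kappa \<alpha> (Suc n) = kappa \<alpha> n * \<rho>\<^sup>2" by (simp add: kappa_def \<rho>(3))
      have eq: "1 / (bs_density \<alpha> (Suc n) z * D z) = (h z / \<rho>)\<^sup>2 * (1 / (bs_density \<alpha> n z * D z))"
        unfolding bs_density_def Q k by (simp add: power_mult_distrib power_divide mult_ac)
      have "sqrt_ratio (Suc n) z = sqrt ((h z / \<rho>)\<^sup>2) * sqrt_ratio n z"
        unfolding sqrt_ratio_def eq by (rule real_sqrt_mult)
      also have "sqrt ((h z / \<rho>)\<^sup>2) = h z / \<rho>" using h_le(2)[OF z] \<rho>(1) by simp
      finally show ?thesis using \<rho>(1) by simp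
    qed
    have ih: "integrable circ h" "integrable circ (\<lambda>z. (h z)\<^sup>2)"
    proof -
      show "integrable circ h" by (rule circ.integrable_bounded[where B = 2]) (use h_le in auto)
      show "integrable circ (\<lambda>z. (h z)\<^sup>2)"
      proof (rule circ.integrable_bounded[where B = "2\<^sup>2"])
        show "norm ((h z)\<^sup>2) \<le> 2\<^sup>2" if "cmod z = 1" for z
          using power_mono[OF h_le[OF that], of 2] by simp
      qed simp
    qed
    have ibl: "integrable circ bl"
      by (rule circ.integrable_bounded[where B = 1]) (use bl1 in auto)
    \<comment> \<open>The Blaschke product is holomorphic in the disc and vanishes at 0; this
      removes the cross term from the integral of \<open>h\<^sup>2\<close>.\<close>
    have "(\<integral>z. bl z \<partial>circ) = bl 0"
      unfolding bl_def[abs_def] using Rnz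
      by (intro mean_value_circ continuous_intros holomorphic_intros) auto
    then have bl0: "(\<integral>z. bl z \<partial>circ) = 0" by (simp add: bl_def)
    have iRe: "integrable circ (\<lambda>z. Re (\<alpha> n * bl z))"
      by (intro integrable_Re integrable_mult_right ibl)
    have "(\<integral>z. Re (\<alpha> n * bl z) \<partial>circ) = Re (\<integral>z. \<alpha> n * bl z \<partial>circ)"
      by (intro integral_Re integrable_mult_right ibl)
    also have "\<dots> = 0" by (simp only: integral_mult_right_zero bl0) simp
    finally have Re0: "(\<integral>z. Re (\<alpha> n * bl z) \<partial>circ) = 0" .
    have "(\<integral>z. (h z)\<^sup>2 \<partial>circ) = (\<integral>z. 1 + (cmod (\<alpha> n))\<^sup>2 - 2 * Re (\<alpha> n * bl z) \<partial>circ)"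
    proof (rule circ.integral_cong_circle)
      fix z :: complex assume z: "cmod z = 1"
      have "(cmod (1 - w))\<^sup>2 = 1 + (cmod w)\<^sup>2 - 2 * Re w" for w
        by (simp only: cmod_power2) (simp add: power2_eq_square algebra_simps)
      then show "(h z)\<^sup>2 = 1 + (cmod (\<alpha> n))\<^sup>2 - 2 * Re (\<alpha> n * bl z)"
        using bl1[OF z] by (simp add: h_def norm_mult)
    qed simp_all
    also have "\<dots> = 1 + (cmod (\<alpha> n))\<^sup>2"
      using iRe Re0 by (simp add: circ.prob_space[simplified] del: times_complex.sel)
    finally have h2: "(\<integral>z. (h z)\<^sup>2 \<partial>circ) = 1 + (cmod (\<alpha> n))\<^sup>2" .
    have "2 * (cmod (\<alpha> n))\<^sup>2 = (\<integral>z. (h z)\<^sup>2 - \<rho>\<^sup>2 \<partial>circ)"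
      using ih h2 \<rho>(3) by (simp add: circ.prob_space[simplified])
    \<comment> \<open>The weights 2 and 1 bound \<open>h\<close> and \<rho>, and 3 bounds their
      sum.\<close>
    also have "\<dots> \<le> (\<integral>z. 3 * (2 * \<bar>sqrt_ratio n z - 1\<bar> + \<bar>sqrt_ratio (Suc n) z - 1\<bar>) \<partial>circ)"
    proof (rule circ.integral_mono_circle)
      fix z :: complex assume z: "cmod z = 1"
      \<comment> \<open>Since \<open>h z * sqrt_ratio n z = \<rho> * sqrt_ratio (Suc n) z\<close>,
        these two terms may be inserted with opposite signs.\<close>
      have "h z - \<rho> = h z * (1 - sqrt_ratio n z) + \<rho> * (sqrt_ratio (Suc n) z - 1)"
        using rel[OF z] by (simp add: algebra_simps)
      then have "\<bar>h z - \<rho>\<bar> \<le> \<bar>h z * (1 - sqrt_ratio n z)\<bar> + \<bar>\<rho> * (sqrt_ratio (Suc n) z - 1)\<bar>" by linarith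
      also have "\<dots> \<le> 2 * \<bar>sqrt_ratio n z - 1\<bar> + 1 * \<bar>sqrt_ratio (Suc n) z - 1\<bar>"
        unfolding abs_mult using h_le[OF z] \<rho> by (intro add_mono mult_mono) (auto simp: abs_minus_commute)
      finally have d: "\<bar>h z - \<rho>\<bar> \<le> 2 * \<bar>sqrt_ratio n z - 1\<bar> + \<bar>sqrt_ratio (Suc n) z - 1\<bar>" by simp
      have "(h z)\<^sup>2 - \<rho>\<^sup>2 = (h z + \<rho>) * (h z - \<rho>)" by (simp add: power2_eq_square algebra_simps)
      also have "\<dots> \<le> (h z + \<rho>) * \<bar>h z - \<rho>\<bar>" using h_le[OF z] \<rho> by (intro mult_left_mono) auto
      also have "\<dots> \<le> 3 * (2 * \<bar>sqrt_ratio n z - 1\<bar> + \<bar>sqrt_ratio (Suc n) z - 1\<bar>)"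
        using h_le[OF z] \<rho> d by (intro mult_mono) auto
      finally show "(h z)\<^sup>2 - \<rho>\<^sup>2 \<le> 3 * (2 * \<bar>sqrt_ratio n z - 1\<bar> + \<bar>sqrt_ratio (Suc n) z - 1\<bar>)" .
    qed (use ih integrable_sqrt_ratio in auto)
    also have "\<dots> = 3 * (2 * (\<integral>z. \<bar>sqrt_ratio n z - 1\<bar> \<partial>circ) + (\<integral>z. \<bar>sqrt_ratio (Suc n) z - 1\<bar> \<partial>circ))"
      using integrable_sqrt_ratio by simp
    finally show ?thesis .
  qed
  have "(\<lambda>n. 3 * (2 * (\<integral>z. \<bar>sqrt_ratio n z - 1\<bar> \<partial>circ) + (\<integral>z. \<bar>sqrt_ratio (Suc n) z - 1\<bar> \<partial>circ))) \<longlonglongrightarrow> 3 * (2 * 0 + 0)"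
    by (intro tendsto_intros sqrt_ratio_tendsto LIMSEQ_Suc[OF sqrt_ratio_tendsto])
  then have lim: "(\<lambda>n. 3 * (2 * (\<integral>z. \<bar>sqrt_ratio n z - 1\<bar> \<partial>circ) + (\<integral>z. \<bar>sqrt_ratio (Suc n) z - 1\<bar> \<partial>circ))) \<longlonglongrightarrow> 0"
    by (simp only: mult_zero_right add_0)
  have "(\<lambda>n. (cmod (\<alpha> n))\<^sup>2) \<longlonglongrightarrow> 0"
  proof (rule Lim_null_comparison[OF always_eventually[rule_format] lim])
    show "norm ((cmod (\<alpha> n))\<^sup>2) \<le> 3 * (2 * (\<integral>z. \<bar>sqrt_ratio n z - 1\<bar> \<partial>circ) + (\<integral>z. \<bar>sqrt_ratio (Suc n) z - 1\<bar> \<partial>circ))" for n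
    proof -
      have "norm ((cmod (\<alpha> n))\<^sup>2) \<le> 2 * (cmod (\<alpha> n))\<^sup>2" by simp
      then show ?thesis using bound[of n] by (rule order_trans)
    qed
  qed
  from tendsto_real_sqrt[OF this] have "(\<lambda>n. cmod (\<alpha> n)) \<longlonglongrightarrow> 0" by simp
  then show ?thesis by (rule tendsto_norm_zero_cancel)
qed

text \<open>The two bounds have different sources. Above, \<open>ln x \<le> x - 1\<close> at
  \<open>x = sqrt_ratio n z\<close> and \<open>g \<le> C\<close> reduce the claim to
  \<open>sqrt_ratio_tendsto\<close>; below, \<open>entropy_lower_bound\<close> is used with
  \<open>f = g\<close> and \<open>h\<close> close to the density \<open>g * D\<close> of \<eta> with
  respect to \<open>M\<close>.\<close>

theorem entropy_limit:
  assumes g: "circle_weight g C" and int: "integrable circ (\<lambda>z. g z * ln (D z))"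
  shows "(\<lambda>n. \<integral>z. g z * log_phi_sq n z \<partial>circ) \<longlonglongrightarrow> (\<integral>z. g z * ln (D z) \<partial>circ)"
proof -
  interpret g: circle_weight g C by fact
  note [measurable] = g.g_measurable
  have abs_g: "\<bar>g z\<bar> \<le> C" if "cmod z = 1" for z using g.g_nonneg[OF that] g.g_le[OF that] by simp
  have int_l: "integrable circ (\<lambda>z. g z * log_phi_sq n z)" for n
    by (rule integrable_bounded_log_phi_sq[OF g.g_measurable abs_g])
  have int_g: "integrable circ g"
    by (rule circ.integrable_bounded[where B = C]) (use abs_g in auto)
  have int_gg: "integrable circ (\<lambda>z. g z * ln (g z))"
    by (rule circ.integrable_bounded[where B = "1 + C\<^sup>2"]) (use g.g_nonneg g.g_le abs_x_ln_x_le in auto)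
  define L where "L = (\<integral>z. g z * ln (D z) \<partial>circ)"
  have upper: "(\<integral>z. g z * log_phi_sq n z \<partial>circ) \<le> L + 2 * C * (\<integral>z. \<bar>sqrt_ratio n z - 1\<bar> \<partial>circ)" for n
  proof -
    have "(\<integral>z. g z * log_phi_sq n z \<partial>circ) - L = (\<integral>z. g z * log_phi_sq n z - g z * ln (D z) \<partial>circ)"
      using int_l int by (simp add: L_def)
    also have "\<dots> \<le> (\<integral>z. 2 * C * \<bar>sqrt_ratio n z - 1\<bar> \<partial>circ)"
    proof (rule integral_mono_AE)
      show "AE z in circ. g z * log_phi_sq n z - g z * ln (D z) \<le> 2 * C * \<bar>sqrt_ratio n z - 1\<bar>"
        using circ.AE_circle D_pos
      proof eventually_elim
        case (elim z)
        have "g z * log_phi_sq n z - g z * ln (D z) = g z * (2 * ln (sqrt_ratio n z))"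
          using ln_sqrt_ratio[OF elim, of n] by (simp add: right_diff_distrib[symmetric])
        also have "\<dots> \<le> g z * (2 * \<bar>sqrt_ratio n z - 1\<bar>)"
          using ln_le_minus_one[OF sqrt_ratio_pos[OF elim, of n]] g.g_nonneg[OF elim(1)] by (intro mult_left_mono) auto
        also have "\<dots> \<le> C * (2 * \<bar>sqrt_ratio n z - 1\<bar>)"
          using g.g_le[OF elim(1)] by (intro mult_right_mono) auto
        finally show ?case by (simp add: mult_ac)
      qed
    qed (use int_l int integrable_sqrt_ratio in auto)
    finally show ?thesis using integrable_sqrt_ratio[of n] by simp
  qed
  have lower: "eventually (\<lambda>n. L - e < (\<integral>z. g z * log_phi_sq n z \<partial>circ)) sequentially" if "e > 0" for e
  proof -
    \<comment> \<open>Three errors of at most \<open>e / 4\<close> arise: from the cut-off at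
      \<open>a\<close>, from the choice of \<open>k\<close>, and from
      \<open>entropy_lower_bound\<close>. The bound 1 keeps \<open>a\<close> below all upper
      cut-offs \<open>k + 1\<close>.\<close>
    define a where "a = min 1 (e / 4)"
    have a: "0 < a" "a \<le> 1" "a \<le> e / 4" using that by (auto simp: a_def)
    define h where "h k z = max a (min (g z * D z) (real (Suc k)))" for k z
    have h: "h k \<in> borel_measurable borel" "a \<le> h k z" "h k z \<le> real (Suc k)" for k z
      using a unfolding h_def by (measurable, auto)
    have int_abs: "integrable circ (\<lambda>z. \<bar>g z\<bar> * \<bar>ln a\<bar> + \<bar>g z * ln (g z)\<bar> + \<bar>g z * ln (D z)\<bar>)"
      using int int_g int_gg by simp
    have prod: "\<bar>g z * ln (g z * D z)\<bar> \<le> \<bar>g z * ln (g z)\<bar> + \<bar>g z * ln (D z)\<bar>"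
      "g z * ln (g z * D z) = g z * ln (g z) + g z * ln (D z)"
      if "cmod z = 1" "0 < D z" for z
      using g.g_nonneg[OF that(1)] that by (cases "g z = 0"; simp add: ln_mult distrib_left)+
    \<comment> \<open>Only the upper cut-off is removed in the limit. The lower one stays, which can
      only increase the logarithm and keeps \<open>h\<close> admissible for
      \<open>entropy_lower_bound\<close>.\<close>
    have "(\<lambda>k. \<integral>z. g z * ln (h k z) \<partial>circ) \<longlonglongrightarrow> (\<integral>z. g z * ln (max a (g z * D z)) \<partial>circ)"
    proof (rule integral_dominated_convergence[OF _ _ int_abs])
      show "AE z in circ. (\<lambda>k. g z * ln (h k z)) \<longlonglongrightarrow> g z * ln (max a (g z * D z))"
      proof (rule AE_I2)
        fix z
        obtain k0 where k0: "g z * D z < real k0" using reals_Archimedean2 by blast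
        have "eventually (\<lambda>k. g z * ln (h k z) = g z * ln (max a (g z * D z))) sequentially"
        proof (rule eventually_sequentiallyI[of k0])
          fix k assume "k0 \<le> k"
          then have "g z * D z \<le> real (Suc k)" using k0 by simp
          then show "g z * ln (h k z) = g z * ln (max a (g z * D z))" by (simp add: h_def min_absorb1)
        qed
        then show "(\<lambda>k. g z * ln (h k z)) \<longlonglongrightarrow> g z * ln (max a (g z * D z))" by (rule tendsto_eventually)
      qed
      show "AE z in circ. norm (g z * ln (h k z)) \<le> \<bar>g z\<bar> * \<bar>ln a\<bar> + \<bar>g z * ln (g z)\<bar> + \<bar>g z * ln (D z)\<bar>" for k
        using circ.AE_circle D_pos
      proof eventually_elim
        case (elim z)
        let ?r = "g z * D z"
        have "\<bar>ln (h k z)\<bar> \<le> \<bar>ln a\<bar> + \<bar>ln ?r\<bar>"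
        proof -
          consider "?r \<le> a" | "a < ?r" "?r \<le> real (Suc k)" | "a < ?r" "real (Suc k) < ?r" by linarith
          then show ?thesis
          proof cases
            case 1
            then have "h k z = a" using a by (simp add: h_def)
            then show ?thesis by simp
          next
            case 2
            then have "h k z = ?r" by (simp add: h_def)
            then show ?thesis by simp
          next
            case 3
            then have eq: "h k z = real (Suc k)" using a by (simp add: h_def)
            have "0 \<le> ln (real (Suc k))" by simp
            moreover have "ln (real (Suc k)) \<le> ln ?r" using 3 by (subst ln_le_cancel_iff) auto
            ultimately show ?thesis unfolding eq by linarith
          qed
        qed
        then have "\<bar>g z\<bar> * \<bar>ln (h k z)\<bar> \<le> \<bar>g z\<bar> * (\<bar>ln a\<bar> + \<bar>ln ?r\<bar>)" by (intro mult_left_mono) auto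
        also have "\<dots> = \<bar>g z\<bar> * \<bar>ln a\<bar> + \<bar>g z * ln ?r\<bar>" by (simp add: distrib_left abs_mult)
        finally show ?case using prod(1)[OF elim] by (simp add: abs_mult)
      qed
    qed (use h(1)[measurable] in simp_all)
    moreover have "L + (\<integral>z. g z * ln (g z) \<partial>circ) \<le> (\<integral>z. g z * ln (max a (g z * D z)) \<partial>circ)"
    proof -
      have "L + (\<integral>z. g z * ln (g z) \<partial>circ) = (\<integral>z. g z * ln (D z) + g z * ln (g z) \<partial>circ)"
        using int int_gg by (simp add: L_def)
      also have "\<dots> \<le> (\<integral>z. g z * ln (max a (g z * D z)) \<partial>circ)"
      proof (rule integral_mono_AE)
        show "AE z in circ. g z * ln (D z) + g z * ln (g z) \<le> g z * ln (max a (g z * D z))"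
          using circ.AE_circle D_pos
        proof eventually_elim
          case (elim z)
          have "ln (g z * D z) \<le> ln (max a (g z * D z))" if "g z \<noteq> 0"
            using that g.g_nonneg[OF elim(1)] elim(2) a by (subst ln_le_cancel_iff) auto
          then have "g z * ln (g z * D z) \<le> g z * ln (max a (g z * D z))"
            using g.g_nonneg[OF elim(1)] by (cases "g z = 0") (auto intro: mult_left_mono)
          then show ?case using prod(2)[OF elim] by simp
        qed
        show "integrable circ (\<lambda>z. g z * ln (max a (g z * D z)))"
        proof (rule Bochner_Integration.integrable_bound[OF int_abs])
          show "AE z in circ. norm (g z * ln (max a (g z * D z))) \<le> norm (\<bar>g z\<bar> * \<bar>ln a\<bar> + \<bar>g z * ln (g z)\<bar> + \<bar>g z * ln (D z)\<bar>)"
            using circ.AE_circle D_pos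
          proof eventually_elim
            case (elim z)
            have "\<bar>ln (max a (g z * D z))\<bar> \<le> \<bar>ln a\<bar> + \<bar>ln (g z * D z)\<bar>" by (simp add: max_def)
            then have "\<bar>g z\<bar> * \<bar>ln (max a (g z * D z))\<bar> \<le> \<bar>g z\<bar> * (\<bar>ln a\<bar> + \<bar>ln (g z * D z)\<bar>)" by (intro mult_left_mono) auto
            also have "\<dots> = \<bar>g z\<bar> * \<bar>ln a\<bar> + \<bar>g z * ln (g z * D z)\<bar>" by (simp add: distrib_left abs_mult)
            finally show ?case using prod(1)[OF elim] by (simp add: abs_mult)
          qed
        qed simp
      qed (use int int_gg in auto)
      finally show ?thesis .
    qed
    ultimately have "eventually (\<lambda>k. L + (\<integral>z. g z * ln (g z) \<partial>circ) - e / 4 < (\<integral>z. g z * ln (h k z) \<partial>circ)) sequentially"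
      using that by (intro order_tendstoD(1)) auto
    then obtain k where k: "L + (\<integral>z. g z * ln (g z) \<partial>circ) - e / 4 < (\<integral>z. g z * ln (h k z) \<partial>circ)"
      by (auto simp: eventually_sequentially)
    have int_DM: "integrable M (\<lambda>z. D z * g z)" and int_DM1: "(\<integral>z. D z * g z \<partial>M) = 1"
      using integral_circ_M[OF g.g_measurable] int_g g.integral_g by auto
    have "(\<integral>z. h k z \<partial>M) \<le> (\<integral>z. D z * g z + a \<partial>M)"
    proof (rule integral_mono_circle)
      show "integrable M (h k)"
      proof (rule integrable_bounded[OF h(1)])
        show "norm (h k z) \<le> real (Suc k)" for z unfolding real_norm_def using h(2,3)[of k z] a by linarith
      qed
      show "h k z \<le> D z * g z + a" if "cmod z = 1" for z
        using mult_nonneg_nonneg[OF D_nonneg[of z] g.g_nonneg[OF that]] a by (simp add: h_def mult.commute[of "g z"])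
    qed (use int_DM in auto)
    also have "\<dots> = 1 + a" using int_DM int_DM1 mass by simp
    finally have hM: "(\<integral>z. h k z \<partial>M) \<le> 1 + a" .
    have e4: "e / 4 > 0" using that by simp
    have "eventually (\<lambda>n. (\<integral>z. g z * ln (h k z) \<partial>circ) - (\<integral>z. g z * ln (g z) \<partial>circ) + (\<integral>z. g z \<partial>circ)
        - (\<integral>z. h k z \<partial>M) - e / 4 \<le> (\<integral>z. g z * log_phi_sq n z \<partial>circ)) sequentially"
      by (rule entropy_lower_bound[where C = C and a = a and b = "real (Suc k)"])
        (use g.g_nonneg g.g_le h a e4 in auto)
    then show ?thesis
    proof eventually_elim
      case (elim n)
      then show ?case using k hM a g.integral_g that by linarith
    qed
  qed
  show ?thesis
    unfolding L_def[symmetric]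
  proof (rule order_tendstoI)
    fix x assume "x < L"
    then show "eventually (\<lambda>n. x < (\<integral>z. g z * log_phi_sq n z \<partial>circ)) sequentially"
      using lower[of "L - x"] by simp
  next
    fix x assume x: "L < x"
    have "(\<lambda>n. L + 2 * C * (\<integral>z. \<bar>sqrt_ratio n z - 1\<bar> \<partial>circ)) \<longlonglongrightarrow> L + 2 * C * 0"
      by (intro tendsto_intros sqrt_ratio_tendsto)
    then have "eventually (\<lambda>n. L + 2 * C * (\<integral>z. \<bar>sqrt_ratio n z - 1\<bar> \<partial>circ) < x) sequentially"
      by (rule order_tendstoD(2)) (use x in simp)
    then show "eventually (\<lambda>n. (\<integral>z. g z * log_phi_sq n z \<partial>circ) < x) sequentially"
      by eventually_elim (use upper in \<open>rule order.strict_trans1\<close>)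
  qed
qed

end

theorem entropy_diverges:
  assumes g: "circle_weight g C"
    and h: "\<And>B. \<exists>a b h. h \<in> borel_measurable borel \<and> (\<forall>z. a \<le> h z \<and> h z \<le> b) \<and> 0 < a \<and>
      (\<integral>z. h z \<partial>M) \<le> 2 \<and> B \<le> (\<integral>z. g z * ln (h z) \<partial>circ)"
  shows "filterlim (\<lambda>n. \<integral>z. g z * log_phi_sq n z \<partial>circ) at_top sequentially"
  unfolding filterlim_at_top
proof
  fix B
  interpret g: circle_weight g C by fact
  \<comment> \<open>The summand 2 balances \<open>\<integral> g = 1\<close>,
    \<open>\<integral> h \<le> 2\<close> and the error 1 in the lower bound.\<close>
  obtain a b h where h: "h \<in> borel_measurable borel" "\<And>z. a \<le> h z" "\<And>z. h z \<le> b" "0 < a"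
    "(\<integral>z. h z \<partial>M) \<le> 2" "B + (\<integral>z. g z * ln (g z) \<partial>circ) + 2 \<le> (\<integral>z. g z * ln (h z) \<partial>circ)"
    using h[of "B + (\<integral>z. g z * ln (g z) \<partial>circ) + 2"] by blast
  have "eventually (\<lambda>n. (\<integral>z. g z * ln (h z) \<partial>circ) - (\<integral>z. g z * ln (g z) \<partial>circ) + (\<integral>z. g z \<partial>circ)
      - (\<integral>z. h z \<partial>M) - 1 \<le> (\<integral>z. g z * log_phi_sq n z \<partial>circ)) sequentially"
    by (rule entropy_lower_bound[where C = C and a = a and b = b])
      (use g.g_measurable g.g_nonneg g.g_le h in auto)
  then show "eventually (\<lambda>n. B \<le> (\<integral>z. g z * log_phi_sq n z \<partial>circ)) sequentially"
  proof eventually_elim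
    case (elim n)
    then show ?case using h(5,6) g.integral_g by linarith
  qed
qed

end

section \<open>Relative entropy\<close>

context szego_measure
begin

context
  fixes g :: "complex \<Rightarrow> real" and C :: real and \<eta> :: "complex measure"
  assumes g: "circle_weight g C" and g_pos: "AE z in circ. 0 < g z"
    and \<eta>_def: "\<eta> = density circ (\<lambda>z. ennreal (g z))"
begin

interpretation g: circle_weight g C by (rule g)

lemmas [measurable] = g.g_measurable

lemma sets_eta: "sets \<eta> = sets borel"
  by (simp add: \<eta>_def circ.sets_borel)

lemma circle_measure_eta: "circle_measure \<eta>"
  unfolding \<eta>_def
  by (rule circle_measure_density[OF circ.circle_measure_axioms g.g_measurable g.g_nonneg g.g_le])

interpretation e: circle_measure \<eta> by (rule circle_measure_eta)

lemma integral_eta: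
  fixes f :: "complex \<Rightarrow> real"
  assumes "f \<in> borel_measurable borel"
  shows "(\<integral>z. f z \<partial>\<eta>) = (\<integral>z. g z * f z \<partial>circ)" "integrable \<eta> f \<longleftrightarrow> integrable circ (\<lambda>z. g z * f z)"
  using circ.integral_density_circle[OF assms g.g_measurable g.g_nonneg] by (simp_all add: \<eta>_def[symmetric])

text \<open>A test function that is large on an \<open>M\<close>-null set of positive \<eta>-measure
  \<open>m\<close> is invisible to \<open>M\<close>, while its logarithm contributes
  \<open>m * ln (1 + T)\<close> to the entropy bound.\<close>

lemma entropy_not_ac:
  assumes "\<not> absolutely_continuous M \<eta>"
  shows "filterlim (\<lambda>n. \<integral>z. g z * log_phi_sq n z \<partial>circ) at_top sequentially"
proof (rule entropy_diverges[OF g])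
  fix B :: real
  obtain A where A: "A \<in> null_sets M" "A \<notin> null_sets \<eta>"
    using assms by (auto simp: absolutely_continuous_def)
  have A_meas [measurable]: "A \<in> sets borel" using A(1) by (auto simp: sets_borel)
  define m where "m = measure \<eta> A"
  have "emeasure \<eta> A \<noteq> 0" using A(2) A_meas by (auto simp: null_sets_def sets_eta)
  then have m: "m > 0" by (simp add: m_def e.emeasure_eq_measure zero_less_measure_iff)
  define T where "T = exp (B / m)"
  define h where "h z = 1 + T * indicator A z" for z :: complex
  have T: "T > 0" by (simp add: T_def)
  have h_meas [measurable]: "h \<in> borel_measurable borel" unfolding h_def[abs_def] by simp
  have ind: "integrable M (indicator A :: complex \<Rightarrow> real)" "integrable \<eta> (indicator A :: complex \<Rightarrow> real)"
    using A_meas by (auto intro!: integrable_real_indicator simp: sets_borel sets_eta less_top[symmetric] e.emeasure_finite)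
  have "measure M A = 0" using A(1) by (auto simp: measure_def)
  then have hM: "(\<integral>z. h z \<partial>M) = 1"
    using ind A_meas mass by (simp add: h_def sets_borel)
  have ln_h: "ln (h z) = ln (1 + T) * indicator A z" for z by (simp add: h_def indicator_def)
  have "(\<integral>z. g z * ln (h z) \<partial>circ) = (\<integral>z. ln (h z) \<partial>\<eta>)"
    by (rule integral_eta(1)[symmetric]) simp
  also have "\<dots> = ln (1 + T) * m"
    using ind A_meas by (simp add: ln_h m_def sets_eta)
  finally have eq: "(\<integral>z. g z * ln (h z) \<partial>circ) = ln (1 + T) * m" .
  have "B / m \<le> ln (1 + T)"
  proof (subst ln_ge_iff)
    show "0 < 1 + T" using T by simp
    show "exp (B / m) \<le> 1 + T" by (simp add: T_def)
  qed
  then have "B \<le> ln (1 + T) * m" using m by (simp add: pos_divide_le_eq)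
  then show "\<exists>a b h. h \<in> borel_measurable borel \<and> (\<forall>z. a \<le> h z \<and> h z \<le> b) \<and> 0 < a \<and>
      (\<integral>z. h z \<partial>M) \<le> 2 \<and> B \<le> (\<integral>z. g z * ln (h z) \<partial>circ)"
    using T hM eq by (intro exI[of _ 1] exI[of _ "1 + T"] exI[of _ h]) (auto simp: h_def indicator_def)
qed

context
  assumes ac: "absolutely_continuous M \<eta>"
begin

definition circ_deriv :: "complex \<Rightarrow> real" where
  "circ_deriv z = enn2real (RN_deriv M circ z)"

text \<open>The density \<open>g\<close> is positive almost everywhere, so null sets of \<eta> are
  null sets of \<open>circ\<close>. This makes the absolutely continuous part of \<open>M\<close>
  positive almost everywhere, as Rakhmanov's theorem requires.\<close>

lemma circ_ac: "absolutely_continuous M circ"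
  unfolding absolutely_continuous_def
proof
  fix A assume A: "A \<in> null_sets M"
  then have A_meas: "A \<in> sets borel" by (auto simp: sets_borel)
  have "A \<in> null_sets \<eta>" using ac A by (auto simp: absolutely_continuous_def)
  then have "AE z in \<eta>. z \<notin> A" by (rule AE_not_in)
  then have "AE z in circ. 0 < ennreal (g z) \<longrightarrow> z \<notin> A"
    unfolding \<eta>_def by (subst (asm) AE_density) auto
  then have "AE z in circ. z \<notin> A" using g_pos by eventually_elim auto
  then show "A \<in> null_sets circ"
    using A_meas by (simp add: AE_iff_null_sets[symmetric] circ.sets_borel)
qed

lemma circ_deriv_measurable [measurable]: "circ_deriv \<in> borel_measurable borel"
proof -
  have "RN_deriv M circ \<in> borel_measurable borel"
    using borel_measurable_RN_deriv[of M circ] by (simp add: measurable_cong_sets[OF sets_borel refl])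
  then show ?thesis unfolding circ_deriv_def[abs_def] by measurable
qed

lemma circ_deriv_nonneg: "0 \<le> circ_deriv z" by (simp add: circ_deriv_def)

lemma circ_density: "circ = density M (\<lambda>z. ennreal (circ_deriv z))"
proof -
  have s: "sets circ = sets M" by (simp add: circ.sets_borel sets_borel)
  have "AE z in M. RN_deriv M circ z \<noteq> \<infinity>"
    by (rule RN_deriv_finite[OF circ.sigma_finite_measure_axioms circ_ac s])
  then have "AE z in M. RN_deriv M circ z = ennreal (circ_deriv z)"
    by eventually_elim (simp add: circ_deriv_def less_top)
  then have "density M (RN_deriv M circ) = density M (\<lambda>z. ennreal (circ_deriv z))"
    by (intro density_cong) (auto simp: measurable_cong_sets[OF sets_borel refl] intro: borel_measurable_RN_deriv[of M circ, unfolded measurable_cong_sets[OF sets_borel refl]])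
  then show ?thesis using density_RN_deriv[OF circ_ac s] by simp
qed

lemma eta_density: "\<eta> = density M (\<lambda>z. ennreal (g z * circ_deriv z))"
proof -
  have "\<eta> = density (density M (\<lambda>z. ennreal (circ_deriv z))) (\<lambda>z. ennreal (g z))"
    unfolding \<eta>_def by (subst circ_density) (rule refl)
  also have "\<dots> = density M (\<lambda>z. ennreal (circ_deriv z) * ennreal (g z))"
    by (rule density_density_eq) (auto simp: measurable_cong_sets[OF sets_borel refl])
  also have "(\<lambda>z. ennreal (circ_deriv z) * ennreal (g z)) = (\<lambda>z. ennreal (g z * circ_deriv z))"
    by (simp add: ennreal_mult''[OF circ_deriv_nonneg] mult.commute)
  finally show ?thesis .
qed

lemma RN_eta: "AE z in \<eta>. enn2real (RN_deriv M \<eta> z) = g z * circ_deriv z"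
proof -
  have "AE z in M. ennreal (g z * circ_deriv z) = RN_deriv M \<eta> z"
    by (rule RN_deriv_unique[OF _ eta_density[symmetric]]) (simp add: measurable_cong_sets[OF sets_borel refl])
  then have "AE z in \<eta>. ennreal (g z * circ_deriv z) = RN_deriv M \<eta> z"
    by (rule absolutely_continuous_AE[OF _ ac, rotated]) (simp add: sets_eta sets_borel)
  then show ?thesis
    using e.AE_circle
  proof eventually_elim
    case (elim z)
    then show ?case using mult_nonneg_nonneg[OF g.g_nonneg[OF elim(2)] circ_deriv_nonneg[of z]]
      by (simp flip: elim(1))
  qed
qed

definition pos_part :: ennreal where "pos_part = (\<integral>\<^sup>+z. ennreal (ln (g z * circ_deriv z)) \<partial>\<eta>)"
definition neg_part :: ennreal where "neg_part = (\<integral>\<^sup>+z. ennreal (- ln (g z * circ_deriv z)) \<partial>\<eta>)"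

lemma rel_entropy_eq: "rel_entropy \<eta> M = enn2ereal pos_part - enn2ereal neg_part"
proof -
  have "(\<integral>\<^sup>+z. ennreal (ln (enn2real (RN_deriv M \<eta> z))) \<partial>\<eta>) = pos_part"
    unfolding pos_part_def by (rule nn_integral_cong_AE) (use RN_eta in eventually_elim, simp)
  moreover have "(\<integral>\<^sup>+z. ennreal (- ln (enn2real (RN_deriv M \<eta> z))) \<partial>\<eta>) = neg_part"
    unfolding neg_part_def by (rule nn_integral_cong_AE) (use RN_eta in eventually_elim, simp)
  ultimately show ?thesis using ac by (simp add: rel_entropy_def)
qed

text \<open>Integration over \<eta> becomes integration over \<open>M\<close> of
  \<open>- x * ln x\<close> with the density \<open>x\<close>, and this is at most 1.\<close>

lemma neg_part_finite: "neg_part < \<infinity>"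
proof -
  have "neg_part = (\<integral>\<^sup>+z. ennreal (g z * circ_deriv z) * ennreal (- ln (g z * circ_deriv z)) \<partial>M)"
    unfolding neg_part_def
    by (subst eta_density, rule nn_integral_density) (auto simp: measurable_cong_sets[OF sets_borel refl])
  also have "\<dots> \<le> (\<integral>\<^sup>+z. 1 \<partial>M)"
  proof (rule nn_integral_mono_AE)
    show "AE z in M. ennreal (g z * circ_deriv z) * ennreal (- ln (g z * circ_deriv z)) \<le> 1"
      using AE_circle
    proof eventually_elim
      case (elim z)
      define x where "x = g z * circ_deriv z"
      have x: "0 \<le> x" using g.g_nonneg[OF elim] circ_deriv_nonneg by (simp add: x_def)
      have "x * - ln x \<le> 1"
      proof (cases "x = 0")
        case False
        then have x0: "0 < x" using x by simp
        have "- ln x \<le> 1 / x - 1" using ln_le_minus_one[of "1 / x"] x0 by (simp add: ln_div)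
        then have "x * - ln x \<le> x * (1 / x - 1)" using x0 by (intro mult_left_mono) auto
        also have "x * (1 / x - 1) = 1 - x" using x0 by (simp add: right_diff_distrib)
        finally show ?thesis using x0 by simp
      qed simp
      then have "ennreal (x * - ln x) \<le> ennreal 1" by (rule ennreal_leI)
      then show ?case unfolding x_def[symmetric] ennreal_mult'[OF x] by (simp only: ennreal_1)
    qed
  qed
  also have "\<dots> < \<infinity>" by (simp add: emeasure_UNIV)
  finally show ?thesis .
qed

lemma rel_entropy_finite_iff: "\<bar>rel_entropy \<eta> M\<bar> \<noteq> \<infinity> \<longleftrightarrow> pos_part < \<infinity>"
proof -
  obtain x where x: "neg_part = ennreal x" "0 \<le> x" using neg_part_finite by (cases neg_part) auto
  show ?thesis
  proof (cases pos_part)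
    case (real y)
    then show ?thesis using x by (simp add: rel_entropy_eq)
  next
    case top
    then show ?thesis using x by (simp add: rel_entropy_eq)
  qed
qed

text \<open>A finite positive part makes \<open>g * ln (g * circ_deriv)\<close> integrable;
  subtracting the bounded function \<open>g * ln g\<close> gives the integrability that
  \<open>entropy_limit\<close> needs.\<close>

lemma entropy_finite_limit:
  assumes "pos_part < \<infinity>"
  shows "\<alpha> \<longlonglongrightarrow> 0" "\<exists>l. (\<lambda>n. \<integral>z. g z * log_phi_sq n z \<partial>circ) \<longlonglongrightarrow> l"
proof -
  show "\<alpha> \<longlonglongrightarrow> 0" by (rule rakhmanov[OF circ_deriv_measurable circ_deriv_nonneg circ_density])
  have "(\<integral>\<^sup>+z. ennreal (norm (ln (g z * circ_deriv z))) \<partial>\<eta>) = (\<integral>\<^sup>+z. ennreal (ln (g z * circ_deriv z)) + ennreal (- ln (g z * circ_deriv z)) \<partial>\<eta>)"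
    by (intro nn_integral_cong) (simp add: abs_if ennreal_neg)
  also have "\<dots> = pos_part + neg_part"
    unfolding pos_part_def neg_part_def by (rule nn_integral_add) (auto simp: measurable_cong_sets[OF sets_eta refl])
  also have "\<dots> < \<infinity>" using assms neg_part_finite by (simp add: less_top)
  finally have "integrable \<eta> (\<lambda>z. ln (g z * circ_deriv z))"
    by (intro integrableI_bounded) (auto simp: measurable_cong_sets[OF sets_eta refl])
  then have i1: "integrable circ (\<lambda>z. g z * ln (g z * circ_deriv z))"
    by (subst (asm) integral_eta(2)) auto
  have i2: "integrable circ (\<lambda>z. g z * ln (g z))"
    by (rule circ.integrable_bounded[where B = "1 + C\<^sup>2"]) (use g.g_nonneg g.g_le abs_x_ln_x_le in auto)
  have "AE z in circ. g z * ln (g z * circ_deriv z) - g z * ln (g z) = g z * ln (circ_deriv z)"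
    using g_pos D_pos[OF circ_deriv_measurable circ_deriv_nonneg circ_density]
    by eventually_elim (simp add: ln_mult distrib_left)
  moreover have "integrable circ (\<lambda>z. g z * ln (g z * circ_deriv z) - g z * ln (g z))" using i1 i2 by simp
  ultimately have "integrable circ (\<lambda>z. g z * ln (circ_deriv z))"
    by (subst (asm) integrable_cong_AE) auto
  then show "\<exists>l. (\<lambda>n. \<integral>z. g z * log_phi_sq n z \<partial>circ) \<longlonglongrightarrow> l"
    using entropy_limit[OF circ_deriv_measurable circ_deriv_nonneg circ_density g] by blast
qed

lemma entropy_infinite_diverges:
  assumes "\<not> pos_part < \<infinity>"
  shows "filterlim (\<lambda>n. \<integral>z. g z * log_phi_sq n z \<partial>circ) at_top sequentially"
proof (rule entropy_diverges[OF g])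
  fix B :: real
  \<comment> \<open>The cut-off at 1 makes \<open>ln (h k z)\<close> increase to the positive part
    of the logarithm of the density. It adds at most 1 to the integral over \<open>M\<close>, whence
    the bound 2 in \<open>entropy_diverges\<close>.\<close>
  define h where "h k z = max 1 (min (g z * circ_deriv z) (real (Suc k)))" for k z
  have h_meas [measurable]: "h k \<in> borel_measurable borel" for k unfolding h_def[abs_def] by measurable
  have h1: "1 \<le> h k z" "h k z \<le> real (Suc k)" for k z by (auto simp: h_def)
  have mono: "h k z \<le> h l z" if "k \<le> l" for k l z
    using that unfolding h_def by (intro max.mono min.mono) auto
  have "pos_part = (\<integral>\<^sup>+z. (SUP k. ennreal (ln (h k z))) \<partial>\<eta>)"
    unfolding pos_part_def
  proof (rule nn_integral_cong_AE)
    show "AE z in \<eta>. ennreal (ln (g z * circ_deriv z)) = (SUP k. ennreal (ln (h k z)))"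
      using e.AE_circle
    proof eventually_elim
      case (elim z)
      have r: "0 \<le> g z * circ_deriv z" using g.g_nonneg[OF elim] circ_deriv_nonneg by simp
      obtain k0 where k0: "g z * circ_deriv z < real k0" using reals_Archimedean2 by blast
      have top: "ln (h k z) \<le> ln (max 1 (g z * circ_deriv z))" for k
        by (subst ln_le_cancel_iff) (auto simp: h_def)
      have "h k0 z = max 1 (g z * circ_deriv z)" using k0 by (simp add: h_def)
      then have "(SUP k. ennreal (ln (h k z))) = ennreal (ln (max 1 (g z * circ_deriv z)))"
        using top by (intro antisym SUP_least SUP_upper2[of k0]) (auto intro: ennreal_leI)
      also have "\<dots> = ennreal (ln (g z * circ_deriv z))"
      proof (cases "1 \<le> g z * circ_deriv z")
        case False
        have "ln x \<le> 0" if "0 \<le> x" "x < 1" for x :: real using that by (cases "x = 0") auto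
        from this[OF r] have "ln (g z * circ_deriv z) \<le> 0" using False by simp
        then have "ennreal (ln (g z * circ_deriv z)) = 0" by (rule ennreal_neg)
        then show ?thesis using False by (simp add: max_def)
      qed simp
      finally show ?case by simp
    qed
  qed
  also have "\<dots> = (SUP k. \<integral>\<^sup>+z. ennreal (ln (h k z)) \<partial>\<eta>)"
  proof (rule nn_integral_monotone_convergence_SUP)
    show "incseq (\<lambda>k z. ennreal (ln (h k z)))"
    proof (intro monoI le_funI ennreal_leI)
      fix k l :: nat and z assume "k \<le> l"
      then show "ln (h k z) \<le> ln (h l z)"
        using mono[of k l z] h1(1)[of k z] h1(1)[of l z] by (subst ln_le_cancel_iff) auto
    qed
  qed (auto simp: measurable_cong_sets[OF sets_eta refl])
  finally have eq: "pos_part = (SUP k. \<integral>\<^sup>+z. ennreal (ln (h k z)) \<partial>\<eta>)" .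
  have "pos_part = \<infinity>" using assms by (metis infinity_ennreal_def less_top)
  then have "ennreal B < pos_part" by simp
  then have "ennreal B < (SUP k. \<integral>\<^sup>+z. ennreal (ln (h k z)) \<partial>\<eta>)" unfolding eq .
  then obtain k where k: "ennreal B < (\<integral>\<^sup>+z. ennreal (ln (h k z)) \<partial>\<eta>)" by (auto simp: less_SUP_iff)
  have ik: "integrable \<eta> (\<lambda>z. ln (h k z))"
  proof (rule e.integrable_bounded)
    fix z show "norm (ln (h k z)) \<le> ln (real (Suc k))"
      using h1[of k z] by simp
  qed simp
  have "(\<integral>\<^sup>+z. ennreal (ln (h k z)) \<partial>\<eta>) = ennreal (\<integral>z. ln (h k z) \<partial>\<eta>)"
    by (rule nn_integral_eq_integral[OF ik]) (use h1 in auto)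
  then have "ennreal B < ennreal (\<integral>z. ln (h k z) \<partial>\<eta>)" using k by simp
  then have "B \<le> (\<integral>z. ln (h k z) \<partial>\<eta>)"
    using ennreal_leI[of "\<integral>z. ln (h k z) \<partial>\<eta>" B] by (meson leD le_cases)
  also have "\<dots> = (\<integral>z. g z * ln (h k z) \<partial>circ)" by (rule integral_eta(1)) simp
  finally have B: "B \<le> (\<integral>z. g z * ln (h k z) \<partial>circ)" .
  have ig: "integrable circ g"
    by (rule circ.integrable_bounded[where B = C]) (use g.g_nonneg g.g_le in auto)
  note c = integral_circ_M[OF circ_deriv_measurable circ_deriv_nonneg circ_density g.g_measurable]
  have "(\<integral>z. h k z \<partial>M) \<le> (\<integral>z. circ_deriv z * g z + 1 \<partial>M)"
  proof (rule integral_mono_circle)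
    show "integrable M (h k)"
    proof (rule integrable_bounded[OF h_meas])
      show "norm (h k z) \<le> real (Suc k)" for z unfolding real_norm_def using h1[of k z] by linarith
    qed
    show "h k z \<le> circ_deriv z * g z + 1" if "cmod z = 1" for z
      using mult_nonneg_nonneg[OF circ_deriv_nonneg[of z] g.g_nonneg[OF that]] by (simp add: h_def mult.commute[of "g z"])
  qed (use c ig in auto)
  also have "\<dots> = 2" using c ig mass g.integral_g by simp
  finally have "(\<integral>z. h k z \<partial>M) \<le> 2" .
  then show "\<exists>a b h. h \<in> borel_measurable borel \<and> (\<forall>z. a \<le> h z \<and> h z \<le> b) \<and> 0 < a \<and>
      (\<integral>z. h z \<partial>M) \<le> 2 \<and> B \<le> (\<integral>z. g z * ln (h z) \<partial>circ)"
    using B h1 by (intro exI[of _ 1] exI[of _ "real (Suc k)"] exI[of _ "h k"]) auto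
qed

end

theorem rel_entropy_finite:
  assumes "\<bar>rel_entropy \<eta> M\<bar> \<noteq> \<infinity>"
  shows "\<alpha> \<longlonglongrightarrow> 0" "\<exists>l. (\<lambda>n. \<integral>z. g z * log_phi_sq n z \<partial>circ) \<longlonglongrightarrow> l"
proof -
  have ac: "absolutely_continuous M \<eta>"
    using assms by (auto simp: rel_entropy_def split: if_splits)
  then have "pos_part < \<infinity>" using assms rel_entropy_finite_iff[OF ac] by simp
  then show "\<alpha> \<longlonglongrightarrow> 0" "\<exists>l. (\<lambda>n. \<integral>z. g z * log_phi_sq n z \<partial>circ) \<longlonglongrightarrow> l"
    using entropy_finite_limit[OF ac] by auto
qed

theorem rel_entropy_infinite:
  assumes "\<bar>rel_entropy \<eta> M\<bar> = \<infinity>"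
  shows "filterlim (\<lambda>n. \<integral>z. g z * log_phi_sq n z \<partial>circ) at_top sequentially"
proof (cases "absolutely_continuous M \<eta>")
  case True
  have "\<not> pos_part < \<infinity>" using assms rel_entropy_finite_iff[OF True] by simp
  then show ?thesis by (rule entropy_infinite_diverges[OF True])
qed (rule entropy_not_ac)

end

end

section \<open>The sum rule\<close>

text \<open>The weight of \<eta> extended to the plane as a continuous function, a product of powers
  of real affine factors; this form shows at once that it is a trigonometric polynomial.\<close>

definition trig_weight :: "nat \<Rightarrow> (nat \<Rightarrow> real) \<Rightarrow> (nat \<Rightarrow> nat) \<Rightarrow> complex \<Rightarrow> real" where
  "trig_weight k \<theta> m z = (\<Prod>j = 1..k. (1 - Re (cnj (cis (\<theta> j)) * z)) ^ m j)"

lemma trig_weight_cis: "trig_weight k \<theta> m (cis t) = eta_weight k \<theta> m t"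
  by (simp add: trig_weight_def eta_weight_def cos_diff mult.commute)

lemma continuous_trig_weight: "continuous_on UNIV (trig_weight k \<theta> m)"
  unfolding trig_weight_def by (intro continuous_intros)

lemma real_trig_trig_weight: "real_trig (trig_weight k \<theta> m)"
proof -
  have eq: "1 - Re (cnj (cis (\<theta> j)) * z) = 1 + Re ((- cnj (cis (\<theta> j))) * z)" for j z by simp
  show ?thesis
    unfolding trig_weight_def eq
    by (intro real_trig_prod real_trig_power real_trig_add real_trig_const real_trig_Re_mult)
qed

lemma Re_rotated_le_1: "cmod z = 1 \<Longrightarrow> Re (cnj (cis t) * z) \<le> 1"
  using complex_Re_le_cmod[of "cnj (cis t) * z"] by (simp add: norm_mult del: times_complex.sel)

lemma trig_weight_nonneg: "cmod z = 1 \<Longrightarrow> 0 \<le> trig_weight k \<theta> m z"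
  unfolding trig_weight_def by (intro prod_nonneg) (auto intro!: zero_le_power Re_rotated_le_1 simp del: times_complex.sel)

lemma trig_weight_pos: "AE z in circ. 0 < trig_weight k \<theta> m z"
proof -
  have "AE z in circ. \<forall>j\<in>{1..k}. z \<noteq> cis (\<theta> j)" by (simp add: AE_finite_all AE_circ_neq)
  then show ?thesis
    using circ.AE_circle
  proof eventually_elim
    case (elim z)
    have "0 < 1 - Re (cnj (cis (\<theta> j)) * z)" if "j \<in> {1..k}" for j
    proof -
      let ?v = "cnj (cis (\<theta> j)) * z"
      have v1: "cmod ?v = 1" using elim by (simp add: norm_mult)
      have "Re ?v \<noteq> 1"
      proof
        assume "Re ?v = 1"
        moreover have "(Re ?v)\<^sup>2 + (Im ?v)\<^sup>2 = 1" using v1 cmod_power2[of ?v] by simp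
        ultimately have "?v = 1" by (simp add: complex_eq_iff del: times_complex.sel)
        then have "cis (\<theta> j) * ?v = cis (\<theta> j)" by simp
        moreover have "cis (\<theta> j) * cnj (cis (\<theta> j)) = 1" using circle_cnj_power(1)[of "cis (\<theta> j)" 1] by simp
        ultimately have "z = cis (\<theta> j)" by (simp add: mult.assoc[symmetric])
        then show False using elim(1) that by blast
      qed
      moreover have "Re ?v \<le> 1" using elim by (intro Re_rotated_le_1)
      ultimately show ?thesis by linarith
    qed
    then show ?case unfolding trig_weight_def by (intro prod_pos ballI zero_less_power) auto
  qed
qed

lemma eta_eq_density:
  obtains Z where "Z > 0" "eta k \<theta> m = density circ (\<lambda>z. ennreal (trig_weight k \<theta> m z / Z))"
    "(\<integral>z. trig_weight k \<theta> m z / Z \<partial>circ) = 1"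
proof -
  let ?w = "trig_weight k \<theta> m"
  define Z where "Z = (\<integral>z. ?w z \<partial>circ)"
  have w_meas [measurable]: "?w \<in> borel_measurable borel"
    by (rule borel_measurable_continuous_onI[OF continuous_trig_weight])
  have int: "integrable circ ?w" by (rule circ.integrable_continuous[OF continuous_trig_weight])
  have ae: "AE z in circ. 0 \<le> ?w z" using trig_weight_pos[of k \<theta> m] by eventually_elim simp
  have "Z \<noteq> 0"
  proof
    assume "Z = 0"
    then have "AE z in circ. ?w z = 0"
      using integral_nonneg_eq_0_iff_AE[OF int ae] by (simp add: Z_def)
    then have "AE z in circ. False"
      using trig_weight_pos[of k \<theta> m] by eventually_elim simp
    then show False by simp
  qed
  moreover have "Z \<ge> 0" unfolding Z_def by (rule integral_nonneg_AE[OF ae])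
  ultimately have Z: "Z > 0" by simp
  have "(\<integral>t. eta_weight k \<theta> m t \<partial>uniform_measure lborel {0..<2 * pi}) = Z"
    unfolding Z_def circ_def by (subst integral_distr) (auto simp: trig_weight_cis)
  then have "eta k \<theta> m = distr (density (uniform_measure lborel {0..<2 * pi}) (\<lambda>t. ennreal (?w (cis t) / Z))) borel cis"
    by (simp add: eta_def Let_def trig_weight_cis)
  also have "\<dots> = density circ (\<lambda>z. ennreal (?w z / Z))"
    unfolding circ_def by (rule density_distr[symmetric]) auto
  finally have eq: "eta k \<theta> m = density circ (\<lambda>z. ennreal (?w z / Z))" .
  have "(\<integral>z. ?w z / Z \<partial>circ) = 1" using int Z by (simp add: Z_def[symmetric])
  then show ?thesis using that Z eq by blast
qed

lemma has_verblunsky_szego_measure: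
  assumes "has_verblunsky \<mu> \<alpha>" "\<And>j. cmod (\<alpha> j) < 1"
  shows "szego_measure \<mu> \<alpha>"
proof -
  have cp: "circle_prob \<mu>" using assms(1) by (simp add: has_verblunsky_def)
  interpret circle_measure \<mu> by (rule circle_prob_circle_measure[OF cp])
  interpret prob_space \<mu> using cp by (simp add: circle_prob_def)
  show ?thesis
    by unfold_locales (use has_verblunsky_orth(1)[OF assms(1)] assms(2) prob_space in auto)
qed

lemma norm_cp_eval_le:
  assumes "\<And>i. cmod (x i) \<le> 1"
  shows "cmod (cp_eval P x) \<le> (\<Sum>e\<in>Poly_Mapping.keys P. cmod (Poly_Mapping.lookup P e))"
  unfolding cp_eval_def
proof (rule sum_norm_le)
  fix e
  have "cmod (\<Prod>v\<in>Poly_Mapping.keys e. (case v of Inl i \<Rightarrow> x i | Inr i \<Rightarrow> cnj (x i)) ^ Poly_Mapping.lookup e v) \<le> 1"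
    unfolding prod_norm[symmetric]
    by (rule prod_le_1) (auto simp: norm_power assms power_le_one split: sum.split)
  then show "cmod (Poly_Mapping.lookup P e * (\<Prod>v\<in>Poly_Mapping.keys e. (case v of Inl i \<Rightarrow> x i | Inr i \<Rightarrow> cnj (x i)) ^ Poly_Mapping.lookup e v))
     \<le> cmod (Poly_Mapping.lookup P e)"
    by (simp add: norm_mult mult_left_le)
qed

text \<open>\<open>G\<close> reads \<open>d + 1\<close> successive coefficients, so only the
  summands with \<open>j\<close> at least \<open>n - d\<close> can notice the truncation at
  \<open>n\<close>.\<close>

lemma truncation_error:
  assumes vars: "in_vars (Suc d) G" and n: "d \<le> n"
  shows "(\<Sum>j<n. Re (cp_shift G \<alpha> j)) - (\<Sum>j<n. Re (cp_shift G (vtrunc \<alpha> n) j)) =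
    (\<Sum>i<d. Re (cp_shift G \<alpha> (n - d + i)) - Re (cp_shift G (vtrunc \<alpha> n) (n - d + i)))"
proof -
  let ?f = "\<lambda>j. Re (cp_shift G \<alpha> j) - Re (cp_shift G (vtrunc \<alpha> n) j)"
  have split: "(\<Sum>j<a + b. f j) = (\<Sum>j<a. f j) + (\<Sum>i<b. f (a + i))" for a b and f :: "nat \<Rightarrow> real"
    by (induction b) auto
  have zero: "?f j = 0" if "j < n - d" for j
  proof -
    have "cp_shift G \<alpha> j = cp_shift G (vtrunc \<alpha> n) j"
      unfolding cp_shift_def by (rule in_vars_cong[OF vars]) (use that in \<open>auto simp: vtrunc_def\<close>)
    then show ?thesis by simp
  qed
  have "(\<Sum>j<n. Re (cp_shift G \<alpha> j)) - (\<Sum>j<n. Re (cp_shift G (vtrunc \<alpha> n) j)) = (\<Sum>j<n - d + d. ?f j)"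
    using n by (simp add: sum_subtractf)
  also have "\<dots> = (\<Sum>j<n - d. ?f j) + (\<Sum>i<d. ?f (n - d + i))"
    by (rule split)
  also have "(\<Sum>j<n - d. ?f j) = 0" using zero by simp
  finally show ?thesis by simp
qed

theorem theorem3p5:
  fixes k :: nat and \<theta> :: "nat \<Rightarrow> real" and m :: "nat \<Rightarrow> nat"
  assumes "k \<ge> 1"
    and "\<forall>j\<in>{1..k}. \<theta> j \<in> {0..<2 * pi}"
    and "inj_on \<theta> {1..k}"
    and "\<forall>j\<in>{1..k}. m j > 0"
  shows "(\<exists>V. is_potential (eta k \<theta> m) V \<and> Poly_Mapping.lookup V 0 = 0) \<and>
    (\<forall>V Fm Fp G (\<alpha> :: nat \<Rightarrow> complex) \<mu>.
       is_potential (eta k \<theta> m) V \<longrightarrow>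
       trace_decomposition V Fm Fp G \<longrightarrow>
       (\<forall>j. cmod (\<alpha> j) < 1) \<longrightarrow>
       has_verblunsky \<mu> \<alpha> \<longrightarrow>
       (\<exists>L::ereal. L \<noteq> -\<infinity> \<and>
          (\<lambda>N. ereal (\<Sum>j = 0..N. Re (cp_shift G \<alpha> j) - ln (1 - (cmod (\<alpha> j))\<^sup>2))) \<longlonglongrightarrow> L \<and>
          (\<bar>L\<bar> \<noteq> \<infinity> \<longleftrightarrow> \<bar>rel_entropy (eta k \<theta> m) \<mu>\<bar> \<noteq> \<infinity>)))"
proof -
  let ?w = "trig_weight k \<theta> m" and ?\<eta> = "eta k \<theta> m"
  obtain Z where Z: "Z > 0" "?\<eta> = density circ (\<lambda>z. ennreal (?w z / Z))" "(\<integral>z. ?w z / Z \<partial>circ) = 1"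
    using eta_eq_density[of k \<theta> m] by metis
  define g where "g z = ?w z / Z" for z
  have \<eta>: "?\<eta> = density circ (\<lambda>z. ennreal (g z))" by (simp add: Z(2) g_def)
  have g_cont: "continuous_on UNIV g"
    unfolding g_def[abs_def] using Z(1) by (intro continuous_intros continuous_trig_weight) auto
  obtain C where C: "\<forall>z. cmod z = 1 \<longrightarrow> norm (g z) \<le> C"
    using continuous_on_circle_bounded[OF continuous_on_subset[OF g_cont]] by auto
  interpret g: circle_weight g C
  proof
    show "g \<in> borel_measurable borel" by (rule borel_measurable_continuous_onI[OF g_cont])
    show "0 \<le> g z" if "cmod z = 1" for z using trig_weight_nonneg[OF that] Z(1) by (simp add: g_def)
    show "g z \<le> C" if "cmod z = 1" for z using C that by (auto simp: abs_le_iff)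
    show "(\<integral>z. g z \<partial>circ) = 1" using Z(3) by (simp add: g_def)
  qed
  have g_pos: "AE z in circ. 0 < g z"
    using trig_weight_pos[of k \<theta> m] by eventually_elim (use Z(1) in \<open>simp add: g_def\<close>)
  have "real_trig (\<lambda>z. (1 / Z) * ?w z)" by (intro real_trig_mult real_trig_const real_trig_trig_weight)
  then have g_trig: "real_trig g" by (simp add: g_def[abs_def])
  have pot_iff: "is_potential ?\<eta> V \<longleftrightarrow> (\<forall>z. cmod z = 1 \<longrightarrow>
      laurent_eval V z = complex_of_real (2 * (\<integral>w. g w * ln (cmod (z - w)) \<partial>circ)))" for V
    unfolding is_potential_def \<eta> by (auto simp: g.integral_density_log)
  show ?thesis
  proof (intro conjI allI impI)
    show "\<exists>V. is_potential ?\<eta> V \<and> Poly_Mapping.lookup V 0 = 0"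
      using g.potential_exists[OF g_trig] pot_iff by blast
  next
    fix V Fm Fp G and \<alpha> :: "nat \<Rightarrow> complex" and \<mu>
    assume pot: "is_potential ?\<eta> V" and dec: "trace_decomposition V Fm Fp G"
      and \<alpha>: "\<forall>j. cmod (\<alpha> j) < 1" and verb: "has_verblunsky \<mu> \<alpha>"
    interpret szego_measure \<mu> \<alpha> by (rule has_verblunsky_szego_measure[OF verb]) (use \<alpha> in auto)
    define d where "d = laurent_degree V"
    have vars: "in_vars (Suc d) G" and G0: "cp_eval G (\<lambda>_. 0) = 0"
      using dec by (auto simp: trace_decomposition_def Let_def d_def)
    have "\<exists>K. \<forall>n\<ge>d. 2 * (\<integral>z. g z * ln (cmod (poly (szego \<alpha> n) z)) \<partial>circ) =
        K + (\<Sum>j<n. Re (cp_shift G (vtrunc \<alpha> n) j))"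
    proof (rule g.trace_formula[of V Fm Fp G \<alpha>])
      show "laurent_eval V z = complex_of_real (2 * (\<integral>w. g w * ln (cmod (z - w)) \<partial>circ))" if "cmod z = 1" for z
        using pot that unfolding pot_iff by blast
    qed (use dec \<alpha> roots in \<open>auto simp: d_def\<close>)
    then obtain K where K: "\<And>n. d \<le> n \<Longrightarrow> 2 * (\<integral>z. g z * ln (cmod (poly (szego \<alpha> n) z)) \<partial>circ) =
        K + (\<Sum>j<n. Re (cp_shift G (vtrunc \<alpha> n) j))"
      by blast
    define S where "S n = (\<integral>z. g z * log_phi_sq n z \<partial>circ)" for n
    define R where "R n = (\<Sum>i<d. Re (cp_shift G \<alpha> (n - d + i)) - Re (cp_shift G (vtrunc \<alpha> n) (n - d + i)))" for n
    define A where "A n = (\<Sum>j<n. Re (cp_shift G \<alpha> j) - ln (1 - (cmod (\<alpha> j))\<^sup>2))" for n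
    \<comment> \<open>The left side of the trace formula is
      \<open>S n + ln (kappa \<alpha> n)\<close>, as g has total mass 1, and
      \<open>ln (kappa \<alpha> n)\<close> is the sum of the logarithms in
      \<open>A n\<close>.\<close>
    have A_eq: "A n = S n + (R n - K)" if n: "d \<le> n" for n
    proof -
      have kp: "kappa \<alpha> n > 0" using kappa_pos \<alpha> by blast
      have pos: "1 - (cmod (\<alpha> j))\<^sup>2 > 0" for j using \<alpha> by (simp add: abs_square_less_1)
      then have ln_kappa: "ln (kappa \<alpha> n) = (\<Sum>j<n. ln (1 - (cmod (\<alpha> j))\<^sup>2))"
        unfolding kappa_def by (intro ln_prod) (simp, metis pos less_irrefl)
      have il: "integrable circ (\<lambda>z. g z * log_phi_sq n z)"
        by (rule integrable_bounded_log_phi_sq[where C = C]) (use g.g_nonneg g.g_le in auto)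
      have ig: "integrable circ g"
        by (rule circ.integrable_continuous[OF g_cont])
      have "2 * (\<integral>z. g z * ln (cmod (poly (szego \<alpha> n) z)) \<partial>circ) = (\<integral>z. 2 * (g z * ln (cmod (poly (szego \<alpha> n) z))) \<partial>circ)"
        by simp
      also have "\<dots> = (\<integral>z. g z * log_phi_sq n z + ln (kappa \<alpha> n) * g z \<partial>circ)"
      proof (rule integral_cong_AE)
        have [measurable]: "poly (szego \<alpha> n) \<in> borel_measurable borel"
          by (intro borel_measurable_continuous_onI continuous_intros)
        show "(\<lambda>z. 2 * (g z * ln (cmod (poly (szego \<alpha> n) z)))) \<in> borel_measurable circ" by simp
        show "(\<lambda>z. g z * log_phi_sq n z + ln (kappa \<alpha> n) * g z) \<in> borel_measurable circ" by simp
        show "AE z in circ. 2 * (g z * ln (cmod (poly (szego \<alpha> n) z))) = g z * log_phi_sq n z + ln (kappa \<alpha> n) * g z"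
          using circ.AE_circle
        proof eventually_elim
          case (elim z)
          have "poly (szego \<alpha> n) z \<noteq> 0" using roots[of n z] elim by auto
          then have eq: "2 * ln (cmod (poly (szego \<alpha> n) z)) = log_phi_sq n z + ln (kappa \<alpha> n)"
            using kp by (simp add: log_phi_sq_def bs_density_def ln_div ln_realpow)
          have "2 * (g z * ln (cmod (poly (szego \<alpha> n) z))) = g z * (2 * ln (cmod (poly (szego \<alpha> n) z)))" by simp
          also have "\<dots> = g z * log_phi_sq n z + ln (kappa \<alpha> n) * g z"
            unfolding eq by (simp add: distrib_left mult.commute)
          finally show ?case .
        qed
      qed
      also have "\<dots> = S n + ln (kappa \<alpha> n)" using il ig g.integral_g by (simp add: S_def)
      finally have "S n + ln (kappa \<alpha> n) = K + (\<Sum>j<n. Re (cp_shift G (vtrunc \<alpha> n) j))"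
        using K[OF n] by simp
      then show ?thesis
        using truncation_error[OF vars n, of \<alpha>] ln_kappa by (simp add: A_def R_def sum_subtractf)
    qed
    have A_sum: "(\<Sum>j = 0..N. Re (cp_shift G \<alpha> j) - ln (1 - (cmod (\<alpha> j))\<^sup>2)) = A (Suc N)" for N
      unfolding A_def by (simp only: atLeast0AtMost lessThan_Suc_atMost)
    have ev: "eventually (\<lambda>n. A n = S n + (R n - K)) sequentially"
      using A_eq by (intro eventually_sequentiallyI[of d])
    show "\<exists>L::ereal. L \<noteq> -\<infinity> \<and>
          (\<lambda>N. ereal (\<Sum>j = 0..N. Re (cp_shift G \<alpha> j) - ln (1 - (cmod (\<alpha> j))\<^sup>2))) \<longlonglongrightarrow> L \<and>
          (\<bar>L\<bar> \<noteq> \<infinity> \<longleftrightarrow> \<bar>rel_entropy ?\<eta> \<mu>\<bar> \<noteq> \<infinity>)"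
    proof (cases "\<bar>rel_entropy ?\<eta> \<mu>\<bar> = \<infinity>")
      case False
      note fin = rel_entropy_finite[OF g.circle_weight_axioms g_pos \<eta> False]
      obtain l where l: "S \<longlonglongrightarrow> l" using fin(2) by (auto simp: S_def[abs_def])
      \<comment> \<open>The shift by \<open>d\<close> removes the natural-number subtraction in
        \<open>R\<close>. By Rakhmanov's theorem the arguments of both values of \<open>G\<close>
        tend to 0, so the values approach the same limit.\<close>
      have "(\<lambda>n. R (n + d)) \<longlonglongrightarrow> (\<Sum>i<d. Re (cp_eval G (\<lambda>_. 0)) - Re (cp_eval G (\<lambda>_. 0)))"
        unfolding R_def cp_shift_def
      proof (intro tendsto_sum tendsto_diff tendsto_Re tendsto_cp_eval)
        fix i l
        have a: "(\<lambda>n. \<alpha> (n + (i + l))) \<longlonglongrightarrow> 0" by (rule LIMSEQ_ignore_initial_segment[OF fin(1)])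
        then show "(\<lambda>n. \<alpha> (n + d - d + i + l)) \<longlonglongrightarrow> 0" by (simp add: add.assoc)
        show "(\<lambda>n. vtrunc \<alpha> (n + d) (n + d - d + i + l)) \<longlonglongrightarrow> 0"
          by (rule Lim_null_comparison[OF _ tendsto_norm_zero[OF a]]) (simp add: vtrunc_def add.assoc)
      qed
      then have "(\<lambda>n. R (n + d)) \<longlonglongrightarrow> 0" by simp
      then have "R \<longlonglongrightarrow> 0" by (rule LIMSEQ_offset)
      then have "(\<lambda>n. S n + (R n - K)) \<longlonglongrightarrow> l + (0 - K)" by (intro tendsto_intros l)
      then have "A \<longlonglongrightarrow> l - K" using ev by (subst tendsto_cong[OF ev]) simp
      then have "(\<lambda>N. ereal (A (Suc N))) \<longlonglongrightarrow> ereal (l - K)" by (intro tendsto_intros LIMSEQ_Suc)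
      then show ?thesis using False by (intro exI[of _ "ereal (l - K)"]) (simp add: A_sum)
    next
      case True
      have S: "filterlim S at_top sequentially"
        using rel_entropy_infinite[OF g.circle_weight_axioms g_pos \<eta> True] by (simp add: S_def[abs_def])
      define B where "B = (\<Sum>e\<in>Poly_Mapping.keys G. cmod (Poly_Mapping.lookup G e))"
      have bound: "\<bar>Re (cp_shift G x j)\<bar> \<le> B" if "\<And>i. cmod (x i) \<le> 1" for x j
        unfolding cp_shift_def B_def
        using abs_Re_le_cmod norm_cp_eval_le[of "\<lambda>i. x (j + i)" G] that order_trans by blast
      \<comment> \<open>Here \<alpha> need not tend to 0, but a lower bound on the error that is
        uniform in \<open>n\<close> is enough for divergence.\<close>
      have R_bound: "- (\<Sum>i<d. 2 * B) \<le> R n" for n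
      proof -
        have "(\<Sum>i<d. - (2 * B)) \<le> R n"
          unfolding R_def
        proof (rule sum_mono)
          fix i
          have "\<bar>Re (cp_shift G \<alpha> (n - d + i))\<bar> \<le> B" "\<bar>Re (cp_shift G (vtrunc \<alpha> n) (n - d + i))\<bar> \<le> B"
            using \<alpha> by (auto intro!: bound simp: vtrunc_def less_imp_le)
          then show "- (2 * B) \<le> Re (cp_shift G \<alpha> (n - d + i)) - Re (cp_shift G (vtrunc \<alpha> n) (n - d + i))"
            by linarith
        qed
        then show ?thesis by (simp add: sum_negf)
      qed
      have "filterlim (\<lambda>n. (- (\<Sum>i<d. 2 * B) - K) + S n) at_top sequentially"
        by (rule filterlim_tendsto_add_at_top[OF tendsto_const S])
      then have "filterlim A at_top sequentially"
      proof (rule filterlim_at_top_mono)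
        show "eventually (\<lambda>n. (- (\<Sum>i<d. 2 * B) - K) + S n \<le> A n) sequentially"
          using ev
        proof eventually_elim
          case (elim n)
          then show ?case using R_bound[of n] by linarith
        qed
      qed
      then have "filterlim (\<lambda>N. A (Suc N)) at_top sequentially"
        by (rule filterlim_compose[OF _ filterlim_Suc])
      then have "(\<lambda>N. ereal (A (Suc N))) \<longlonglongrightarrow> \<infinity>" by (simp add: tendsto_PInfty_eq_at_top)
      then show ?thesis using True by (intro exI[of _ \<infinity>]) (simp add: A_sum)
    qed
  qed
qed

end
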